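(* For any $n\in\mathbb{N}$, there exists a non-abelian finite simple group $G$ of minimal depth $\lambda(G)=3$ such that $l(G)>n$. In fact, one may take $G={\rm L}_2(p)$ for a suitable prime $p$.
   Context: For a finite group $G$, an unrefinable chain of length $t$ is a chain of subgroups $G=G_0>G_1>\cdots>G_{t-1}>G_t=1$ in which each $G_i$ is a maximal subgroup of $G_{i-1}$. The depth $\lambda(G)$ is the minimal length of an unrefinable chain of $G$. The length $l(G)$ is the maximal length of a strictly descending chain of subgroups from $G$ to $1$. Here ${\rm L}_2(p)={\rm PSL}_2(p)$. (Every non-abelian finite simple group has depth at least $3$, so depth $3$ is called minimal depth.) *)

theory Defs
  imports "HOL-Algebra.SimpleGroups" "HOL-Number_Theory.Residues"
begin

definition maximal_subgroup :: "'a set \<Rightarrow> ('a, 'b) monoid_scheme \<Rightarrow> bool" where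
  "maximal_subgroup M G \<longleftrightarrow>
     subgroup M G \<and> M \<noteq> carrier G \<and>
     (\<forall>K. subgroup K G \<and> M \<subseteq> K \<longrightarrow> K = M \<or> K = carrier G)"

text \<open>
  A chain of length \<open>t\<close> has \<open>t + 1\<close> terms \<open>C 0, \<dots>, C t\<close>; values of \<open>C\<close> beyond \<open>t\<close> are irrelevant.
\<close>

definition subgroup_chain :: "('a, 'b) monoid_scheme \<Rightarrow> nat \<Rightarrow> (nat \<Rightarrow> 'a set) \<Rightarrow> bool" where
  "subgroup_chain G t C \<longleftrightarrow>
     C 0 = carrier G \<and> C t = {\<one>\<^bsub>G\<^esub>} \<and>
     (\<forall>i\<le>t. subgroup (C i) G) \<and>
     (\<forall>i<t. C (Suc i) \<subset> C i)"

definition unrefinable_chain :: "('a, 'b) monoid_scheme \<Rightarrow> nat \<Rightarrow> (nat \<Rightarrow> 'a set) \<Rightarrow> bool" where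
  "unrefinable_chain G t C \<longleftrightarrow>
     C 0 = carrier G \<and> C t = {\<one>\<^bsub>G\<^esub>} \<and>
     (\<forall>i<t. maximal_subgroup (C (Suc i)) (G\<lparr>carrier := C i\<rparr>))"

text \<open>
  The next two definitions are meaningful for finite groups only: there unrefinable chains exist, and
  the lengths of subgroup chains form a finite nonempty set.
\<close>

definition group_depth :: "('a, 'b) monoid_scheme \<Rightarrow> nat" where
  "group_depth G = (LEAST t. \<exists>C. unrefinable_chain G t C)"

definition group_length :: "('a, 'b) monoid_scheme \<Rightarrow> nat" where
  "group_length G = Max {t. \<exists>C. subgroup_chain G t C}"

definition group_center :: "('a, 'b) monoid_scheme \<Rightarrow> 'a set" where
  "group_center G = {z \<in> carrier G. \<forall>g \<in> carrier G. z \<otimes>\<^bsub>G\<^esub> g = g \<otimes>\<^bsub>G\<^esub> z}"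

text \<open>
  The quadruple \<open>(a, b, c, d)\<close> stands for the matrix with rows \<open>(a, b)\<close> and \<open>(c, d)\<close>.
\<close>

definition SL2 :: "('a, 'b) ring_scheme \<Rightarrow> ('a \<times> 'a \<times> 'a \<times> 'a) monoid" where
  "SL2 R =
     \<lparr>carrier = {(a, b, c, d). a \<in> carrier R \<and> b \<in> carrier R \<and> c \<in> carrier R \<and> d \<in> carrier R \<and>
                  a \<otimes>\<^bsub>R\<^esub> d \<ominus>\<^bsub>R\<^esub> b \<otimes>\<^bsub>R\<^esub> c = \<one>\<^bsub>R\<^esub>},
      monoid.mult = (\<lambda>(a, b, c, d) (a', b', c', d').
        (a \<otimes>\<^bsub>R\<^esub> a' \<oplus>\<^bsub>R\<^esub> b \<otimes>\<^bsub>R\<^esub> c', a \<otimes>\<^bsub>R\<^esub> b' \<oplus>\<^bsub>R\<^esub> b \<otimes>\<^bsub>R\<^esub> d',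
         c \<otimes>\<^bsub>R\<^esub> a' \<oplus>\<^bsub>R\<^esub> d \<otimes>\<^bsub>R\<^esub> c', c \<otimes>\<^bsub>R\<^esub> b' \<oplus>\<^bsub>R\<^esub> d \<otimes>\<^bsub>R\<^esub> d')),
      one = (\<one>\<^bsub>R\<^esub>, \<zero>\<^bsub>R\<^esub>, \<zero>\<^bsub>R\<^esub>, \<one>\<^bsub>R\<^esub>)\<rparr>"

definition PSL2 :: "('a, 'b) ring_scheme \<Rightarrow> ('a \<times> 'a \<times> 'a \<times> 'a) set monoid" where
  "PSL2 R = SL2 R Mod group_center (SL2 R)"

text \<open>For prime \<open>p\<close>, \<^term>\<open>residue_ring (int p)\<close> is the field with \<open>p\<close> elements.\<close>

abbreviation L2 :: "nat \<Rightarrow> (int \<times> int \<times> int \<times> int) set monoid" where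
  "L2 p \<equiv> PSL2 (residue_ring (int p))"

end

theory Submission
  imports Defs "HOL-Number_Theory.Number_Theory"
begin

text \<open>
  The group will be $L_2(p)$ for a prime $p$ with $p \equiv \pm 3$ modulo $8$ and $p \equiv \pm 2$ modulo
  $5$ such that $L_2(p)$ has an element of order $3^m$ with $m$ large. The powers of that element give
  a long chain of subgroups (\<open>group_length_ge_prime_power\<close>). The two congruences
  make a subgroup $A_4$ of $L_2(p)$ maximal, and then $L_2(p) > A_4 > C_3 > 1$ is unrefinable.

  \<^bold>\<open>The prime.\<close> Primes in a residue class could be found with Dirichlet's theorem, but here an explicit
  number does the work. Let $x$ be a matrix of determinant $1$ and trace $41/2$. Since
  $\mathrm{tr}(y^3) = \mathrm{tr}(y)^3 - 3\,\mathrm{tr}(y)$, the trace of $x^{3^j}$ is an explicit fraction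
  $a_j/2^{3^j}$. If a prime $p$ divides $a_j + 2^{3^j}$, then modulo $p$ this trace is $-1$, so that $x^{3^j}$
  has order $3$ and $x$ has order $3^{j+1}$. As $a_j + 2^{3^j} \equiv 5$ modulo $8$ for $j > 0$, some such $p$ is $\pm 3$
  modulo $8$ (\<open>exists_suitable_prime\<close>), and $2$ is not a square modulo $p$. Being of odd order,
  $x$ is the square of a power $s$ of itself, so $\mathrm{tr}(s)^2 = \mathrm{tr}(x) + 2 = 45/2$ and
  $90 = 10 \cdot 3^2$ is a square modulo $p$. Hence $5$ is not a square, that is $p \equiv \pm 2$ modulo $5$
  (\<open>residue_mod_5\<close>). The value $41/2$ is chosen such that $10(\mathrm{tr}(x) + 2)$ is a square, namely
  $15^2$.

  \<^bold>\<open>Maximality of $A_4$.\<close> All work takes place in $SL_2(p)$, whose subgroups containing the center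
  $\{1, -1\}$ correspond to the subgroups of $L_2(p)$. The preimage of $A_4$ is generated by a
  quaternion $i$ and the element $r = -(1+i+j+k)/2$ of order $3$. Let $H$ be any subgroup containing both.
  If $H$ contains a non-central element of trace $\pm 2$, then its conjugates under $i, j, k$ give two transvection
  groups with different axes, which generate $SL_2(p)$ (\<open>overgroup_of_quaternions\<close>). Otherwise centralizers of
  non-central elements of $H$ partition $H$ outside the center, each has index at most $2$ in its normalizer, and
  counting the conjugates of these centralizers leads to the Diophantine equation behind the list of the finite
  rotation groups. Its solutions are the dihedral groups, excluded by the element $r$, and the orders $12$, $24$
  and $60$ modulo the center; the last two are impossible because neither $16$ nor $5$ divides $p(p^2-1)$.
  So $H$ has order $24$ (\<open>order_24\<close>, \<open>card_overgroup\<close>), and there is nothing strictly between.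

  \<^bold>\<open>Simplicity and lower bound.\<close> A normal subgroup of $SL_2(p)$ with a non-central element contains
  transvections (\<open>normal_subgroup_SL2\<close>). A chain of length $2$ would make a group of prime order maximal; such a group is
  the image of the centralizer of a matrix, and that centralizer is properly normalized by a further matrix
  (\<open>normalizing_element\<close>), so it would be normal in $SL_2(p)$ (\<open>not_cyclic_maximal\<close>).
\<close>

section \<open>A prime with prescribed quadratic residues\<close>

text \<open>
  Modulo $8$ the classes $1$ and $7$ are closed under multiplication, so not all prime factors can lie there.
\<close>

lemma prime_factor_3_5_mod_8:
  fixes n :: nat
  assumes "n mod 8 = 3 \<or> n mod 8 = 5"
  obtains q where "prime q" "q dvd n" "q mod 8 = 3 \<or> q mod 8 = 5"
proof -
  have "\<exists>q. prime q \<and> q dvd n \<and> (q mod 8 = 3 \<or> q mod 8 = 5)" using assms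
  proof (induction n rule: less_induct)
    case (less n)
    have "n \<noteq> 0" "n \<noteq> 1" using less.prems by auto
    then obtain q where q: "prime q" "q dvd n" using prime_factor_nat by blast
    then obtain m where m: "n = q * m" by blast
    show ?case
    proof (cases "q mod 8 = 3 \<or> q mod 8 = 5")
      case True then show ?thesis using q by blast
    next
      case False
      have "odd n"
      proof
        assume "even n"
        then have "even (n mod 8)" by presburger
        then show False using less.prems by auto
      qed
      then have "odd q" using m by simp
      then have "q mod 8 = 1 \<or> q mod 8 = 7" using False by presburger
      moreover have "n mod 8 = ((q mod 8) * (m mod 8)) mod 8" by (simp add: m mod_mult_eq)
      moreover have "m mod 8 = 0 \<or> m mod 8 = 1 \<or> m mod 8 = 2 \<or> m mod 8 = 3 \<or> m mod 8 = 4 \<or> m mod 8 = 5 \<or> m mod 8 = 6 \<or> m mod 8 = 7" by presburger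
      ultimately have "m mod 8 = 3 \<or> m mod 8 = 5" using less.prems
        by (elim disjE) simp_all
      moreover have "m < n" using m \<open>n \<noteq> 0\<close> prime_gt_1_nat[OF q(1)] by simp
      ultimately obtain r where "prime r" "r dvd m" "r mod 8 = 3 \<or> r mod 8 = 5" using less.IH by blast
      then show ?thesis using m by (metis dvd_mult)
    qed
  qed
  then show thesis using that by blast
qed

text \<open>
  Infinite descent: a square root of $2$ modulo $p$ can be taken odd and smaller than $p$, say $z$. Then
  $z^2 - 2 = pq$ with $q < p$ is $7$ modulo $8$, so $q$ is again $3$ or $5$ modulo $8$ and has
  a smaller prime factor of that kind, modulo which $2$ is still a square.
\<close>

lemma two_nonresidue:
  fixes p :: nat
  assumes "prime p" "p mod 8 = 3 \<or> p mod 8 = 5"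
  shows "\<not> [x\<^sup>2 = 2] (mod int p)"
  using assms
proof (induction p arbitrary: x rule: less_induct)
  case (less p)
  show ?case
  proof
    assume x: "[x\<^sup>2 = 2] (mod int p)"
    have p: "odd (int p)" "0 < int p" "p \<ge> 3" 
    proof -
      have "odd p" using less.prems(2) by presburger
      then show "odd (int p)" by simp
      show "0 < int p" using less.prems(1) prime_gt_0_nat by simp
      show "p \<ge> 3" using less.prems(2) by presburger
    qed
    define y where "y = x mod int p"
    \<comment> \<open>An odd representative makes $z^2 - 2$ equal to $-1$ modulo $8$.\<close>
    define z where "z = (if odd y then y else int p - y)"
    have y: "0 \<le> y" "y < int p" "[y\<^sup>2 = 2] (mod int p)"
      using p x by (auto simp: y_def cong_def power_mod)
    have "(int p - y)\<^sup>2 = y\<^sup>2 + int p * (int p - 2 * y)" by (simp add: power2_eq_square algebra_simps)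
    then have "[(int p - y)\<^sup>2 = y\<^sup>2] (mod int p)" by (simp add: cong_iff_dvd_diff)
    moreover have "odd y \<Longrightarrow> y \<noteq> 0" by auto
    ultimately have z: "0 < z" "z \<le> int p" "odd z" "[z\<^sup>2 = 2] (mod int p)"
      using y p \<open>odd y \<Longrightarrow> y \<noteq> 0\<close> by (auto simp: z_def intro: cong_trans)
    have "z \<noteq> int p"
    proof
      assume "z = int p"
      then have "int p dvd 2" using z(4) by (simp add: cong_iff_dvd_diff dvd_diff_right_iff)
      then show False using p(3) zdvd_imp_le[of "int p" 2] by simp
    qed
    then have zp: "z < int p" using z by simp
    have "z \<noteq> 1" using z(4) p(3) zdvd_imp_le[of "int p" 1] by (auto simp: cong_iff_dvd_diff)
    then have z3: "z \<ge> 3" using z by presburger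
    obtain q' where q': "z\<^sup>2 - 2 = int p * q'" using z(4) by (auto simp: cong_iff_dvd_diff)
    have "z\<^sup>2 \<ge> 3 * 3" unfolding power2_eq_square using z3 by (intro mult_mono) auto
    then have "int p * q' > 0" using q' by simp
    then have "q' > 0" using p(2) zero_less_mult_pos by blast
    then obtain q where q: "q' = int q" "q > 0" by (metis pos_int_cases)
    have eq: "z\<^sup>2 - 2 = int p * int q" using q' q by simp
    have "int p * int q < int p * int p"
      using eq zp z by (smt (verit) mult_strict_mono power2_eq_square)
    then have qp: "q < p" using p(2) by (simp flip: of_nat_mult)
    obtain w where w: "z = 2 * w + 1" using z(3) by (rule oddE)
    obtain v where v: "w * (w + 1) = 2 * v" using even_mult_iff[of w "w+1"] by (meson even_plus_one_iff evenE)
    have "z\<^sup>2 - 2 = 8 * v - 1" using v by (simp add: w power2_eq_square algebra_simps)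
    then have "(int p * int q) mod 8 = 7" using eq by presburger
    then have m: "(p * q) mod 8 = 7" by (metis of_nat_mult of_nat_mod of_nat_numeral of_nat_eq_iff)
    have "(p mod 8) * (q mod 8) mod 8 = 7" using m by (simp add: mod_mult_eq)
    moreover have "q mod 8 = 0 \<or> q mod 8 = 1 \<or> q mod 8 = 2 \<or> q mod 8 = 3 \<or> q mod 8 = 4 \<or> q mod 8 = 5 \<or> q mod 8 = 6 \<or> q mod 8 = 7" by presburger
    ultimately have "q mod 8 = 3 \<or> q mod 8 = 5" using less.prems(2)
      by (elim disjE) simp_all
    then obtain r where r: "prime r" "r dvd q" "r mod 8 = 3 \<or> r mod 8 = 5" by (rule prime_factor_3_5_mod_8)
    have "r < p" using dvd_imp_le[OF r(2) q(2)] qp by simp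
    moreover have "[z\<^sup>2 = 2] (mod int r)" unfolding cong_iff_dvd_diff eq using r(2) by simp
    ultimately show False using less.IH r by blast
  qed
qed

text \<open>
  If $10$ is a square and $2$ is not, then $5$ is not a square modulo $p$, and reciprocity turns this into a
  statement on $p$ modulo $5$.
\<close>

lemma residue_mod_5:
  fixes p :: nat
  assumes "prime p" "p > 5" "p mod 8 = 3 \<or> p mod 8 = 5" "[s\<^sup>2 = 10 * t\<^sup>2] (mod int p)" "\<not> int p dvd t"
  shows "p mod 5 = 2 \<or> p mod 5 = 3"
proof -
  have "coprime t (int p)" using assms(1,5)
    by (metis coprime_commute prime_imp_coprime prime_nat_int_transfer)
  then obtain i where i: "[t * i = 1] (mod int p)" using cong_solve_coprime_int by blast
  have ten: "[(s * i)\<^sup>2 = 10] (mod int p)"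
  proof -
    have "[s\<^sup>2 * i\<^sup>2 = 10 * t\<^sup>2 * i\<^sup>2] (mod int p)" using assms(4) by (rule cong_scalar_right)
    moreover have "[10 * (t * i)\<^sup>2 = 10 * 1\<^sup>2] (mod int p)" using i by (intro cong_scalar_left cong_pow)
    ultimately show ?thesis by (simp add: power_mult_distrib mult.assoc cong_trans)
  qed
  have "\<not> [y\<^sup>2 = 5] (mod int p)" for y
  proof
    assume y: "[y\<^sup>2 = 5] (mod int p)"
    have "\<not> int p dvd y"
    proof
      assume "int p dvd y"
      then have "[y\<^sup>2 = 0] (mod int p)" by (simp add: cong_0_iff power2_eq_square)
      then have "int p dvd 5" using y by (metis cong_0_iff cong_sym cong_trans)
      then show False using assms(2) zdvd_imp_le[of "int p" 5] by simp
    qed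
    then have "coprime y (int p)" using assms(1)
      by (metis coprime_commute prime_imp_coprime prime_nat_int_transfer)
    then obtain j where j: "[y * j = 1] (mod int p)" using cong_solve_coprime_int by blast
    have "[(s * i)\<^sup>2 * j\<^sup>2 = 10 * j\<^sup>2] (mod int p)" using ten by (rule cong_scalar_right)
    moreover have "[y\<^sup>2 * (2 * j\<^sup>2) = 5 * (2 * j\<^sup>2)] (mod int p)" using y by (rule cong_scalar_right)
    moreover have "[2 * (y * j)\<^sup>2 = 2 * 1\<^sup>2] (mod int p)" using j by (intro cong_scalar_left cong_pow)
    ultimately have "[(s * i * j)\<^sup>2 = 2] (mod int p)"
      by (simp add: power_mult_distrib mult_ac) (meson cong_sym cong_trans)
    then show False using two_nonresidue assms by blast
  qed
  then have "\<not> QuadRes (int p) 5" by (simp add: QuadRes_def)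
  moreover have "\<not> [5 = 0] (mod int p)" using assms(2) zdvd_imp_le[of "int p" 5] by (auto simp: cong_0_iff)
  ultimately have "Legendre 5 (int p) = -1" by (simp add: Legendre_def)
  moreover have "Legendre (int p) (int 5) * Legendre (int 5) (int p) = (-1) ^ ((p - 1) div 2 * ((5 - 1) div 2))"
    using assms by (intro Quadratic_Reciprocity) auto
  ultimately have L: "Legendre (int p) 5 = -1" by (simp add: power_mult mult.commute)
  then have nq: "\<not> QuadRes 5 (int p)" "\<not> [int p = 0] (mod 5)" by (auto simp: Legendre_def split: if_splits)
  have "\<not> [int p = 1] (mod 5)" 
  proof
    assume "[int p = 1] (mod 5)"
    then have "[1\<^sup>2 = int p] (mod 5)" by (simp add: cong_sym_eq)
    then show False using nq(1) unfolding QuadRes_def by blast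
  qed
  moreover have "\<not> [int p = 4] (mod 5)"
  proof
    assume "[int p = 4] (mod 5)"
    then have "[2\<^sup>2 = int p] (mod 5)" by (simp add: cong_sym_eq)
    then show False using nq(1) unfolding QuadRes_def by blast
  qed
  ultimately have "int p mod 5 \<noteq> 0" "int p mod 5 \<noteq> 1" "int p mod 5 \<noteq> 4" using nq(2) by (auto simp: cong_def)
  then show ?thesis by presburger
qed

text \<open>
  The numerator, over the denominator $2^{3^j}$, of the trace of $x^{3^j}$ for a matrix $x$ of determinant $1$ and
  trace $41/2$; the recursion is $t \mapsto t^3 - 3t$ with denominators cleared.
\<close>

fun trace_num :: "nat \<Rightarrow> int" where
  "trace_num 0 = 41"
| "trace_num (Suc j) = trace_num j ^ 3 - 3 * (2 ^ (3 ^ j)) ^ 2 * trace_num j"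

lemma trace_num_mod_3: "trace_num j mod 3 = 2"
proof (induction j)
  case (Suc j)
  have "trace_num j ^ 3 mod 3 = (trace_num j mod 3) ^ 3 mod 3" by (simp add: power_mod)
  then have "trace_num j ^ 3 mod 3 = 2" using Suc by simp
  moreover have "trace_num (Suc j) mod 3 = trace_num j ^ 3 mod 3" by (simp add: mod_diff_eq[symmetric, of "trace_num j ^ 3"] mult.assoc)
  ultimately show ?case by simp
qed simp

lemma eight_dvd_two_pow: "(8::int) dvd 2 ^ (3 ^ Suc j)"
proof -
  have "(3::nat) \<le> 3 ^ Suc j" by simp
  then have "(2::int) ^ 3 dvd 2 ^ (3 ^ Suc j)" by (rule le_imp_power_dvd)
  then show ?thesis by simp
qed

text \<open>
  The initial value is $1$ modulo $8$. The denominator $2$ of the first step contributes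
  $-12 \cdot 41 \equiv 4$, and every later step is $t \mapsto t^3$, because $8$ divides the later denominators.
\<close>

lemma trace_num_mod_8: "trace_num (Suc j) mod 8 = 5"
proof (induction j)
  case (Suc j)
  have "(8::int) dvd 2 ^ (3 ^ Suc j)" by (rule eight_dvd_two_pow)
  then obtain k where k: "(2::int) ^ (3 ^ Suc j) = 8 * k" by blast
  have "trace_num (Suc (Suc j)) = trace_num (Suc j) ^ 3 - 8 * (3 * k * (8 * k) * trace_num (Suc j))"
    unfolding trace_num.simps(2)[of "Suc j"] k by (simp add: power2_eq_square)
  then have "trace_num (Suc (Suc j)) mod 8 = trace_num (Suc j) ^ 3 mod 8" by (metis mod_diff_right_eq mod_mult_self1_is_0 diff_zero)
  also have "\<dots> = (trace_num (Suc j) mod 8) ^ 3 mod 8" by (simp add: power_mod)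
  also have "\<dots> = 5" unfolding Suc by simp
  finally show ?case .
qed simp

lemma trace_num_mod_5: "trace_num j mod 5 = 1 \<and> 2 ^ (3 ^ j) mod 5 = (2::int) \<or> trace_num j mod 5 = 4 \<and> 2 ^ (3 ^ j) mod 5 = (3::int)"
proof (induction j)
  case (Suc j)
  define n where "n = trace_num j"
  define t :: int where "t = 2 ^ (3 ^ j)"
  have t: "2 ^ (3 ^ Suc j) = t ^ 3" by (simp add: t_def flip: power_mult)
  have n: "trace_num (Suc j) = n ^ 3 - 3 * t ^ 2 * n" by (simp add: n_def t_def)
  have "n mod 5 = 1 \<and> t mod 5 = 2 \<or> n mod 5 = 4 \<and> t mod 5 = 3" using Suc by (simp add: n_def t_def)
  then show ?case
  proof
    assume "n mod 5 = 1 \<and> t mod 5 = 2"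
    then have c: "[n = 1] (mod 5)" "[t = 2] (mod 5)" by (auto simp: cong_def)
    have "[n ^ 3 - 3 * t ^ 2 * n = 1 ^ 3 - 3 * 2 ^ 2 * 1] (mod 5)"
      using c by (intro cong_diff cong_mult cong_pow cong_refl)
    moreover have "[t ^ 3 = 2 ^ 3] (mod 5)" using c by (intro cong_pow)
    ultimately show ?thesis unfolding n t by (simp add: cong_def)
  next
    assume "n mod 5 = 4 \<and> t mod 5 = 3"
    then have c: "[n = 4] (mod 5)" "[t = 3] (mod 5)" by (auto simp: cong_def)
    have "[n ^ 3 - 3 * t ^ 2 * n = 4 ^ 3 - 3 * 3 ^ 2 * 4] (mod 5)"
      using c by (intro cong_diff cong_mult cong_pow cong_refl)
    moreover have "[t ^ 3 = 3 ^ 3] (mod 5)" using c by (intro cong_pow)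
    ultimately show ?thesis unfolding n t by (simp add: cong_def)
  qed
qed simp

text \<open>
  The congruences modulo $3$ and $5$ serve to exclude the two small primes $3$ and $5$, which would satisfy the condition
  modulo $8$ as well.
\<close>

lemma exists_suitable_prime:
  obtains p :: nat where "prime p" "p > 5" "p mod 8 = 3 \<or> p mod 8 = 5"
    "[trace_num (Suc j) + 2 ^ (3 ^ Suc j) = 0] (mod int p)"
proof -
  define M where "M = trace_num (Suc j) + 2 ^ (3 ^ Suc j)"
  have "(8::int) dvd 2 ^ (3 ^ Suc j)" by (rule eight_dvd_two_pow)
  then have M8: "M mod 8 = 5" using trace_num_mod_8[of j] unfolding M_def by presburger
  have "((2::int) ^ (3 ^ Suc j)) mod 3 = 2"
  proof -
    have "odd ((3::nat) ^ Suc j)" by simp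
    then obtain m where m: "(3::nat) ^ Suc j = 2 * m + 1" by (rule oddE)
    have "(2::int) ^ (3 ^ Suc j) = 2 * 4 ^ m" unfolding m by (simp add: power_mult)
    moreover have "(4::int) ^ m mod 3 = 1" using power_mod[of "4::int" 3 m] by simp
    ultimately show ?thesis by presburger
  qed
  then have M3: "M mod 3 = 1" using trace_num_mod_3[of "Suc j"] unfolding M_def by presburger
  have "\<bar>M\<bar> mod 8 = 3 \<or> \<bar>M\<bar> mod 8 = 5" using M8 by presburger
  then have "nat \<bar>M\<bar> mod 8 = 3 \<or> nat \<bar>M\<bar> mod 8 = 5" 
    using nat_mod_distrib[of "\<bar>M\<bar>" 8] by auto
  then obtain p where p: "prime p" "p dvd nat \<bar>M\<bar>" "p mod 8 = 3 \<or> p mod 8 = 5"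
    by (rule prime_factor_3_5_mod_8)
  have dvd: "int p dvd M" using p(2) by (metis dvd_abs_iff int_dvd_int_iff int_nat_eq abs_ge_zero)
  have "p \<noteq> 3" using dvd M3 by auto
  moreover have "p \<noteq> 5"
  proof
    assume "p = 5"
    then have "M mod 5 = 0" using dvd by auto
    then show False using trace_num_mod_5[of "Suc j"] unfolding M_def by presburger
  qed
  moreover have "p > 2" using p(1,3) prime_ge_2_nat[OF p(1)] by (cases "p = 2") auto
  moreover have "p \<noteq> 4" using p(3) by auto
  ultimately have "p > 5" by linarith
  then show thesis using that p dvd by (simp add: M_def cong_0_iff)
qed

section \<open>Conjugation, centralizers and index two\<close>

lemma (in group) left_cancel:
  "\<lbrakk>x \<in> carrier G; y \<in> carrier G; z \<in> carrier G\<rbrakk> \<Longrightarrow> x \<otimes> y = x \<otimes> z \<longleftrightarrow> y = z"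
  using Units_l_cancel by simp

lemma (in group) card_left_translate:
  assumes "x \<in> carrier G" "K \<subseteq> carrier G"
  shows "card ((\<lambda>k. x \<otimes> k) ` K) = card K"
proof (rule card_image, rule inj_onI)
  fix a b assume "a \<in> K" "b \<in> K" "x \<otimes> a = x \<otimes> b"
  then show "a = b" using left_cancel[of x a b] assms by blast
qed

lemma (in group) card_subgroup_dvd:
  assumes "subgroup A G" "subgroup B G" "A \<subseteq> B"
  shows "card A dvd card B"
proof -
  interpret B: group "G\<lparr>carrier := B\<rparr>" using assms(2) subgroup_imp_group by blast
  have "card (rcosets\<^bsub>G\<lparr>carrier := B\<rparr>\<^esub> A) * card A = card B"
    using B.lagrange[OF subgroup_incl[OF assms]] by (simp add: order_def)
  then show ?thesis by (metis dvd_triv_right)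
qed

lemma (in group) subgroup_nat_pow:
  assumes "subgroup K G" "x \<in> K" shows "x [^] (n::nat) \<in> K"
  using assms by (induction n) (auto intro: subgroup.one_closed subgroup.m_closed)

lemma (in group) conj_eqI:
  assumes "g \<in> carrier G" "y \<in> carrier G" "g \<otimes> x = y \<otimes> g"
  shows "g \<otimes> x \<otimes> inv g = y"
  using assms by (simp add: m_assoc)

lemma (in group) conj_commute_iff:
  assumes "x \<in> carrier G" "y \<in> carrier G" "g \<in> carrier G"
  shows "(g \<otimes> x \<otimes> inv g) \<otimes> (g \<otimes> y \<otimes> inv g) = (g \<otimes> y \<otimes> inv g) \<otimes> (g \<otimes> x \<otimes> inv g) \<longleftrightarrow> x \<otimes> y = y \<otimes> x"
proof -
  have *: "(g \<otimes> x \<otimes> inv g) \<otimes> (g \<otimes> y \<otimes> inv g) = g \<otimes> (x \<otimes> y) \<otimes> inv g" if "x \<in> carrier G" "y \<in> carrier G" for x y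
    using that assms(3) by (metis inv_closed inv_solve_right m_assoc m_closed)
  show ?thesis unfolding *[OF assms(1,2)] *[OF assms(2,1)]
    using assms by (metis inv_closed left_cancel m_closed right_cancel)
qed

lemma (in group) conj_conj:
  assumes "x \<in> carrier G" "g \<in> carrier G" "h \<in> carrier G"
  shows "g \<otimes> (h \<otimes> x \<otimes> inv h) \<otimes> inv g = (g \<otimes> h) \<otimes> x \<otimes> inv (g \<otimes> h)"
  using assms by (simp add: inv_mult_group m_assoc)

lemma (in group) conj_inv_conj:
  assumes "x \<in> carrier G" "g \<in> carrier G"
  shows "inv g \<otimes> (g \<otimes> x \<otimes> inv g) \<otimes> g = x"
  using assms by (metis conj_conj inv_closed inv_inv l_inv l_one inv_one r_one)

lemma (in group) conj_cube:
  assumes "g \<in> carrier G" "x \<in> carrier G" "x \<otimes> x \<otimes> x = \<one>"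
  shows "(g \<otimes> x \<otimes> inv g) \<otimes> (g \<otimes> x \<otimes> inv g) \<otimes> (g \<otimes> x \<otimes> inv g) = \<one>"
proof -
  have *: "(g \<otimes> y \<otimes> inv g) \<otimes> (g \<otimes> z \<otimes> inv g) = g \<otimes> (y \<otimes> z) \<otimes> inv g" if "y \<in> carrier G" "z \<in> carrier G" for y z
    using that assms(1) by (metis inv_closed inv_solve_right m_assoc m_closed)
  show ?thesis using assms by (simp add: *)
qed

text \<open>
  An element of order $3$ is a square twice over; this puts it into every subgroup of index $2$.
\<close>

lemma (in group) square_square_of_cube:
  assumes "x \<in> carrier G" "x \<otimes> x \<otimes> x = \<one>"
  shows "(x \<otimes> x) \<otimes> (x \<otimes> x) = x"
  using assms by (metis l_one m_assoc m_closed)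

lemma (in group) conj_subgroup:
  assumes "subgroup H G" "g \<in> carrier G"
  shows "subgroup {y \<in> carrier G. g \<otimes> y \<otimes> inv g \<in> H} G"
proof -
  interpret H: subgroup H G by fact
  show ?thesis
  proof (rule subgroupI)
    show "{y \<in> carrier G. g \<otimes> y \<otimes> inv g \<in> H} \<noteq> {}" using assms one_closed H.one_closed
      by (metis (mono_tags, lifting) r_inv r_one empty_iff mem_Collect_eq)
  next
    fix a assume "a \<in> {y \<in> carrier G. g \<otimes> y \<otimes> inv g \<in> H}"
    then have a: "a \<in> carrier G" "g \<otimes> a \<otimes> inv g \<in> H" by auto
    have "inv (g \<otimes> a \<otimes> inv g) = g \<otimes> inv a \<otimes> inv g"
      using a assms(2) by (simp add: inv_mult_group m_assoc)
    then show "inv a \<in> {y \<in> carrier G. g \<otimes> y \<otimes> inv g \<in> H}"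
      using a H.m_inv_closed by fastforce
  next
    fix a b assume "a \<in> {y \<in> carrier G. g \<otimes> y \<otimes> inv g \<in> H}" "b \<in> {y \<in> carrier G. g \<otimes> y \<otimes> inv g \<in> H}"
    then have a: "a \<in> carrier G" "g \<otimes> a \<otimes> inv g \<in> H"
      and b: "b \<in> carrier G" "g \<otimes> b \<otimes> inv g \<in> H" by auto
    have "(g \<otimes> a \<otimes> inv g) \<otimes> (g \<otimes> b \<otimes> inv g) = g \<otimes> (a \<otimes> b) \<otimes> inv g"
      using a b assms(2) by (metis inv_closed inv_solve_right m_assoc m_closed)
    then show "a \<otimes> b \<in> {y \<in> carrier G. g \<otimes> y \<otimes> inv g \<in> H}"
      using a b H.m_closed by fastforce
  qed auto
qed

text \<open>
  Closure under inverses uses finiteness: conjugation maps the finite set injectively into itself, hence onto itself.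
\<close>

lemma (in group) set_normalizer_subgroup:
  assumes "finite X" "X \<subseteq> carrier G"
  shows "subgroup {x \<in> carrier G. \<forall>q\<in>X. x \<otimes> q \<otimes> inv x \<in> X} G"
proof (rule subgroupI)
  fix x assume "x \<in> {x \<in> carrier G. \<forall>q\<in>X. x \<otimes> q \<otimes> inv x \<in> X}"
  then have x: "x \<in> carrier G" "\<And>q. q \<in> X \<Longrightarrow> x \<otimes> q \<otimes> inv x \<in> X" by auto
  have inv_conj: "inv x \<otimes> (x \<otimes> q \<otimes> inv x) \<otimes> inv (inv x) = q" if "q \<in> carrier G" for q
    using that x(1) by (simp add: m_assoc) (simp flip: m_assoc)
  have "inj_on (\<lambda>q. x \<otimes> q \<otimes> inv x) X"
    using inv_conj assms(2) by (intro inj_onI) (metis subsetD)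
  then have "(\<lambda>q. x \<otimes> q \<otimes> inv x) ` X = X"
    using x(2) assms(1) by (intro endo_inj_surj) auto
  then have "inv x \<otimes> q \<otimes> inv (inv x) \<in> X" if "q \<in> X" for q
    using that inv_conj assms(2) by (smt (verit, best) image_iff subsetD)
  then show "inv x \<in> {x \<in> carrier G. \<forall>q\<in>X. x \<otimes> q \<otimes> inv x \<in> X}" using x(1) by simp
next
  fix x y assume xy: "x \<in> {x \<in> carrier G. \<forall>q\<in>X. x \<otimes> q \<otimes> inv x \<in> X}" "y \<in> {x \<in> carrier G. \<forall>q\<in>X. x \<otimes> q \<otimes> inv x \<in> X}"
  have "(x \<otimes> y) \<otimes> q \<otimes> inv (x \<otimes> y) = x \<otimes> (y \<otimes> q \<otimes> inv y) \<otimes> inv x" if "q \<in> X" for q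
    using that assms(2) xy by (auto simp: inv_mult_group m_assoc)
  then show "x \<otimes> y \<in> {x \<in> carrier G. \<forall>q\<in>X. x \<otimes> q \<otimes> inv x \<in> X}" using xy by simp
next
  have "\<one> \<in> {x \<in> carrier G. \<forall>q\<in>X. x \<otimes> q \<otimes> inv x \<in> X}" using assms(2) by auto
  then show "{x \<in> carrier G. \<forall>q\<in>X. x \<otimes> q \<otimes> inv x \<in> X} \<noteq> {}" by blast
qed auto

definition centralizer :: "('a, 'b) monoid_scheme \<Rightarrow> 'a \<Rightarrow> 'a set" where
  "centralizer H x = {y \<in> carrier H. x \<otimes>\<^bsub>H\<^esub> y = y \<otimes>\<^bsub>H\<^esub> x}"

lemma (in group) centralizer_subgroup:
  assumes "x \<in> carrier G" shows "subgroup (centralizer G x) G"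
proof (rule subgroupI)
  fix a assume "a \<in> centralizer G x"
  then have a: "a \<in> carrier G" "x \<otimes> a = a \<otimes> x" by (auto simp: centralizer_def)
  then have "x \<otimes> inv a = inv a \<otimes> x"
    by (metis assms inv_closed inv_solve_left m_assoc inv_solve_right' m_closed)
  then show "inv a \<in> centralizer G x" using a by (simp add: centralizer_def)
next
  fix a b assume "a \<in> centralizer G x" "b \<in> centralizer G x"
  then show "a \<otimes> b \<in> centralizer G x"
    using assms by (simp add: centralizer_def) (metis m_assoc)
qed (use assms in \<open>auto simp: centralizer_def intro: exI[of _ \<one>]\<close>)

text \<open>
  If $x^2$ were outside $K$, the three cosets $K$, $xK$ and $x^2K$ would be disjoint.
\<close>

lemma (in group) card_index_two_square:
  assumes "finite (carrier G)" "subgroup K G" "order G = 2 * card K" "x \<in> carrier G"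
  shows "x \<otimes> x \<in> K"
proof (rule ccontr)
  assume xx: "x \<otimes> x \<notin> K"
  interpret K: subgroup K G by fact
  have fK: "finite K" using assms(1) K.subset finite_subset by blast
  have x: "x \<notin> K" using xx by blast
  define A B where "A = (\<lambda>k. x \<otimes> k) ` K" and "B = (\<lambda>k. x \<otimes> x \<otimes> k) ` K"
  have cA: "card A = card K" and cB: "card B = card K"
    unfolding A_def B_def using assms(4) K.subset card_left_translate by simp_all
  have KA: "K \<inter> A = {}"
  proof -
    have False if "k \<in> K" "k = x \<otimes> l" "l \<in> K" for k l
      using that x assms(4) by (metis K.m_closed K.m_inv_closed K.mem_carrier inv_solve_right)
    then show ?thesis by (auto simp: A_def)
  qed
  have KB: "K \<inter> B = {}"
  proof -
    have False if "k \<in> K" "k = x \<otimes> x \<otimes> l" "l \<in> K" for k l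
      using that xx assms(4) by (metis K.m_closed K.m_inv_closed K.mem_carrier inv_solve_right m_closed)
    then show ?thesis by (auto simp: B_def)
  qed
  have AB: "A \<inter> B = {}"
  proof -
    have False if "k \<in> K" "x \<otimes> k = x \<otimes> x \<otimes> l" "l \<in> K" for k l
    proof -
      have "k = x \<otimes> l" using that assms(4) by (metis K.mem_carrier left_cancel m_assoc m_closed)
      then show False using that KA by (auto simp: A_def)
    qed
    then show ?thesis by (auto simp: A_def B_def)
  qed
  have "K \<union> A \<union> B \<subseteq> carrier G" using assms(4) K.subset by (auto simp: A_def B_def)
  then have "card (K \<union> A \<union> B) \<le> 2 * card K"
    using assms(1,3) card_mono by (metis order_def)
  moreover have "card (K \<union> A \<union> B) = 3 * card K"
    using fK KA KB AB cA cB by (simp add: card_Un_disjoint A_def B_def Int_Un_distrib2)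
  moreover have "card K > 0" using fK K.one_closed card_gt_0_iff by blast
  ultimately show False by simp
qed

section \<open>Quotients, maximal subgroups and chains\<close>

lemma maximal_subgroup_restrict:
  assumes G: "group G" and S: "subgroup S G" and M: "subgroup M G" "M \<subset> S"
    and max: "\<And>K. \<lbrakk>subgroup K G; M \<subseteq> K; K \<subseteq> S\<rbrakk> \<Longrightarrow> K = M \<or> K = S"
  shows "maximal_subgroup M (G\<lparr>carrier := S\<rparr>)"
  unfolding maximal_subgroup_def
proof (intro conjI allI impI)
  show "subgroup M (G\<lparr>carrier := S\<rparr>)" using group.subgroup_incl[OF G M(1) S] M(2) by blast
  show "M \<noteq> carrier (G\<lparr>carrier := S\<rparr>)" using M(2) by auto
  fix K assume K: "subgroup K (G\<lparr>carrier := S\<rparr>) \<and> M \<subseteq> K"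
  then have "K \<subseteq> S" using subgroup.subset by fastforce
  moreover have "subgroup K G" using group.incl_subgroup[OF G S] K by blast
  ultimately show "K = M \<or> K = carrier (G\<lparr>carrier := S\<rparr>)" using max K by auto
qed

lemma maximal_subgroup_restrictD:
  assumes G: "group G" and S: "subgroup S G" and m: "maximal_subgroup M (G\<lparr>carrier := S\<rparr>)"
  shows "subgroup M G" "M \<subset> S" "\<lbrakk>subgroup K G; M \<subseteq> K; K \<subseteq> S\<rbrakk> \<Longrightarrow> K = M \<or> K = S"
proof -
  show "subgroup M G" using m group.incl_subgroup[OF G S] by (auto simp: maximal_subgroup_def)
  have "subgroup M (G\<lparr>carrier := S\<rparr>)" using m by (simp add: maximal_subgroup_def)
  then have "M \<subseteq> S" using subgroup.subset by fastforce
  then show "M \<subset> S" using m by (auto simp: maximal_subgroup_def)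
  assume "subgroup K G" "M \<subseteq> K" "K \<subseteq> S"
  then show "K = M \<or> K = S"
    using m group.subgroup_incl[OF G _ S] by (auto simp: maximal_subgroup_def)
qed

context normal begin

abbreviation proj :: "'a \<Rightarrow> 'a set" where "proj x \<equiv> H #> x"
definition preim :: "'a set set \<Rightarrow> 'a set" where "preim K = {x \<in> carrier G. proj x \<in> K}"

sublocale quot: group "G Mod H" by (rule factorgroup_is_group)

sublocale ph: group_hom G "G Mod H" proj
  by (intro group_hom.intro group_hom_axioms.intro is_group factorgroup_is_group r_coset_hom_Mod)

lemma proj_subgroup: "subgroup K G \<Longrightarrow> subgroup (proj ` K) (G Mod H)"
  by (rule ph.subgroup_img_is_subgroup)

lemma carrier_quot: "carrier (G Mod H) = proj ` carrier G"
  by (rule carrier_FactGroup)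

lemma proj_eq_one_iff: "x \<in> carrier G \<Longrightarrow> proj x = H \<longleftrightarrow> x \<in> H"
  using rcos_self[OF _ is_subgroup] rcos_const by blast

lemma preim_subgroup:
  assumes K: "subgroup K (G Mod H)" shows "subgroup (preim K) G"
proof -
  interpret K: subgroup K "G Mod H" by fact
  show ?thesis
  proof (rule subgroupI)
    show "preim K \<noteq> {}" using K.one_closed ph.hom_one by (auto simp: preim_def)
  next
    fix x assume "x \<in> preim K"
    then show "inv x \<in> preim K" using K.m_inv_closed ph.hom_inv[of x] by (simp add: preim_def)
  next
    fix x y assume "x \<in> preim K" "y \<in> preim K"
    then show "x \<otimes> y \<in> preim K" using K.m_closed[of "proj x" "proj y"] ph.hom_mult[of x y] by (simp add: preim_def)
  qed (auto simp: preim_def)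
qed

lemma H_preim: "subgroup K (G Mod H) \<Longrightarrow> H \<subseteq> preim K"
  using subgroup.one_closed[of K "G Mod H"] rcos_const subset by (auto simp: preim_def)

lemma proj_preim: "subgroup K (G Mod H) \<Longrightarrow> proj ` preim K = K"
  using subgroup.subset[of K "G Mod H"] by (fastforce simp: preim_def carrier_quot)

lemma preim_proj:
  assumes K: "subgroup K G" "H \<subseteq> K" shows "preim (proj ` K) = K"
proof (intro equalityI subsetI)
  fix x assume "x \<in> preim (proj ` K)"
  then obtain y where y: "x \<in> carrier G" "y \<in> K" "proj x = proj y" by (auto simp: preim_def)
  have "x \<in> proj y" using rcos_self[OF y(1) is_subgroup] y(3) by simp
  then obtain h where "h \<in> H" "x = h \<otimes> y" by (auto simp: r_coset_def)
  then show "x \<in> K" using subgroup.m_closed[OF K(1), of h y] K(2) y(2) by auto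
next
  fix x assume "x \<in> K"
  then show "x \<in> preim (proj ` K)" using K(1) subgroup.subset by (auto simp: preim_def)
qed

text \<open>
  Maximality may be tested among the subgroups of $G$ that contain the kernel $H$, by the correspondence theorem.
\<close>

lemma proj_maximal:
  assumes S: "subgroup S G" and M: "subgroup M G" "H \<subseteq> M" "M \<subset> S"
    and max: "\<And>K. \<lbrakk>subgroup K G; M \<subseteq> K; K \<subseteq> S\<rbrakk> \<Longrightarrow> K = M \<or> K = S"
  shows "maximal_subgroup (proj ` M) ((G Mod H)\<lparr>carrier := proj ` S\<rparr>)"
proof (rule maximal_subgroup_restrict[OF quot.is_group])
  show "subgroup (proj ` S) (G Mod H)" by (rule proj_subgroup[OF S])
  show "subgroup (proj ` M) (G Mod H)" by (rule proj_subgroup[OF M(1)])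
  have "proj ` M \<noteq> proj ` S" 
    using preim_proj[OF M(1,2)] preim_proj[OF S] M by (metis less_le order.trans)
  then show "proj ` M \<subset> proj ` S" using M(3) by blast
  fix K assume K: "subgroup K (G Mod H)" "proj ` M \<subseteq> K" "K \<subseteq> proj ` S"
  have "M \<subseteq> preim K" using preim_proj[OF M(1,2)] K(2) by (auto simp: preim_def)
  moreover have "preim K \<subseteq> preim (proj ` S)" using K(3) by (auto simp: preim_def)
  then have "preim K \<subseteq> S" using preim_proj[OF S] M by auto
  ultimately have "preim K = M \<or> preim K = S" using max preim_subgroup[OF K(1)] by blast
  then show "K = proj ` M \<or> K = proj ` S" using proj_preim[OF K(1)] by blast
qed

lemma card_proj:
  assumes K: "subgroup K G" "H \<subseteq> K"
  shows "card (proj ` K) * card H = card K"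
proof -
  interpret K: group "G\<lparr>carrier := K\<rparr>" using K(1) subgroup_imp_group by blast
  have "rcosets\<^bsub>G\<lparr>carrier := K\<rparr>\<^esub> H = proj ` K" by (auto simp: RCOSETS_def r_coset_def)
  then show ?thesis using K.lagrange[OF subgroup_incl[OF is_subgroup K]] by (simp add: order_def)
qed

end

lemma (in group) prime_card_trivial_maximal:
  assumes P: "subgroup P G" "prime (card P)"
  shows "maximal_subgroup {\<one>} (G\<lparr>carrier := P\<rparr>)"
proof (rule maximal_subgroup_restrict[OF is_group P(1) triv_subgroup])
  have "1 < card P" using P(2) prime_gt_1_nat by blast
  then have "P \<noteq> {\<one>}" by auto
  then show "{\<one>} \<subset> P" using subgroup.one_closed[OF P(1)] by blast
  fix K assume K: "subgroup K G" "{\<one>} \<subseteq> K" "K \<subseteq> P"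
  have fin: "finite P" using \<open>1 < card P\<close> card.infinite by fastforce
  have "card K = 1 \<or> card K = card P"
    using card_subgroup_dvd[OF K(1) P(1) K(3)] P(2) prime_nat_iff by blast
  then show "K = {\<one>} \<or> K = P"
    using K fin card_subset_eq[of P K] card_1_singletonE by (metis insert_subset singletonD)
qed

text \<open>
  Cardinalities drop along a chain, so the lengths of chains are bounded by the order. This makes the maximum in
  the definition of the length a genuine one.
\<close>

lemma (in group) group_length_ge:
  assumes "finite (carrier G)" "subgroup_chain G t C"
  shows "t \<le> group_length G"
proof -
  have le: "t \<le> order G" if c: "subgroup_chain G t C" for t C
  proof -
    have sub: "C i \<subseteq> carrier G" if "i \<le> t" for i using c that by (simp add: subgroup_chain_def subgroup.subset)
    have "card (C i) + i \<le> order G" if "i \<le> t" for i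
      using that
    proof (induction i)
      case 0 then show ?case using c by (simp add: subgroup_chain_def order_def)
    next
      case (Suc i)
      have "C (Suc i) \<subset> C i" using c Suc.prems by (simp add: subgroup_chain_def)
      moreover have "finite (C i)" using sub[of i] Suc.prems assms(1) finite_subset by auto
      ultimately have "card (C (Suc i)) < card (C i)" using psubset_card_mono by blast
      then show ?case using Suc by simp
    qed
    then show ?thesis by (metis add_leD2 order_refl)
  qed
  have "finite {t. \<exists>C. subgroup_chain G t C}"
    by (rule finite_subset[of _ "{..order G}"]) (use le in auto)
  then show ?thesis unfolding group_length_def using assms(2) by (intro Max_ge) auto
qed

text \<open>
  The subgroups generated by $x, x^q, x^{q^2}, \ldots$ descend strictly. The first of them is replaced by the whole
  group, which saves the question whether the group is cyclic.
\<close>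

lemma (in group) group_length_ge_prime_power:
  assumes fin: "finite (carrier G)" and x: "x \<in> carrier G" "ord x = q ^ m" and q: "1 < q" and m: "0 < m"
  shows "m \<le> group_length G"
proof -
  define C where "C = (\<lambda>i::nat. if i = 0 then carrier G else generate G {x [^] (q ^ i)})"
  have card: "card (generate G {x [^] (q ^ i)}) = q ^ (m - i)" if "i \<le> m" for i
  proof -
    have "ord (x [^] (q ^ i)) = q ^ m div q ^ i" using x that q by (subst ord_pow) (auto intro: le_imp_power_dvd)
    also have "\<dots> = q ^ (m - i)" using that q by (simp add: power_diff)
    finally show ?thesis using generate_pow_card[of "x [^] (q ^ i)"] x by simp
  qed
  have incl: "generate G {x [^] (q ^ Suc i)} \<subseteq> generate G {x [^] (q ^ i)}" for i
  proof (rule generate_subgroup_incl)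
    show gs: "subgroup (generate G {x [^] (q ^ i)}) G" using x by (intro generate_is_subgroup) auto
    have "(x [^] (q ^ i)) [^] q = x [^] (q ^ Suc i)" using x by (simp add: nat_pow_pow mult.commute)
    moreover have "x [^] (q ^ i) \<in> generate G {x [^] (q ^ i)}" by (rule generate.incl) simp
    ultimately show "{x [^] (q ^ Suc i)} \<subseteq> generate G {x [^] (q ^ i)}"
      using subgroup_nat_pow[OF gs, of "x [^] (q ^ i)" q] by simp
  qed
  have strict: "generate G {x [^] (q ^ Suc i)} \<subset> generate G {x [^] (q ^ i)}" if "i < m" for i
  proof -
    have "q ^ (m - Suc i) < q ^ (m - i)" using that q by (intro power_strict_increasing) auto
    then have "card (generate G {x [^] (q ^ Suc i)}) \<noteq> card (generate G {x [^] (q ^ i)})"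
      using card[of i] card[of "Suc i"] that by simp
    then show ?thesis using incl[of i] by auto
  qed
  have "subgroup_chain G m C"
    unfolding subgroup_chain_def
  proof (intro conjI allI impI)
    show "C 0 = carrier G" by (simp add: C_def)
    have "x [^] (q ^ m) = \<one>" using x by (metis pow_ord_eq_1)
    then show "C m = {\<one>}" using m by (simp add: C_def generate_one)
    fix i
    show "subgroup (C i) G" using x subgroup_self by (auto simp: C_def intro!: generate_is_subgroup)
    assume i: "i < m"
    show "C (Suc i) \<subset> C i"
    proof (cases "i = 0")
      case True
      have "generate G {x [^] (q ^ 0)} \<subseteq> carrier G" using x by (intro generate_incl) auto
      then show ?thesis using strict[OF i] True by (auto simp: C_def)
    next
      case False then show ?thesis using strict[OF i] by (simp add: C_def)
    qed
  qed
  then show ?thesis by (rule group_length_ge[OF fin])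
qed

section \<open>The class equation of a group with abelian centralizers\<close>

text \<open>
  Commutativity is transitive outside the central subgroup $Z$ of order $2$, so the centralizers of elements outside $Z$
  are abelian and any two of them are equal or meet in $Z$. The last axiom bounds the index of such a centralizer in its normalizer by $2$.
  For matrices without repeated eigenvalues it expresses that a conjugate of $x$ commuting with $x$ has the
  same pair of eigenvalues, in one of two orders.
\<close>

locale ct_group = group H for H (structure) +
  fixes Z :: "'a set"
  assumes finite_H: "finite (carrier H)"
    and Z_subgroup: "subgroup Z H"
    and card_Z: "card Z = 2"
    and Z_central: "z \<in> Z \<Longrightarrow> x \<in> carrier H \<Longrightarrow> z \<otimes> x = x \<otimes> z"
    and commute_trans: "\<lbrakk>x \<in> carrier H; y \<in> carrier H - Z; w \<in> carrier H; x \<otimes> y = y \<otimes> x; y \<otimes> w = w \<otimes> y\<rbrakk>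
       \<Longrightarrow> x \<otimes> w = w \<otimes> x"
    and conj_commuting: "\<lbrakk>x \<in> carrier H - Z; n \<in> carrier H; x \<otimes> (n \<otimes> x \<otimes> inv n) = (n \<otimes> x \<otimes> inv n) \<otimes> x\<rbrakk>
       \<Longrightarrow> n \<otimes> x \<otimes> inv n = x \<or> n \<otimes> x \<otimes> inv n = inv x"
begin

abbreviation C where "C \<equiv> centralizer H"

text \<open>
  This is the normalizer of the centralizer of $x$, see \<open>torus_normalizer_iff\<close> below; membership need only be tested at $x$.
\<close>

definition torus_normalizer :: "'a \<Rightarrow> 'a set" where
  "torus_normalizer x = {n \<in> carrier H. n \<otimes> x \<otimes> inv n \<in> C x}"

text \<open>
  The union of all conjugates of the centralizer of $x$, with the central subgroup removed. These sets partition the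
  complement of $Z$.
\<close>

definition torus_class :: "'a \<Rightarrow> 'a set" where
  "torus_class x = {g \<otimes> y \<otimes> inv g | g y. g \<in> carrier H \<and> y \<in> C x - Z}"

lemma Z_sub: "Z \<subseteq> carrier H" using Z_subgroup subgroup.subset by blast

lemma C_sub: "C x \<subseteq> carrier H" by (auto simp: centralizer_def)

lemma finite_C: "finite (C x)" using C_sub finite_H finite_subset by blast

lemma Z_sub_C: "x \<in> carrier H \<Longrightarrow> Z \<subseteq> C x"
  unfolding centralizer_def using Z_central[of _ x] Z_sub by (auto intro: sym)

lemma conj_Z_iff:
  assumes "x \<in> carrier H" "g \<in> carrier H" shows "g \<otimes> x \<otimes> inv g \<in> Z \<longleftrightarrow> x \<in> Z"
proof
  assume "x \<in> Z"
  then have "g \<otimes> x \<otimes> inv g = x" using Z_central[of x g] assms by (metis inv_solve_right' m_closed)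
  then show "g \<otimes> x \<otimes> inv g \<in> Z" using \<open>x \<in> Z\<close> by simp
next
  assume "g \<otimes> x \<otimes> inv g \<in> Z"
  then have "g \<otimes> x \<otimes> inv g \<otimes> g = g \<otimes> (g \<otimes> x \<otimes> inv g)" using Z_central assms by blast
  moreover have "g \<otimes> x \<otimes> inv g \<otimes> g = g \<otimes> x" using assms by (simp add: m_assoc)
  ultimately have "g \<otimes> x \<otimes> inv g = x" using assms by (metis inv_closed left_cancel m_closed)
  then show "x \<in> Z" using \<open>g \<otimes> x \<otimes> inv g \<in> Z\<close> by simp
qed

text \<open>An element of torus_normalizer conjugates the whole of C into itself.\<close>

lemma torus_normalizer_iff:
  assumes x: "x \<in> carrier H - Z" and y: "y \<in> C x - Z" and n: "n \<in> carrier H"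
  shows "n \<otimes> y \<otimes> inv n \<in> C x \<longleftrightarrow> n \<in> torus_normalizer x"
proof -
  have y': "y \<in> carrier H" and xy: "x \<otimes> y = y \<otimes> x" using y by (auto simp: centralizer_def)
  have nx: "n \<otimes> x \<otimes> inv n \<in> carrier H - Z" "n \<otimes> y \<otimes> inv n \<in> carrier H - Z" using x y y' n conj_Z_iff by auto
  have co: "(n \<otimes> x \<otimes> inv n) \<otimes> (n \<otimes> y \<otimes> inv n) = (n \<otimes> y \<otimes> inv n) \<otimes> (n \<otimes> x \<otimes> inv n)"
    using conj_commute_iff x y' n xy by blast
  have "x \<otimes> (n \<otimes> y \<otimes> inv n) = (n \<otimes> y \<otimes> inv n) \<otimes> x \<longleftrightarrow> x \<otimes> (n \<otimes> x \<otimes> inv n) = (n \<otimes> x \<otimes> inv n) \<otimes> x"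
    using commute_trans[of x "n \<otimes> y \<otimes> inv n" "n \<otimes> x \<otimes> inv n"] commute_trans[of x "n \<otimes> x \<otimes> inv n" "n \<otimes> y \<otimes> inv n"] nx co x
    by auto
  then show ?thesis using nx n by (auto simp: torus_normalizer_def centralizer_def)
qed

text \<open>
  An element of the normalizer either centralizes $x$ or inverts it, and the inverting elements, if any, form one
  coset of the centralizer.
\<close>

lemma card_torus_normalizer:
  assumes x: "x \<in> carrier H - Z"
  shows "card (torus_normalizer x) = card (C x) \<or> card (torus_normalizer x) = 2 * card (C x)"
proof (cases "\<exists>g\<in>carrier H. g \<otimes> x \<otimes> inv g = inv x \<and> g \<notin> C x")
  case True
  then obtain g where g: "g \<in> carrier H" "g \<otimes> x \<otimes> inv g = inv x" "g \<notin> C x" by blast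
  have "inv x \<in> C x" using x by (simp add: centralizer_def)
  have "torus_normalizer x = C x \<union> (\<lambda>c. g \<otimes> c) ` C x"
  proof (intro equalityI subsetI)
    fix n assume n: "n \<in> torus_normalizer x"
    then have nc: "n \<in> carrier H" by (simp add: torus_normalizer_def)
    have "n \<otimes> x \<otimes> inv n = x \<or> n \<otimes> x \<otimes> inv n = inv x"
      using conj_commuting[OF x nc] n by (auto simp: torus_normalizer_def centralizer_def)
    then show "n \<in> C x \<union> (\<lambda>c. g \<otimes> c) ` C x"
    proof
      assume "n \<otimes> x \<otimes> inv n = x"
      then have "n \<otimes> x = x \<otimes> n" using x nc by (metis DiffD1 inv_solve_right' m_closed)
      then show ?thesis using nc by (simp add: centralizer_def)
    next
      assume nn: "n \<otimes> x \<otimes> inv n = inv x"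
      have "inv g \<otimes> n \<in> C x"
      proof -
        have "(inv g \<otimes> n) \<otimes> x \<otimes> inv (inv g \<otimes> n) = inv g \<otimes> (n \<otimes> x \<otimes> inv n) \<otimes> inv (inv g)"
          using conj_conj[of x "inv g" n] x nc g(1) by simp
        also have "\<dots> = x" using nn g x conj_inv_conj[of x g] by simp
        finally have "(inv g \<otimes> n) \<otimes> x = x \<otimes> (inv g \<otimes> n)"
          using x nc g(1) by (metis DiffD1 inv_closed inv_solve_right' m_closed)
        then show ?thesis using nc g(1) by (simp add: centralizer_def)
      qed
      moreover have "n = g \<otimes> (inv g \<otimes> n)" using nc g(1) by (simp flip: m_assoc)
      ultimately show ?thesis by blast
    qed
  next
    fix n assume "n \<in> C x \<union> (\<lambda>c. g \<otimes> c) ` C x"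
    then show "n \<in> torus_normalizer x"
    proof
      assume "n \<in> C x"
      then have "n \<in> carrier H" "n \<otimes> x \<otimes> inv n = x" using x
        by (auto simp: centralizer_def inv_solve_right')
      then show ?thesis using x by (simp add: torus_normalizer_def centralizer_def)
    next
      assume "n \<in> (\<lambda>c. g \<otimes> c) ` C x"
      then obtain c where c: "n = g \<otimes> c" "c \<in> carrier H" "x \<otimes> c = c \<otimes> x" by (auto simp: centralizer_def)
      then have "c \<otimes> x \<otimes> inv c = x" using x by (metis DiffD1 inv_solve_right' m_closed)
      then have "n \<otimes> x \<otimes> inv n = inv x" using conj_conj[of x g c] c g x by auto
      then show ?thesis using \<open>inv x \<in> C x\<close> c g by (simp add: torus_normalizer_def)
    qed
  qed
  moreover have "C x \<inter> (\<lambda>c. g \<otimes> c) ` C x = {}"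
  proof -
    interpret Cx: subgroup "C x" H using centralizer_subgroup x by blast
    have False if "c \<in> C x" "c' \<in> C x" "c = g \<otimes> c'" for c c'
      using that g by (metis Cx.m_closed Cx.m_inv_closed Cx.mem_carrier inv_solve_right)
    then show ?thesis by auto
  qed
  moreover have "card ((\<lambda>c. g \<otimes> c) ` C x) = card (C x)"
    using g(1) C_sub by (rule card_left_translate)
  ultimately have "card (torus_normalizer x) = 2 * card (C x)" using finite_C by (simp add: card_Un_disjoint)
  then show ?thesis ..
next
  case False
  have "torus_normalizer x = C x"
  proof (intro equalityI subsetI)
    fix n assume n: "n \<in> torus_normalizer x"
    then have nc: "n \<in> carrier H" by (simp add: torus_normalizer_def)
    have "n \<otimes> x \<otimes> inv n = x \<or> n \<otimes> x \<otimes> inv n = inv x"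
      using conj_commuting[OF x nc] n by (auto simp: torus_normalizer_def centralizer_def)
    then show "n \<in> C x"
    proof
      assume "n \<otimes> x \<otimes> inv n = x"
      then have "n \<otimes> x = x \<otimes> n" using x nc by (metis DiffD1 inv_solve_right' m_closed)
      then show ?thesis using nc by (simp add: centralizer_def)
    qed (use False nc in blast)
  next
    fix n assume "n \<in> C x"
    then have "n \<in> carrier H" "n \<otimes> x \<otimes> inv n = x" using x
      by (auto simp: centralizer_def inv_solve_right')
    then show "n \<in> torus_normalizer x" using x by (simp add: torus_normalizer_def centralizer_def)
  qed
  then show ?thesis by simp
qed

text \<open>
  Count the pairs $(g, y)$ by the element $g y g^{-1}$: the fibre over each element of the class is a copy
  of the normalizer.
\<close>

lemma card_torus_class:
  assumes x: "x \<in> carrier H - Z"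
  shows "card (torus_class x) * card (torus_normalizer x) = card (carrier H) * (card (C x) - 2)"
proof -
  define f where "f = (\<lambda>(g, y). g \<otimes> y \<otimes> inv g)"
  define D where "D = carrier H \<times> (C x - Z)"
  have fin: "finite D" unfolding D_def using finite_H finite_C by simp
  have im: "f ` D = torus_class x" unfolding f_def D_def torus_class_def by auto
  have fiber: "card {d \<in> D. f d = w} = card (torus_normalizer x)" if w: "w \<in> torus_class x" for w
  proof -
    obtain g y where gy: "g \<in> carrier H" "y \<in> C x - Z" "w = g \<otimes> y \<otimes> inv g" using w by (auto simp: torus_class_def)
    have y: "y \<in> carrier H" using gy C_sub by blast
    have sub: "{d \<in> D. f d = w} = (\<lambda>n. (g \<otimes> inv n, n \<otimes> y \<otimes> inv n)) ` torus_normalizer x"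
    proof (intro equalityI subsetI)
      fix d assume "d \<in> {d \<in> D. f d = w}"
      then obtain h v where d: "d = (h, v)" "h \<in> carrier H" "v \<in> C x - Z" "h \<otimes> v \<otimes> inv h = w"
        by (auto simp: D_def f_def)
      have v: "v \<in> carrier H" using d C_sub by blast
      define n where "n = inv h \<otimes> g"
      have n: "n \<in> carrier H" using d gy by (simp add: n_def)
      have h: "h = g \<otimes> inv n" using d gy by (simp add: n_def inv_mult_group flip: m_assoc)
      have "n \<otimes> y \<otimes> inv n = inv h \<otimes> w \<otimes> inv (inv h)"
        unfolding gy(3) n_def using conj_conj[of y "inv h" g] d gy y by simp
      also have "\<dots> = v" unfolding d(4)[symmetric] using conj_inv_conj[OF v d(2)] d(2) by simp
      finally have nv: "n \<otimes> y \<otimes> inv n = v" .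
      then have "n \<in> torus_normalizer x" using torus_normalizer_iff[OF x gy(2) n] d(3) by simp
      then show "d \<in> (\<lambda>n. (g \<otimes> inv n, n \<otimes> y \<otimes> inv n)) ` torus_normalizer x" using nv h d(1) by auto
    next
      fix d assume "d \<in> (\<lambda>n. (g \<otimes> inv n, n \<otimes> y \<otimes> inv n)) ` torus_normalizer x"
      then obtain n where n: "n \<in> torus_normalizer x" "d = (g \<otimes> inv n, n \<otimes> y \<otimes> inv n)" by blast
      have nc: "n \<in> carrier H" using n by (simp add: torus_normalizer_def)
      have "n \<otimes> y \<otimes> inv n \<in> C x - Z" using torus_normalizer_iff[OF x gy(2) nc] n conj_Z_iff[OF y nc] gy(2) by blast
      moreover have "g \<otimes> inv n \<otimes> (n \<otimes> y \<otimes> inv n) \<otimes> inv (g \<otimes> inv n) = w"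
        unfolding conj_conj[OF y m_closed[OF gy(1) inv_closed[OF nc]] nc] gy(3)
        using nc gy(1) by (simp add: m_assoc)
      ultimately show "d \<in> {d \<in> D. f d = w}" using n nc gy(1) by (simp add: D_def f_def)
    qed
    have "inj_on (\<lambda>n. (g \<otimes> inv n, n \<otimes> y \<otimes> inv n)) (torus_normalizer x)"
    proof (rule inj_onI)
      fix n m assume "n \<in> torus_normalizer x" "m \<in> torus_normalizer x" "(g \<otimes> inv n, n \<otimes> y \<otimes> inv n) = (g \<otimes> inv m, m \<otimes> y \<otimes> inv m)"
      then have "n \<in> carrier H" "m \<in> carrier H" "inv n = inv m"
        using gy(1) left_cancel[of g] by (auto simp: torus_normalizer_def)
      then show "n = m" by (metis inv_inv)
    qed
    then show ?thesis unfolding sub by (rule card_image)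
  qed
  have "card D = (\<Sum>w\<in>f ` D. card {d \<in> D. f d = w})"
    using sum.image_gen[OF fin, of "\<lambda>_. 1::nat" f] by simp
  also have "\<dots> = card (torus_class x) * card (torus_normalizer x)" using fiber by (simp add: im)
  finally have "card D = card (torus_class x) * card (torus_normalizer x)" .
  moreover have "card (C x - Z) = card (C x) - 2"
    using card_Diff_subset[of Z "C x"] Z_sub_C[of x] x card_Z finite_subset[OF _ finite_C, of Z x] by simp
  ultimately show ?thesis by (simp add: D_def card_cartesian_product)
qed

lemma torus_class_sub: "x \<in> carrier H \<Longrightarrow> torus_class x \<subseteq> carrier H - Z"
  using conj_Z_iff C_sub by (fastforce simp: torus_class_def)

text \<open>
  If two conjugates of centralizers share an element outside $Z$, they coincide by transitivity of commuting.
\<close>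

lemma torus_class_disjoint:
  assumes x: "x \<in> carrier H - Z" and y: "y \<in> carrier H - Z" and ny: "y \<notin> torus_class x"
  shows "torus_class x \<inter> torus_class y = {}"
proof (rule ccontr)
  assume "torus_class x \<inter> torus_class y \<noteq> {}"
  then obtain g u h v where g: "g \<in> carrier H" "u \<in> C x - Z" and h: "h \<in> carrier H" "v \<in> C y - Z"
    and eq: "g \<otimes> u \<otimes> inv g = h \<otimes> v \<otimes> inv h" by (auto simp: torus_class_def)
  have u: "u \<in> carrier H" and v: "v \<in> carrier H" using g h C_sub by blast+
  define k where "k = inv h \<otimes> g"
  have k: "k \<in> carrier H" using g h by (simp add: k_def)
  have "k \<otimes> u \<otimes> inv k = inv h \<otimes> (g \<otimes> u \<otimes> inv g) \<otimes> inv (inv h)"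
    unfolding k_def using conj_conj[of u "inv h" g] g h u by simp
  also have "\<dots> = v" unfolding eq using conj_inv_conj[OF v h(1)] h by simp
  finally have kv: "k \<otimes> u \<otimes> inv k = v" .
  have yv: "y \<otimes> v = v \<otimes> y" using h by (auto simp: centralizer_def)
  define w where "w = inv k \<otimes> y \<otimes> k"
  have w: "w \<in> carrier H" using k y by (simp add: w_def)
  have yw: "y = k \<otimes> w \<otimes> inv k"
    using conj_inv_conj[of y "inv k"] k y by (simp add: w_def)
  have "w \<otimes> u = u \<otimes> w"
    using conj_commute_iff[OF w u k] yv kv yw by simp
  moreover have "x \<otimes> u = u \<otimes> x" using g by (auto simp: centralizer_def)
  ultimately have "x \<otimes> w = w \<otimes> x" using commute_trans[of x u w] x u w g by auto
  moreover have "w \<notin> Z" using conj_Z_iff[OF w k] yw y by auto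
  ultimately have "y \<in> torus_class x" using w k yw by (auto simp: torus_class_def centralizer_def)
  with ny show False by contradiction
qed

end

text \<open>
  This is the equation of the spherical triangle groups. The smallest denominator must be $2$; the second cannot be $2$, as
  this is the dihedral solution $k = 2c$; so it is $3$, and the third is at most $5$. The remaining
  cases $(2,3,3)$, $(2,3,4)$ and $(2,3,5)$ give $k = 12, 24, 60$.
\<close>

lemma triangle_equation_sorted:
  fixes a b c k :: nat
  assumes "2 \<le> a" "a \<le> b" "b \<le> c" "0 < k"
    and eq: "1 / real a + 1 / b + 1 / c = 1 + 2 / k"
    and ex: "k \<noteq> 2 * c" "k \<noteq> 24" "k \<noteq> 60"
  shows "k = 12"
proof -
  have pos: "real a > 0" "real b > 0" "real c > 0" "real k > 0" using assms by auto
  have kpos: "2 / real k > 0" using pos by simp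
  have a: "a = 2"
  proof (rule ccontr)
    assume "a \<noteq> 2"
    then have "real a \<ge> 3" "real b \<ge> 3" "real c \<ge> 3" using assms by auto
    then have "1 / real a \<le> 1 / 3" "1 / real b \<le> 1 / 3" "1 / real c \<le> 1 / 3"
      by (simp_all add: field_simps)
    then show False using eq kpos by linarith
  qed
  have b: "b = 3"
  proof (rule ccontr)
    assume "b \<noteq> 3"
    moreover have "b \<noteq> 2" using eq a ex pos by (auto simp: field_simps)
    ultimately have "real b \<ge> 4" "real c \<ge> 4" using assms a by auto
    then have "1 / real b \<le> 1 / 4" "1 / real c \<le> 1 / 4"
      by (simp_all add: field_simps)
    moreover have "1 / 2 + 1 / real b + 1 / real c = 1 + 2 / k" using eq a by simp
    ultimately show False using kpos by linarith
  qed
  have "c < 6"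
  proof (rule ccontr)
    assume "\<not> c < 6"
    then have "1 / real c \<le> 1 / 6" by (simp add: field_simps)
    moreover have "1 / 2 + 1 / 3 + 1 / real c = 1 + 2 / k" using eq a b by simp
    ultimately show False using kpos by linarith
  qed
  then have "c = 3 \<or> c = 4 \<or> c = 5" using assms b by auto
  then show "k = 12" using eq a b ex pos by (auto simp: field_simps)
qed

lemma triangle_equation:
  fixes a b c k :: nat
  assumes "2 \<le> a" "2 \<le> b" "2 \<le> c" "0 < k"
    and "1 / real a + 1 / b + 1 / c = 1 + 2 / k"
    and "k \<noteq> 2 * a" "k \<noteq> 2 * b" "k \<noteq> 2 * c" "k \<noteq> 24" "k \<noteq> 60"
  shows "k = 12"
proof -
  consider "a \<le> b" "b \<le> c" | "a \<le> c" "c \<le> b" | "b \<le> a" "a \<le> c" | "b \<le> c" "c \<le> a" | "c \<le> a" "a \<le> b" | "c \<le> b" "b \<le> a"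
    by linarith
  then show ?thesis
  proof cases
    case 1 then show ?thesis using triangle_equation_sorted[of a b c k] assms by simp
  next
    case 2 then show ?thesis using triangle_equation_sorted[of a c b k] assms by simp
  next
    case 3 then show ?thesis using triangle_equation_sorted[of b a c k] assms by simp
  next
    case 4 then show ?thesis using triangle_equation_sorted[of b c a k] assms by simp
  next
    case 5 then show ?thesis using triangle_equation_sorted[of c a b k] assms by simp
  next
    case 6 then show ?thesis using triangle_equation_sorted[of c b a k] assms by simp
  qed
qed

text \<open>
  A class with parameters $c$ and $e$ occupies the fraction $(1 - 1/c)/e$ of the group. It is at least $1/4$, so there are
  at most three classes.
\<close>

lemma class_weight_bounds:
  fixes c e :: nat
  assumes "2 \<le> c" "e = 1 \<or> e = 2"
  shows "(1 - 1 / real c) / e \<ge> 1 / 4" and "(1 - 1 / real c) / e \<ge> 1 / (2 * e)"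
  using assms by (auto simp: field_simps)

context ct_group begin

text \<open>
  Everything has even order because $Z$ has order $2$; $c$ is the order of the centralizer modulo $Z$.
\<close>

lemma class_data:
  assumes x: "x \<in> carrier H - Z"
  obtains c e :: nat where "2 \<le> c" "e = 1 \<or> e = 2" "card (C x) = 2 * c" "card (torus_normalizer x) = e * card (C x)"
    "e * (2 * c) \<le> order H" "real (card (torus_class x)) = order H * ((1 - 1 / c) / e)"
proof -
  have xC: "x \<in> C x" using x by (simp add: centralizer_def)
  have "card Z dvd card (C x)"
    using card_subgroup_dvd Z_subgroup centralizer_subgroup Z_sub_C x by blast
  then obtain c where c: "card (C x) = 2 * c" using card_Z by (metis dvdE)
  have "Z \<subset> C x" using Z_sub_C x xC by blast
  then have "card Z < card (C x)" using finite_C psubset_card_mono by blast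
  then have c2: "2 \<le> c" using c card_Z by simp
  obtain e where e: "e = 1 \<or> e = 2" "card (torus_normalizer x) = e * card (C x)" using card_torus_normalizer[OF x] by (metis mult_1)
  have "card (torus_normalizer x) \<le> order H" unfolding order_def by (intro card_mono finite_H) (auto simp: torus_normalizer_def)
  then have le: "e * (2 * c) \<le> order H" using e c by simp
  have "real (card (torus_class x)) * (e * (2 * c)) = order H * (2 * real c - 2)"
  proof -
    have "card (torus_class x) * (e * (2 * c)) = order H * (2 * c - 2)"
      using card_torus_class[OF x] c e by (simp add: order_def)
    then have "real (card (torus_class x)) * real (e * (2 * c)) = real (order H) * real (2 * c - 2)"
      by (metis of_nat_mult)
    then show ?thesis using c2 by simp
  qed
  then have "real (card (torus_class x)) = order H * ((1 - 1 / c) / e)"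
    using c2 e by (auto simp: field_simps)
  with c2 e c le that show thesis by blast
qed

text \<open>
  Write $2k$ for the order. The classes fill the group up to the central subgroup, so their weights add up to
  $1 - 1/k$. The class of $x$ has weight less than $1/2$, since $x$ is normalized
  by an element that does not centralize it; a single class, or a second one of the same kind, is not enough to fill the group. Thus either there are two
  classes, the second with a self-normalizing centralizer, or three classes of the kind of $x$. The former forces the
  parameters $2$ and $3$, hence $k = 12$; the latter is the triangle equation.
\<close>

theorem order_24:
  assumes x: "x \<in> carrier H - Z" and g: "g \<in> torus_normalizer x" "g \<notin> C x"
    and index: "\<And>y. y \<in> carrier H - Z \<Longrightarrow> order H \<noteq> 2 * card (C y)"
    and ndvd: "\<not> 16 dvd order H" "\<not> 5 dvd order H"
  shows "order H = 24"
proof -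
  have "card Z dvd order H" using lagrange[OF Z_subgroup] by (metis dvd_triv_right)
  then obtain k where k: "order H = 2 * k" using card_Z by (metis dvdE)
  have k24: "k \<noteq> 24" "k \<noteq> 60" using ndvd k by auto
  have finc: "finite (torus_class y)" if "y \<in> carrier H - Z" for y
    using torus_class_sub that finite_H by (meson DiffD1 finite_Diff finite_subset)
  have k0: "k > 0" using k finite_H order_gt_0_iff_finite by simp
  have tot: "card (carrier H - Z) = 2 * k - 2"
    using card_Diff_subset[of Z "carrier H"] finite_subset[OF Z_sub finite_H] Z_sub card_Z k by (simp add: order_def)
  have k1: "k \<ge> 1" using k0 by simp
  obtain c e where ce: "2 \<le> c" "e = 1 \<or> e = 2" "card (C x) = 2 * c" "card (torus_normalizer x) = e * card (C x)"
    "e * (2 * c) \<le> order H" "real (card (torus_class x)) = order H * ((1 - 1 / c) / e)"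
    by (rule class_data[OF x])
  have "C x \<subset> torus_normalizer x"
  proof -
    have "n \<in> torus_normalizer x" if "n \<in> C x" for n
    proof -
      have "n \<in> carrier H" "n \<otimes> x \<otimes> inv n = x" using x that
        by (auto simp: centralizer_def inv_solve_right')
      then show ?thesis using x by (simp add: torus_normalizer_def centralizer_def)
    qed
    then show ?thesis using g by blast
  qed
  moreover have "finite (torus_normalizer x)" using finite_H by (simp add: torus_normalizer_def)
  ultimately have "card (C x) < card (torus_normalizer x)" by (simp add: psubset_card_mono)
  then have e: "e = 2" using ce by auto
  have ck: "2 * c \<le> k" "2 * c \<noteq> k" using ce(5) index[OF x] ce(3) k e by auto
  then have ck': "1 / real k \<le> 1 / (2 * real c)" using ce(1) by (simp add: field_simps)
  have m1: "real (card (torus_class x)) = 2 * real k * ((1 - 1 / c) / 2)" using ce(6) e k by simp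
  have "torus_class x \<noteq> carrier H - Z"
  proof
    assume "torus_class x = carrier H - Z"
    then have "2 * real k - 2 = 2 * real k * ((1 - 1 / c) / 2)"
      using m1 tot k1 by (simp add: of_nat_diff)
    then have "2 * (real k * (1 + 1 / c)) = 2 * 2" by (simp add: algebra_simps)
    then have "real k * (1 + 1 / c) = 2" by simp
    moreover have "real k * (1 + 1 / c) > k" using k0 ce(1) by (simp add: field_simps)
    ultimately show False using ck(1) ce(1) by linarith
  qed
  then obtain y where y: "y \<in> carrier H - Z" "y \<notin> torus_class x" using torus_class_sub x by blast
  obtain d f where df: "2 \<le> d" "f = 1 \<or> f = 2" "card (C y) = 2 * d" "card (torus_normalizer y) = f * card (C y)"
    "f * (2 * d) \<le> order H" "real (card (torus_class y)) = order H * ((1 - 1 / d) / f)"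
    by (rule class_data[OF y(1)])
  have xy: "torus_class x \<inter> torus_class y = {}" using torus_class_disjoint x y by blast
  then have cxy: "card (torus_class x \<union> torus_class y) = card (torus_class x) + card (torus_class y)"
    using finc x y by (simp add: card_Un_disjoint)
  have dk: "2 * d \<noteq> k" using index[OF y(1)] df(3) k by auto
  show ?thesis
  proof (cases "torus_class x \<union> torus_class y = carrier H - Z")
    case True
    then have "real (card (torus_class x)) + real (card (torus_class y)) = 2 * real k - 2"
      using cxy tot k1 by (simp add: of_nat_diff flip: of_nat_add)
    then have "2 * real k * ((1 - 1 / c) / 2 + (1 - 1 / d) / f) = 2 * real k * (1 - 1 / k)"
      unfolding m1 df(6) k using k0 by (simp add: algebra_simps)
    then have eq: "(1 - 1 / real c) / 2 + (1 - 1 / d) / f = 1 - 1 / k"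
      using k0 by (subst (asm) mult_cancel_left) simp
    from df(2) show ?thesis
    proof
      assume f: "f = 2"
      then have "1 / real k \<le> 1 / (2 * real d)" using df k by (simp add: field_simps)
      moreover have "1 / (2 * real c) + 1 / (2 * real d) = 1 / k" using eq f by (simp add: field_simps)
      moreover have "1 / real k > 0" using k0 by simp
      ultimately show ?thesis using ck' by linarith
    next
      assume f: "f = 1"
      have eq': "1 / real d + 1 / (2 * real c) = 1 / 2 + 1 / k" using eq f by (simp add: field_simps)
      have pos: "1 / real k > 0" using k0 by simp
      have "d \<noteq> 2"
      proof
        assume "d = 2"
        then have "1 / (2 * real c) = 1 / k" using eq' by simp
        then have "real k = real (2 * c)" using k0 ce(1) by (simp add: field_simps)
        then show False using ck(2) by linarith
      qed
      then have "1 / real d \<le> 1 / 3" using df(1) by (simp add: field_simps)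
      then have "1 / (2 * real c) > 1 / 6" using eq' pos by linarith
      then have "c < 3" using ce(1) by (simp add: field_simps)
      then have c: "c = 2" using ce(1) by simp
      have "1 / real d + 1 / 4 = 1 / 2 + 1 / real k" using eq' c by simp
      then have "1 / real d > 1 / 4" using pos by linarith
      then have "d < 4" using df(1) by (simp add: field_simps)
      then have d: "d = 3" using df(1) \<open>d \<noteq> 2\<close> by simp
      have "k = 12" using eq' c d k0 by (simp add: field_simps)
      then show ?thesis using k by simp
    qed
  next
    case False
    then obtain z where z: "z \<in> carrier H - Z" "z \<notin> torus_class x" "z \<notin> torus_class y" using torus_class_sub x y by blast
    obtain a b where ab: "2 \<le> a" "b = 1 \<or> b = 2" "card (C z) = 2 * a" "card (torus_normalizer z) = b * card (C z)"
      "b * (2 * a) \<le> order H" "real (card (torus_class z)) = order H * ((1 - 1 / a) / b)"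
      by (rule class_data[OF z(1)])
    have xyz: "(torus_class x \<union> torus_class y) \<inter> torus_class z = {}" using torus_class_disjoint x y z by blast
    then have cxyz: "card (torus_class x \<union> torus_class y \<union> torus_class z) = card (torus_class x) + card (torus_class y) + card (torus_class z)"
      using finc x y z cxy by (simp add: card_Un_disjoint)
    have ak: "2 * a \<noteq> k" using index[OF z(1)] ab(3) k by auto
    have sub: "torus_class x \<union> torus_class y \<union> torus_class z \<subseteq> carrier H - Z" using torus_class_sub x y z by blast
    then have "card (torus_class x) + card (torus_class y) + card (torus_class z) \<le> 2 * k - 2"
      using card_mono[OF _ sub] finite_H cxyz tot by simp
    then have "real (card (torus_class x)) + real (card (torus_class y)) + real (card (torus_class z)) \<le> 2 * real k - 2"
      using k1 by (simp add: of_nat_diff flip: of_nat_add)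
    then have "2 * real k * ((1 - 1 / c) / 2 + (1 - 1 / d) / f + (1 - 1 / a) / b) \<le> 2 * real k * (1 - 1 / k)"
      unfolding m1 df(6) ab(6) k using k0 by (simp add: algebra_simps)
    then have le: "(1 - 1 / real c) / 2 + (1 - 1 / d) / f + (1 - 1 / a) / b \<le> 1 - 1 / k"
      using k0 by (subst (asm) mult_le_cancel_left_pos) simp_all
    have pos: "1 / real k > 0" using k0 by simp
    have q1: "(1 - 1 / real c) / 2 \<ge> 1 / 4" using class_weight_bounds(1)[OF ce(1), of 2] by simp
    note q2 = class_weight_bounds[OF df(1,2)] and q3 = class_weight_bounds[OF ab(1,2)]
    have f: "f = 2"
    proof (rule ccontr)
      assume "f \<noteq> 2"
      then have "1 / (2 * real f) = 1 / 2" using df(2) by simp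
      then show False using q1 q2(2) q3(1) le pos by linarith
    qed
    have b: "b = 2"
    proof (rule ccontr)
      assume "b \<noteq> 2"
      then have "1 / (2 * real b) = 1 / 2" using ab(2) by simp
      then show False using q1 q2(1) q3(2) le pos by linarith
    qed
    have "torus_class x \<union> torus_class y \<union> torus_class z = carrier H - Z"
    proof (rule ccontr)
      assume "torus_class x \<union> torus_class y \<union> torus_class z \<noteq> carrier H - Z"
      then obtain w where w: "w \<in> carrier H - Z" "w \<notin> torus_class x" "w \<notin> torus_class y" "w \<notin> torus_class z" using sub by blast
      obtain u v where uv: "2 \<le> u" "v = 1 \<or> v = 2" "card (C w) = 2 * u" "card (torus_normalizer w) = v * card (C w)"
        "v * (2 * u) \<le> order H" "real (card (torus_class w)) = order H * ((1 - 1 / u) / v)"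
        by (rule class_data[OF w(1)])
      have "(torus_class x \<union> torus_class y \<union> torus_class z) \<inter> torus_class w = {}" using torus_class_disjoint x y z w by blast
      then have card4: "card (torus_class x \<union> torus_class y \<union> torus_class z \<union> torus_class w) = card (torus_class x) + card (torus_class y) + card (torus_class z) + card (torus_class w)"
        using finc x y z w cxyz by (simp add: card_Un_disjoint)
      have "torus_class x \<union> torus_class y \<union> torus_class z \<union> torus_class w \<subseteq> carrier H - Z" using sub torus_class_sub w by blast
      then have "card (torus_class x) + card (torus_class y) + card (torus_class z) + card (torus_class w) \<le> 2 * k - 2"
        using card_mono[of "carrier H - Z"] finite_H card4 tot by (metis finite_Diff)
      then have "real (card (torus_class x)) + real (card (torus_class y)) + real (card (torus_class z)) + real (card (torus_class w)) \<le> 2 * real k - 2"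
        using k1 by (simp add: of_nat_diff flip: of_nat_add)
      then have "2 * real k * ((1 - 1 / c) / 2 + (1 - 1 / d) / f + (1 - 1 / a) / b + (1 - 1 / u) / v) \<le> 2 * real k * (1 - 1 / k)"
        unfolding m1 df(6) ab(6) uv(6) k using k0 by (simp add: algebra_simps)
      then have "(1 - 1 / real c) / 2 + (1 - 1 / d) / f + (1 - 1 / a) / b + (1 - 1 / u) / v \<le> 1 - 1 / k"
        using k0 by (subst (asm) mult_le_cancel_left_pos) simp_all
      then show False using q1 q2(1) q3(1) class_weight_bounds(1)[OF uv(1,2)] pos by linarith
    qed
    then have "real (card (torus_class x)) + real (card (torus_class y)) + real (card (torus_class z)) = 2 * real k - 2"
      using cxyz tot k1 by (simp add: of_nat_diff flip: of_nat_add)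
    then have "2 * real k * ((1 - 1 / c) / 2 + (1 - 1 / d) / f + (1 - 1 / a) / b) = 2 * real k * (1 - 1 / k)"
      unfolding m1 df(6) ab(6) k using k0 by (simp add: algebra_simps)
    then have "(1 - 1 / real c) / 2 + (1 - 1 / d) / 2 + (1 - 1 / a) / 2 = 1 - 1 / k"
      unfolding f b using k0 by (subst (asm) mult_cancel_left) simp
    then have "1 / real c + 1 / d + 1 / a = 1 + 2 / k" by (simp add: field_simps)
    then have "k = 12"
      using triangle_equation[OF ce(1) df(1) ab(1) k0] ck(2) dk ak k24 by blast
    then show ?thesis using k by simp
  qed
qed

end

section \<open>Matrices of determinant one over a prime field\<close>

text \<open>
  Matrices are given by integer representatives of their entries, so that identities between matrices become congruences between
  integer polynomials. The bound on $p$ ensures that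
  $2^4 \neq 1$, which makes commutators with $\mathrm{diag}(2, 1/2)$ useful.
\<close>

locale SL2_prime =
  fixes p :: nat
  assumes prime_p: "prime p" and p_gt_5: "5 < p"
begin

abbreviation eqm :: "int \<Rightarrow> int \<Rightarrow> bool" (infix "\<doteq>" 50)
  where "x \<doteq> y \<equiv> [x = y] (mod int p)"

abbreviation G :: "(int \<times> int \<times> int \<times> int) monoid"
  where "G \<equiv> SL2 (residue_ring (int p))"

text \<open>
  Reducing the entries makes this the canonical form used by the carrier of \<open>SL2\<close>, for arbitrary integers.
\<close>

definition Mat :: "int \<Rightarrow> int \<Rightarrow> int \<Rightarrow> int \<Rightarrow> int \<times> int \<times> int \<times> int"
  where "Mat a b c d = (a mod int p, b mod int p, c mod int p, d mod int p)"

definition tr :: "int \<times> int \<times> int \<times> int \<Rightarrow> int"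
  where "tr = (\<lambda>(a, b, c, d). (a + d) mod int p)"

sublocale F: residues "int p" "residue_ring (int p)"
  using p_gt_5 by unfold_locales auto

lemma eqm_0_iff: "x \<doteq> 0 \<longleftrightarrow> int p dvd x"
  by (simp add: cong_0_iff)

lemma eqm_mult_0: "x * y \<doteq> 0 \<longleftrightarrow> x \<doteq> 0 \<or> y \<doteq> 0"
  using prime_p by (simp add: eqm_0_iff prime_dvd_mult_iff)

lemma eqm_inverse:
  assumes "\<not> x \<doteq> 0" obtains y where "x * y \<doteq> 1"
proof -
  have "coprime x (int p)"
    using prime_p assms
    by (metis coprime_commute eqm_0_iff prime_imp_coprime prime_int_nat_transfer prime_nat_int_transfer)
  then show thesis using that cong_solve_coprime_int by blast
qed

lemma small_not_eqm_0:
  assumes "0 < x" "x < int p" shows "\<not> x \<doteq> 0"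
  using assms by (auto simp: eqm_0_iff dest: zdvd_imp_le)

lemma two_not_0: "\<not> 2 \<doteq> 0" and three_not_0: "\<not> 3 \<doteq> 0" and five_not_0: "\<not> 5 \<doteq> 0"
  using p_gt_5 by (simp_all add: small_not_eqm_0)

lemma Mat_eq_iff [simp]:
  "Mat a b c d = Mat a' b' c' d' \<longleftrightarrow> a \<doteq> a' \<and> b \<doteq> b' \<and> c \<doteq> c' \<and> d \<doteq> d'"
  by (simp add: Mat_def cong_def)

lemma Mat_mult [simp]:
  "Mat a b c d \<otimes>\<^bsub>G\<^esub> Mat a' b' c' d' =
   Mat (a * a' + b * c') (a * b' + b * d') (c * a' + d * c') (c * b' + d * d')"
  unfolding Mat_def SL2_def
  by (simp add: F.res_mult_eq F.res_add_eq mod_add_eq)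
    (simp flip: cong_def, intro conjI cong_add cong_mult; simp)

lemma Mat_one: "\<one>\<^bsub>G\<^esub> = Mat 1 0 0 1"
  using p_gt_5 by (simp add: Mat_def SL2_def F.res_one_eq F.res_zero_eq)

lemma Mat_in_carrier [simp]: "Mat a b c d \<in> carrier G \<longleftrightarrow> a * d - b * c \<doteq> 1"
proof -
  have "1 mod int p = 1" using p_gt_5 by simp
  moreover have "(a mod int p * (d mod int p) - b mod int p * (c mod int p)) mod int p = (a * d - b * c) mod int p"
    by (simp flip: cong_def, intro cong_diff cong_mult; simp)
  ultimately show ?thesis
    using p_gt_5
    by (simp add: Mat_def SL2_def F.res_mult_eq F.res_add_eq F.res_one_eq F.res_neg_eq a_minus_def
        F.res_carrier_eq cong_def mod_simps)
qed

lemma carrier_Mat: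
  assumes "x \<in> carrier G"
  obtains a b c d where "x = Mat a b c d" "a * d - b * c \<doteq> 1"
proof -
  obtain a b c d where x: "x = (a, b, c, d)" by (cases x)
  then have "a \<in> {0..int p - 1}" "b \<in> {0..int p - 1}" "c \<in> {0..int p - 1}" "d \<in> {0..int p - 1}"
    using assms by (auto simp: SL2_def F.res_carrier_eq)
  then have "x = Mat a b c d" using x by (simp add: Mat_def)
  then show thesis using that assms Mat_in_carrier by metis
qed

lemma tr_Mat [simp]: "tr (Mat a b c d) = (a + d) mod int p"
  by (simp add: tr_def Mat_def mod_simps)

lemma finite_G: "finite (carrier G)"
proof -
  have "carrier G \<subseteq> {0..int p} \<times> {0..int p} \<times> {0..int p} \<times> {0..int p}"
    by (auto simp: SL2_def F.res_carrier_eq)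
  then show ?thesis by (rule finite_subset) simp
qed

sublocale G: group G
proof (rule groupI)
  show "\<one>\<^bsub>G\<^esub> \<in> carrier G" by (simp add: Mat_one)
next
  fix x y assume "x \<in> carrier G" "y \<in> carrier G"
  then obtain a b c d a' b' c' d'
    where x: "x = Mat a b c d" "a * d - b * c \<doteq> 1"
      and y: "y = Mat a' b' c' d'" "a' * d' - b' * c' \<doteq> 1"
    by (elim carrier_Mat)
  have "(a * a' + b * c') * (c * b' + d * d') - (a * b' + b * d') * (c * a' + d * c') \<doteq> 1"
    using x(2) y(2) unfolding cong_iff_dvd_diff by Groebner_Basis.algebra
  then show "x \<otimes>\<^bsub>G\<^esub> y \<in> carrier G" by (simp add: x y)
next
  fix x y z assume "x \<in> carrier G" "y \<in> carrier G" "z \<in> carrier G"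
  then show "x \<otimes>\<^bsub>G\<^esub> y \<otimes>\<^bsub>G\<^esub> z = x \<otimes>\<^bsub>G\<^esub> (y \<otimes>\<^bsub>G\<^esub> z)"
    by (elim carrier_Mat) (simp add: algebra_simps)
next
  fix x assume "x \<in> carrier G"
  then show "\<one>\<^bsub>G\<^esub> \<otimes>\<^bsub>G\<^esub> x = x"
    by (elim carrier_Mat) (simp add: Mat_one)
next
  fix x assume "x \<in> carrier G"
  then obtain a b c d where x: "x = Mat a b c d" "a * d - b * c \<doteq> 1" by (elim carrier_Mat)
  have "Mat d (-b) (-c) a \<in> carrier G" using x by (simp add: algebra_simps)
  moreover have "Mat d (-b) (-c) a \<otimes>\<^bsub>G\<^esub> x = \<one>\<^bsub>G\<^esub>"
    using x(2) by (simp add: x(1) Mat_one algebra_simps)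
  ultimately show "\<exists>y\<in>carrier G. y \<otimes>\<^bsub>G\<^esub> x = \<one>\<^bsub>G\<^esub>" by blast
qed

lemma Mat_inv [simp]:
  assumes "a * d - b * c \<doteq> 1"
  shows "inv\<^bsub>G\<^esub> (Mat a b c d) = Mat d (-b) (-c) a"
proof (rule G.inv_equality)
  show "Mat d (-b) (-c) a \<otimes>\<^bsub>G\<^esub> Mat a b c d = \<one>\<^bsub>G\<^esub>"
    using assms by (simp add: Mat_one algebra_simps)
qed (use assms in \<open>simp_all add: algebra_simps\<close>)

lemma center_G: "group_center G = {Mat 1 0 0 1, Mat (-1) 0 0 (-1)}"
proof (intro equalityI subsetI)
  fix x assume x: "x \<in> group_center G"
  then obtain a b c d where M: "x = Mat a b c d" "a * d - b * c \<doteq> 1"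
    using carrier_Mat unfolding group_center_def by blast
  have "x \<otimes>\<^bsub>G\<^esub> Mat 1 1 0 1 = Mat 1 1 0 1 \<otimes>\<^bsub>G\<^esub> x" "x \<otimes>\<^bsub>G\<^esub> Mat 1 0 1 1 = Mat 1 0 1 1 \<otimes>\<^bsub>G\<^esub> x"
    using x by (auto simp: group_center_def)
  then have c: "c \<doteq> 0" and b: "b \<doteq> 0" and ad: "a \<doteq> d"
    by (auto simp: M cong_iff_dvd_diff algebra_simps)
  have "(a - 1) * (a + 1) \<doteq> 0"
    using M(2) b c ad unfolding cong_iff_dvd_diff by Groebner_Basis.algebra
  then have "a - 1 \<doteq> 0 \<or> a + 1 \<doteq> 0" by (simp only: eqm_mult_0)
  then have "a \<doteq> 1 \<and> d \<doteq> 1 \<or> a \<doteq> -1 \<and> d \<doteq> -1"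
    using ad by (metis cong_diff_iff_cong_0 cong_sym cong_trans diff_minus_eq_add)
  then show "x \<in> {Mat 1 0 0 1, Mat (-1) 0 0 (-1)}"
    using b c by (auto simp: M)
next
  fix x assume "x \<in> {Mat 1 0 0 1, Mat (-1) 0 0 (-1)}"
  then show "x \<in> group_center G"
    by (auto simp: group_center_def elim!: carrier_Mat)
qed

end

context SL2_prime begin

text \<open>
  The vectors $(a - d, b, c)$ of the traceless parts must be parallel.
\<close>

lemma Mat_commute_iff:
  "Mat a b c d \<otimes>\<^bsub>G\<^esub> Mat a' b' c' d' = Mat a' b' c' d' \<otimes>\<^bsub>G\<^esub> Mat a b c d \<longleftrightarrow>
   (a - d) * b' \<doteq> b * (a' - d') \<and> (a - d) * c' \<doteq> c * (a' - d') \<and> b * c' \<doteq> c * b'"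
proof -
  have "int p dvd a * a' + b * c' - (a' * a + b' * c) \<longleftrightarrow> int p dvd b * c' - c * b'"
    by (simp add: algebra_simps)
  moreover have "int p dvd c * b' + d * d' - (c' * b + d' * d) \<longleftrightarrow> int p dvd b * c' - c * b'"
    by (simp add: algebra_simps dvd_diff_commute)
  moreover have "int p dvd a * b' + b * d' - (a' * b + b' * d) \<longleftrightarrow> int p dvd (a - d) * b' - b * (a' - d')"
    by (simp add: algebra_simps)
  moreover have "int p dvd c * a' + d * c' - (c' * a + d' * c) \<longleftrightarrow> int p dvd (a - d) * c' - c * (a' - d')"
    by (subst dvd_diff_commute) (simp add: algebra_simps)
  ultimately show ?thesis unfolding Mat_mult Mat_eq_iff cong_iff_dvd_diff by blast
qed

lemma Mat_in_center_iff:
  assumes "a * d - b * c \<doteq> 1"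
  shows "Mat a b c d \<in> group_center G \<longleftrightarrow> b \<doteq> 0 \<and> c \<doteq> 0 \<and> a - d \<doteq> 0"
proof
  assume "Mat a b c d \<in> group_center G"
  then show "b \<doteq> 0 \<and> c \<doteq> 0 \<and> a - d \<doteq> 0"
    unfolding center_G by (auto simp: cong_diff_iff_cong_0 intro: cong_trans cong_sym)
next
  assume "b \<doteq> 0 \<and> c \<doteq> 0 \<and> a - d \<doteq> 0"
  then have "\<And>a' b' c' d'. Mat a b c d \<otimes>\<^bsub>G\<^esub> Mat a' b' c' d' = Mat a' b' c' d' \<otimes>\<^bsub>G\<^esub> Mat a b c d"
    unfolding Mat_commute_iff by (metis cong_mult_self_left cong_refl cong_scalar_right cong_sym cong_trans mult_zero_left)
  then show "Mat a b c d \<in> group_center G"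
    using assms by (auto simp: group_center_def elim!: carrier_Mat)
qed

lemma parallel_scalar:
  assumes "\<not> (x \<doteq> 0 \<and> y \<doteq> 0 \<and> z \<doteq> 0)" "x * y' \<doteq> y * x'" "x * z' \<doteq> z * x'" "y * z' \<doteq> z * y'"
  obtains l where "x' \<doteq> l * x" "y' \<doteq> l * y" "z' \<doteq> l * z"
proof -
  consider "\<not> x \<doteq> 0" | "\<not> y \<doteq> 0" | "\<not> z \<doteq> 0" using assms(1) by blast
  then show thesis
  proof cases
    case 1
    then obtain i where i: "x * i \<doteq> 1" by (rule eqm_inverse)
    have "x' \<doteq> x' * i * x" "y' \<doteq> x' * i * y" "z' \<doteq> x' * i * z"
      using i assms(2-) unfolding cong_iff_dvd_diff by (Groebner_Basis.algebra+)
    then show thesis by (rule that)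
  next
    case 2
    then obtain i where i: "y * i \<doteq> 1" by (rule eqm_inverse)
    have "x' \<doteq> y' * i * x" "y' \<doteq> y' * i * y" "z' \<doteq> y' * i * z"
      using i assms(2-) unfolding cong_iff_dvd_diff by (Groebner_Basis.algebra+)
    then show thesis by (rule that)
  next
    case 3
    then obtain i where i: "z * i \<doteq> 1" by (rule eqm_inverse)
    have "x' \<doteq> z' * i * x" "y' \<doteq> z' * i * y" "z' \<doteq> z' * i * z"
      using i assms(2-) unfolding cong_iff_dvd_diff by (Groebner_Basis.algebra+)
    then show thesis by (rule that)
  qed
qed

text \<open>
  Matrices commuting with a non-scalar matrix have traceless parts that are multiples of one and the same nonzero vector.
\<close>

lemma commute_trans:
  assumes "x \<in> carrier G" "y \<in> carrier G" "z \<in> carrier G" "y \<notin> group_center G"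
    and xy: "x \<otimes>\<^bsub>G\<^esub> y = y \<otimes>\<^bsub>G\<^esub> x" and yz: "y \<otimes>\<^bsub>G\<^esub> z = z \<otimes>\<^bsub>G\<^esub> y"
  shows "x \<otimes>\<^bsub>G\<^esub> z = z \<otimes>\<^bsub>G\<^esub> x"
proof -
  obtain a b c d where x: "x = Mat a b c d" by (meson assms(1) carrier_Mat)
  obtain a' b' c' d' where y: "y = Mat a' b' c' d'" "a' * d' - b' * c' \<doteq> 1" by (meson assms(2) carrier_Mat)
  obtain a'' b'' c'' d'' where z: "z = Mat a'' b'' c'' d''" by (meson assms(3) carrier_Mat)
  have nz: "\<not> (a' - d' \<doteq> 0 \<and> b' \<doteq> 0 \<and> c' \<doteq> 0)"
    using assms(4) y Mat_in_center_iff by blast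
  obtain k where k: "a - d \<doteq> k * (a' - d')" "b \<doteq> k * b'" "c \<doteq> k * c'"
    using parallel_scalar[OF nz] xy[symmetric] unfolding x y Mat_commute_iff by metis
  obtain l where l: "a'' - d'' \<doteq> l * (a' - d')" "b'' \<doteq> l * b'" "c'' \<doteq> l * c'"
    using parallel_scalar[OF nz] yz unfolding z y Mat_commute_iff by metis
  show ?thesis
    unfolding x z Mat_commute_iff
    using k l unfolding cong_iff_dvd_diff by (intro conjI; Groebner_Basis.algebra)
qed

lemma tr_mult_commute:
  assumes "x \<in> carrier G" "y \<in> carrier G"
  shows "tr (x \<otimes>\<^bsub>G\<^esub> y) = tr (y \<otimes>\<^bsub>G\<^esub> x)"
  using assms by (elim carrier_Mat) (simp add: algebra_simps)

lemma tr_conj: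
  assumes "x \<in> carrier G" "n \<in> carrier G"
  shows "tr (n \<otimes>\<^bsub>G\<^esub> x \<otimes>\<^bsub>G\<^esub> inv\<^bsub>G\<^esub> n) = tr x"
  by (metis G.inv_closed G.inv_solve_left' G.m_closed assms tr_mult_commute)

text \<open>
  The form $x^2 + 4yz$ is the discriminant of the characteristic polynomial, as a function of the traceless part. A scaling by $l$
  multiplies it by $l^2$, so that $l = \pm 1$ if a nonzero value is preserved.
\<close>

lemma parallel_same_form:
  assumes "\<not> x\<^sup>2 + 4 * y * z \<doteq> 0" "x * y' \<doteq> y * x'" "x * z' \<doteq> z * x'" "y * z' \<doteq> z * y'"
    and "x'\<^sup>2 + 4 * y' * z' \<doteq> x\<^sup>2 + 4 * y * z"
  shows "x' \<doteq> x \<and> y' \<doteq> y \<and> z' \<doteq> z \<or> x' \<doteq> -x \<and> y' \<doteq> -y \<and> z' \<doteq> -z"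
proof -
  have nz: "\<not> (x \<doteq> 0 \<and> y \<doteq> 0 \<and> z \<doteq> 0)"
  proof
    assume "x \<doteq> 0 \<and> y \<doteq> 0 \<and> z \<doteq> 0"
    then have "x\<^sup>2 + 4 * y * z \<doteq> 0" unfolding cong_iff_dvd_diff by Groebner_Basis.algebra
    with assms(1) show False by contradiction
  qed
  obtain l where l: "x' \<doteq> l * x" "y' \<doteq> l * y" "z' \<doteq> l * z"
    by (rule parallel_scalar[OF nz assms(2-4)])
  have "(l - 1) * (l + 1) * (x\<^sup>2 + 4 * y * z) \<doteq> 0"
    using l assms(5) unfolding cong_iff_dvd_diff by Groebner_Basis.algebra
  then have "l - 1 \<doteq> 0 \<or> l + 1 \<doteq> 0" using assms(1) eqm_mult_0 by blast
  then show ?thesis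
  proof
    assume "l - 1 \<doteq> 0"
    then have "x' \<doteq> x" "y' \<doteq> y" "z' \<doteq> z"
      using l unfolding cong_iff_dvd_diff by (Groebner_Basis.algebra+)
    then show ?thesis by blast
  next
    assume "l + 1 \<doteq> 0"
    then have "x' \<doteq> -x" "y' \<doteq> -y" "z' \<doteq> -z"
      using l unfolding cong_iff_dvd_diff by (Groebner_Basis.algebra+)
    then show ?thesis by blast
  qed
qed

text \<open>
  Equal traces and determinants mean equal discriminants; commuting means parallel traceless parts. The sign $-1$ of the
  scaling factor gives the adjugate matrix, which is the inverse.
\<close>

lemma same_trace_commuting:
  assumes "x \<in> carrier G" "y \<in> carrier G" "\<not> (tr x)\<^sup>2 \<doteq> 4" "tr y = tr x" "x \<otimes>\<^bsub>G\<^esub> y = y \<otimes>\<^bsub>G\<^esub> x"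
  shows "y = x \<or> y = inv\<^bsub>G\<^esub> x"
proof -
  obtain a b c d where x: "x = Mat a b c d" "a * d - b * c \<doteq> 1" by (meson assms(1) carrier_Mat)
  obtain a' b' c' d' where y: "y = Mat a' b' c' d'" "a' * d' - b' * c' \<doteq> 1" by (meson assms(2) carrier_Mat)
  have t: "a' + d' \<doteq> a + d" using assms(4) by (simp add: x y cong_def)
  have nz: "\<not> (a - d)\<^sup>2 + 4 * b * c \<doteq> 0"
  proof
    assume "(a - d)\<^sup>2 + 4 * b * c \<doteq> 0"
    then have "(a + d)\<^sup>2 \<doteq> 4" using x(2) unfolding cong_iff_dvd_diff by Groebner_Basis.algebra
    then have "(tr x)\<^sup>2 \<doteq> 4" by (simp add: x cong_def power_mod)
    with assms(3) show False by contradiction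
  qed
  have "(a' - d')\<^sup>2 + 4 * b' * c' \<doteq> (a - d)\<^sup>2 + 4 * b * c"
    using t x(2) y(2) unfolding cong_iff_dvd_diff by Groebner_Basis.algebra
  moreover have "(a - d) * b' \<doteq> b * (a' - d')" "(a - d) * c' \<doteq> c * (a' - d')" "b * c' \<doteq> c * b'"
    using assms(5) unfolding x y Mat_commute_iff by auto
  ultimately have "a' - d' \<doteq> a - d \<and> b' \<doteq> b \<and> c' \<doteq> c \<or> a' - d' \<doteq> -(a - d) \<and> b' \<doteq> -b \<and> c' \<doteq> -c"
    using parallel_same_form[OF nz] by blast
  then show ?thesis
  proof
    assume h: "a' - d' \<doteq> a - d \<and> b' \<doteq> b \<and> c' \<doteq> c"
    have "2 * (a' - a) \<doteq> 0" "2 * (d' - d) \<doteq> 0"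
      using h t unfolding cong_iff_dvd_diff by (Groebner_Basis.algebra+)
    then have "a' \<doteq> a" "d' \<doteq> d" using two_not_0 by (auto simp only: eqm_mult_0 cong_diff_iff_cong_0)
    then show ?thesis using h by (simp add: x y)
  next
    assume h: "a' - d' \<doteq> -(a - d) \<and> b' \<doteq> -b \<and> c' \<doteq> -c"
    have "2 * (a' - d) \<doteq> 0" "2 * (d' - a) \<doteq> 0"
      using h t unfolding cong_iff_dvd_diff by (Groebner_Basis.algebra+)
    then have "a' \<doteq> d" "d' \<doteq> a" using two_not_0 by (auto simp only: eqm_mult_0 cong_diff_iff_cong_0)
    then show ?thesis using h x(2) by (simp add: x(1) y)
  qed
qed

end

section \<open>Transvections and normal subgroups\<close>

context SL2_prime begin

abbreviation Z where "Z \<equiv> group_center G"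

text \<open>
  The transvection with axis spanned by $(u, v)$: the identity plus $s$ times the nilpotent matrix with
  image and kernel spanned by $(u, v)$.
\<close>

definition Uni :: "int \<Rightarrow> int \<Rightarrow> int \<Rightarrow> int \<times> int \<times> int \<times> int" where
  "Uni u v s = Mat (1 - s * (u * v)) (s * (u * u)) (- (s * (v * v))) (1 + s * (u * v))"

lemma Uni_in_carrier [simp]: "Uni u v s \<in> carrier G"
  by (simp add: Uni_def algebra_simps power2_eq_square)

lemma Uni_add: "Uni u v s \<otimes>\<^bsub>G\<^esub> Uni u v t = Uni u v (s + t)"
  by (simp add: Uni_def algebra_simps power2_eq_square)

lemma Uni_0: "Uni u v 0 = \<one>\<^bsub>G\<^esub>"
  by (simp add: Uni_def Mat_one)

lemma Uni_pow: "Uni u v s [^]\<^bsub>G\<^esub> (n::nat) = Uni u v (int n * s)"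
  by (induction n) (simp_all add: Uni_0 Uni_add algebra_simps)

lemma Uni_cong: "u \<doteq> u' \<Longrightarrow> v \<doteq> v' \<Longrightarrow> s \<doteq> s' \<Longrightarrow> Uni u v s = Uni u' v' s'"
  unfolding Uni_def Mat_eq_iff cong_minus_minus_iff by (intro conjI cong_diff cong_add cong_mult; simp)

lemma Uni_conj:
  assumes "a * d - b * c \<doteq> 1"
  shows "Mat a b c d \<otimes>\<^bsub>G\<^esub> Uni u v s \<otimes>\<^bsub>G\<^esub> inv\<^bsub>G\<^esub> (Mat a b c d) = Uni (a * u + b * v) (c * u + d * v) s"
  unfolding Mat_inv[OF assms] Uni_def Mat_mult Mat_eq_iff
  using assms unfolding cong_iff_dvd_diff by (intro conjI; (Groebner_Basis.algebra | simp add: algebra_simps))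

text \<open>
  The integer multiples of a nonzero residue $s$ exhaust the prime field.
\<close>

lemma Uni_all:
  assumes H: "subgroup H G" "Uni u v s \<in> H" and s: "\<not> s \<doteq> 0"
  shows "Uni u v t \<in> H"
proof -
  interpret subgroup H G by fact
  obtain i where i: "s * i \<doteq> 1" using eqm_inverse[OF s] .
  define n where "n = nat ((t * i) mod int p)"
  have n: "int n \<doteq> t * i" using p_gt_5 by (simp add: n_def)
  have "int n * s \<doteq> t" using i n unfolding cong_iff_dvd_diff by Groebner_Basis.algebra
  then have "Uni u v s [^]\<^bsub>G\<^esub> n = Uni u v t" unfolding Uni_pow by (intro Uni_cong) simp_all
  then show ?thesis using G.subgroup_nat_pow[OF H, of n] by metis
qed

lemma elementary_generate:
  assumes K: "subgroup K G" and up: "\<And>t. Mat 1 t 0 1 \<in> K" and lo: "\<And>t. Mat 1 0 t 1 \<in> K"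
  shows "K = carrier G"
proof -
  interpret subgroup K G by fact
  have gen: "Mat a b c d \<in> K" if det: "a * d - b * c \<doteq> 1" and c: "\<not> c \<doteq> 0" for a b c d
  proof -
    obtain i where i: "c * i \<doteq> 1" using eqm_inverse[OF c] .
    have "Mat 1 ((a - 1) * i) 0 1 \<otimes>\<^bsub>G\<^esub> Mat 1 0 c 1 \<otimes>\<^bsub>G\<^esub> Mat 1 ((d - 1) * i) 0 1 = Mat a b c d"
      unfolding Mat_mult Mat_eq_iff
      using i det unfolding cong_iff_dvd_diff by (intro conjI; (Groebner_Basis.algebra | simp add: algebra_simps))
    moreover have "Mat 1 ((a - 1) * i) 0 1 \<otimes>\<^bsub>G\<^esub> Mat 1 0 c 1 \<otimes>\<^bsub>G\<^esub> Mat 1 ((d - 1) * i) 0 1 \<in> K"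
      using up lo by blast
    ultimately show ?thesis by metis
  qed
  have "x \<in> K" if x: "x \<in> carrier G" for x
  proof -
    obtain a b c d where x: "x = Mat a b c d" "a * d - b * c \<doteq> 1" by (meson x carrier_Mat)
    show ?thesis
    proof (cases "c \<doteq> 0")
      case False then show ?thesis using gen x by blast
    next
      case True
      have "\<not> a \<doteq> 0"
      proof
        assume "a \<doteq> 0"
        then have "1 \<doteq> 0" using x(2) True unfolding cong_iff_dvd_diff by Groebner_Basis.algebra
        then show False using small_not_eqm_0[of 1] p_gt_5 by simp
      qed
      then have ac: "\<not> a + c \<doteq> 0" using True by (metis cong_add_lcancel_0 cong_add_rcancel_0 cong_trans add.commute cong_0_iff dvd_add_left_iff)
      have "a * (b + d) - b * (a + c) \<doteq> 1" using x(2) by (simp add: algebra_simps)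
      then have y: "Mat a b (a + c) (b + d) \<in> K" using gen ac by blast
      have "Mat 1 0 (-1) 1 \<otimes>\<^bsub>G\<^esub> Mat a b (a + c) (b + d) = x" by (simp add: x)
      moreover have "Mat 1 0 (-1) 1 \<otimes>\<^bsub>G\<^esub> Mat a b (a + c) (b + d) \<in> K" using lo y by blast
      ultimately show ?thesis by metis
    qed
  qed
  then show ?thesis using subset by blast
qed

text \<open>
  A base change moves the two axes to the coordinate axes, where the transvections are elementary matrices.
\<close>

lemma unipotents_generate:
  assumes H: "subgroup H G" and U: "Uni u v s \<in> H" "Uni u' v' s' \<in> H"
    and nz: "\<not> s \<doteq> 0" "\<not> s' \<doteq> 0" "\<not> u * v' - u' * v \<doteq> 0"
  shows "H = carrier G"
proof -
  interpret H: subgroup H G by fact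
  obtain i where i: "(u * v' - u' * v) * i \<doteq> 1" using eqm_inverse[OF nz(3)] .
  define g where "g = Mat u (u' * i) v (v' * i)"
  have det: "u * (v' * i) - u' * i * v \<doteq> 1" using i by (simp add: algebra_simps)
  then have g: "g \<in> carrier G" by (simp add: g_def)
  define K where "K = {y \<in> carrier G. g \<otimes>\<^bsub>G\<^esub> y \<otimes>\<^bsub>G\<^esub> inv\<^bsub>G\<^esub> g \<in> H}"
  have K: "subgroup K G" unfolding K_def by (rule G.conj_subgroup[OF H g])
  have "K = carrier G"
  proof (rule elementary_generate[OF K])
    fix t
    have eq: "Mat 1 t 0 1 = Uni 1 0 t" by (simp add: Uni_def)
    have "g \<otimes>\<^bsub>G\<^esub> Uni 1 0 t \<otimes>\<^bsub>G\<^esub> inv\<^bsub>G\<^esub> g = Uni u v t"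
      unfolding g_def Uni_conj[OF det] by (simp add: Uni_cong)
    then show "Mat 1 t 0 1 \<in> K" unfolding eq K_def using Uni_all[OF H U(1) nz(1)] by simp
  next
    fix t
    have eq: "Mat 1 0 t 1 = Uni 0 1 (-t)" by (simp add: Uni_def)
    have "g \<otimes>\<^bsub>G\<^esub> Uni 0 1 (-t) \<otimes>\<^bsub>G\<^esub> inv\<^bsub>G\<^esub> g = Uni u' v' (-t * i\<^sup>2)"
      unfolding g_def Uni_conj[OF det] by (simp add: Uni_def algebra_simps power2_eq_square)
    then show "Mat 1 0 t 1 \<in> K" unfolding eq K_def using Uni_all[OF H U(2) nz(2)] by simp
  qed
  moreover have "x \<in> H" if "x \<in> carrier G" for x
  proof -
    have "inv\<^bsub>G\<^esub> g \<otimes>\<^bsub>G\<^esub> x \<otimes>\<^bsub>G\<^esub> g \<in> K" using g that \<open>K = carrier G\<close> by simp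
    then have "g \<otimes>\<^bsub>G\<^esub> (inv\<^bsub>G\<^esub> g \<otimes>\<^bsub>G\<^esub> x \<otimes>\<^bsub>G\<^esub> g) \<otimes>\<^bsub>G\<^esub> inv\<^bsub>G\<^esub> g \<in> H" by (simp add: K_def)
    moreover have "g \<otimes>\<^bsub>G\<^esub> (inv\<^bsub>G\<^esub> g \<otimes>\<^bsub>G\<^esub> x \<otimes>\<^bsub>G\<^esub> g) \<otimes>\<^bsub>G\<^esub> inv\<^bsub>G\<^esub> g = x"
      using g that by (simp add: G.m_assoc flip: G.m_assoc[of g "inv\<^bsub>G\<^esub> g"])
    ultimately show ?thesis by simp
  qed
  ultimately show ?thesis using H.subset by blast
qed

text \<open>
  Trace $2$ and determinant $1$ make the matrix minus the identity nilpotent; its image is the axis.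
\<close>

lemma trace_two_Uni:
  assumes "x \<in> carrier G" "x \<notin> Z" "tr x \<doteq> 2"
  obtains u v s where "x = Uni u v s" "\<not> s \<doteq> 0" "\<not> (u \<doteq> 0 \<and> v \<doteq> 0)"
proof -
  obtain a b c d where x: "x = Mat a b c d" "a * d - b * c \<doteq> 1" by (meson assms(1) carrier_Mat)
  have t: "a + d \<doteq> 2" using assms(3) by (simp add: x(1))
  have one: "\<not> 1 \<doteq> 0" using small_not_eqm_0[of 1] p_gt_5 by simp
  show thesis
  proof (cases "b \<doteq> 0")
    case False
    then obtain i where i: "b * i \<doteq> 1" using eqm_inverse by blast
    have "1 - b * ((1 - a) * i) \<doteq> a" "- (b * ((1 - a) * i * ((1 - a) * i))) \<doteq> c" "1 + b * ((1 - a) * i) \<doteq> d"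
      using i t x(2) unfolding cong_iff_dvd_diff by (Groebner_Basis.algebra+)
    then have "x = Uni 1 ((1 - a) * i) b" by (simp add: x(1) Uni_def cong_sym_eq)
    then show thesis using that False one by blast
  next
    case True
    have "(a - 1) * (a - 1) \<doteq> 0"
      using True t x(2) unfolding cong_iff_dvd_diff by Groebner_Basis.algebra
    then have a: "a - 1 \<doteq> 0" using eqm_mult_0 by blast
    have "d \<doteq> 1" using a t unfolding cong_iff_dvd_diff by Groebner_Basis.algebra
    then have "x = Uni 0 1 (-c)" using True a by (simp add: x(1) Uni_def cong_diff_iff_cong_0)
    moreover have "\<not> -c \<doteq> 0"
    proof
      assume "-c \<doteq> 0"
      then have "c \<doteq> 0" by (simp add: eqm_0_iff)
      moreover have "a - d \<doteq> 0" using a t unfolding cong_iff_dvd_diff by Groebner_Basis.algebra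
      ultimately show False using assms(2) True Mat_in_center_iff[OF x(2)] x(1) by blast
    qed
    ultimately show thesis using that one by blast
  qed
qed

text \<open>
  The sets of values of $u^2 + 1$ and of $f z^2$ have $(p+1)/2$ elements each, so they intersect.
\<close>

lemma squares_pigeonhole:
  assumes f: "\<not> f \<doteq> 0"
  obtains u z where "u\<^sup>2 + 1 \<doteq> f * z\<^sup>2"
proof -
  define I where "I = {0..(int p - 1) div 2}"
  define A where "A = (\<lambda>x. (x\<^sup>2 + 1) mod int p) ` I"
  define B where "B = (\<lambda>x. (f * x\<^sup>2) mod int p) ` I"
  have "odd p" using prime_p p_gt_5 prime_odd_nat by auto
  then have cI: "2 * card I = p + 1" unfolding I_def using p_gt_5 by (auto elim!: oddE)
  have sq: "x = y" if "x \<in> I" "y \<in> I" "x\<^sup>2 \<doteq> y\<^sup>2" for x y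
  proof -
    have "(x - y) * (x + y) \<doteq> 0"
      using that(3) unfolding cong_iff_dvd_diff by Groebner_Basis.algebra
    then have "x - y \<doteq> 0 \<or> x + y \<doteq> 0" by (simp only: eqm_mult_0)
    then show "x = y"
    proof
      assume d: "x - y \<doteq> 0"
      have "\<bar>x - y\<bar> < int p" using that p_gt_5 by (auto simp: I_def)
      then show ?thesis using d zdvd_not_zless[of "\<bar>x - y\<bar>" "int p"] by (force simp: eqm_0_iff)
    next
      assume d: "x + y \<doteq> 0"
      have "x + y < int p" "0 \<le> x + y" using that p_gt_5 by (auto simp: I_def)
      then have "x + y = 0" using d zdvd_not_zless[of "x + y" "int p"] by (force simp: eqm_0_iff)
      then show ?thesis using that by (auto simp: I_def)
    qed
  qed
  have "inj_on (\<lambda>x. (x\<^sup>2 + 1) mod int p) I"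
    by (intro inj_onI sq) (auto simp flip: cong_def simp: cong_add_rcancel)
  then have cA: "card A = card I" unfolding A_def by (rule card_image)
  have "inj_on (\<lambda>x. (f * x\<^sup>2) mod int p) I"
  proof (intro inj_onI sq)
    fix x y assume "(f * x\<^sup>2) mod int p = (f * y\<^sup>2) mod int p"
    then have "f * (x\<^sup>2 - y\<^sup>2) \<doteq> 0"
      by (simp add: right_diff_distrib cong_diff_iff_cong_0) (simp add: cong_def)
    then have "x\<^sup>2 - y\<^sup>2 \<doteq> 0" using f eqm_mult_0 by blast
    then show "x\<^sup>2 \<doteq> y\<^sup>2" by (simp only: cong_diff_iff_cong_0)
  qed auto
  then have cB: "card B = card I" unfolding B_def by (rule card_image)
  have "A \<inter> B \<noteq> {}"
  proof
    assume "A \<inter> B = {}"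
    moreover have "finite A" "finite B" by (auto simp: A_def B_def I_def)
    ultimately have "card (A \<union> B) = p + 1" using cA cB cI by (simp add: card_Un_disjoint)
    moreover have "A \<union> B \<subseteq> {0..<int p}" using p_gt_5 by (auto simp: A_def B_def)
    then have "card (A \<union> B) \<le> card {0..<int p}" by (intro card_mono) auto
    ultimately show False by simp
  qed
  then obtain u z where "(u\<^sup>2 + 1) mod int p = (f * z\<^sup>2) mod int p" by (auto simp: A_def B_def)
  then show thesis using that by (simp add: cong_def)
qed

end

context SL2_prime begin

lemma one_not_0: "\<not> 1 \<doteq> 0"
  using small_not_eqm_0[of 1] p_gt_5 by simp

lemma row_completion:
  assumes "\<not> (a \<doteq> 0 \<and> c \<doteq> 0)"
  obtains b d where "a * d - b * c \<doteq> 1"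
proof (cases "a \<doteq> 0")
  case False
  then obtain i where "a * i \<doteq> 1" by (rule eqm_inverse)
  then show thesis using that[of i 0] by simp
next
  case True
  then obtain i where "c * i \<doteq> 1" using assms eqm_inverse by blast
  then show thesis using that[of 0 "-i"] by (simp add: mult.commute)
qed

text \<open>
  A matrix is determined by its first column, one of $p^2 - 1$ nonzero vectors, and by the multiple of that column
  which is added to a fixed completion.
\<close>

lemma order_G: "order G = p * (p\<^sup>2 - 1)"
proof -
  define X where "X = {0..<int p} \<times> {0..<int p} - {(0, 0)}"
  define good where "good = (\<lambda>(a, c) (b, d). a * d - b * c \<doteq> 1)"
  define base where "base = (\<lambda>v. SOME w. good v w)"
  have base: "good v (base v)" if "v \<in> X" for v
  proof -
    obtain a c where v: "v = (a, c)" by (cases v)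
    have "\<not> (a \<doteq> 0 \<and> c \<doteq> 0)"
      using that v small_not_eqm_0[of a] small_not_eqm_0[of c] by (auto simp: X_def)
    then obtain b d where "a * d - b * c \<doteq> 1" by (rule row_completion)
    then have "good v (b, d)" by (simp add: good_def v)
    then show ?thesis unfolding base_def by (rule someI)
  qed
  define F where "F = (\<lambda>(v, t). case v of (a, c) \<Rightarrow> case base v of (b, d) \<Rightarrow> Mat a (b + t * a) c (d + t * c))"
  have red: "x = y" if "x \<in> {0..<int p}" "y \<in> {0..<int p}" "x \<doteq> y" for x y
    using that by (simp add: cong_def)
  have "bij_betw F (X \<times> {0..<int p}) (carrier G)"
    unfolding bij_betw_def
  proof
    show "inj_on F (X \<times> {0..<int p})"
    proof (rule inj_onI)
      fix q q' assume q: "q \<in> X \<times> {0..<int p}" "q' \<in> X \<times> {0..<int p}" "F q = F q'"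
      obtain a c t where q1: "q = ((a, c), t)" by (metis prod.collapse)
      obtain a' c' t' where q2: "q' = ((a', c'), t')" by (metis prod.collapse)
      obtain b d where bd: "base (a, c) = (b, d)" by (metis prod.collapse)
      obtain b' d' where bd': "base (a', c') = (b', d')" by (metis prod.collapse)
      have "a \<doteq> a'" "c \<doteq> c'" using q(3) by (simp_all add: F_def q1 q2 bd bd')
      then have ac: "a = a'" "c = c'" using red q by (auto simp: X_def q1 q2)
      have e: "b + t * a \<doteq> b + t' * a" "d + t * c \<doteq> d + t' * c"
        using q(3) bd bd' ac by (simp_all add: F_def q1 q2)
      have "a * d - b * c \<doteq> 1" using base[of "(a, c)"] q(1) bd by (simp add: good_def q1)
      then have "t \<doteq> t'" using e unfolding cong_iff_dvd_diff by Groebner_Basis.algebra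
      then show "q = q'" using red q ac by (simp add: q1 q2)
    qed
    show "F ` (X \<times> {0..<int p}) = carrier G"
    proof (intro equalityI subsetI)
      fix x assume "x \<in> F ` (X \<times> {0..<int p})"
      then obtain a c t where v: "(a, c) \<in> X" "x = F ((a, c), t)" by auto
      obtain b d where bd: "base (a, c) = (b, d)" by (metis prod.collapse)
      have "a * d - b * c \<doteq> 1" using base[OF v(1)] bd by (simp add: good_def)
      then show "x \<in> carrier G" by (simp add: v(2) F_def bd algebra_simps)
    next
      fix x assume "x \<in> carrier G"
      then obtain a0 b0 c0 d0 where x0: "x = Mat a0 b0 c0 d0" "a0 * d0 - b0 * c0 \<doteq> 1" by (rule carrier_Mat)
      define a c where "a = a0 mod int p" and "c = c0 mod int p"
      have x: "x = Mat a b0 c d0" by (simp add: x0 a_def c_def)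
      then have det: "a * d0 - b0 * c \<doteq> 1" using \<open>x \<in> carrier G\<close> by simp
      have X: "(a, c) \<in> X"
        using det one_not_0 p_gt_5 by (auto simp: X_def a_def c_def cong_sym_eq)
      obtain b d where bd: "base (a, c) = (b, d)" by (metis prod.collapse)
      have det': "a * d - b * c \<doteq> 1" using base[OF X] bd by (simp add: good_def)
      define t where "t = (d * b0 - b * d0) mod int p"
      have t: "t \<doteq> d * b0 - b * d0" by (simp add: t_def)
      have "b + t * a \<doteq> b0" "d + t * c \<doteq> d0"
        using det det' t unfolding cong_iff_dvd_diff by (Groebner_Basis.algebra+)
      then have "x = F ((a, c), t)" by (simp add: x F_def bd cong_sym_eq)
      then show "x \<in> F ` (X \<times> {0..<int p})" using X p_gt_5 by (auto simp: t_def)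
    qed
  qed
  then have "order G = card (X \<times> {0..<int p})" unfolding order_def by (simp add: bij_betw_same_card)
  also have "\<dots> = (p\<^sup>2 - 1) * p"
    unfolding X_def using p_gt_5 by (simp add: card_cartesian_product card_Diff_singleton_if power2_eq_square)
  finally show ?thesis by simp
qed

lemma trace_square_four:
  assumes x: "x \<in> carrier G" "x \<notin> Z" "(tr x)\<^sup>2 \<doteq> 4"
  obtains z u v s where "z \<in> Z" "x = z \<otimes>\<^bsub>G\<^esub> Uni u v s" "\<not> s \<doteq> 0" "\<not> (u \<doteq> 0 \<and> v \<doteq> 0)"
proof -
  obtain a b c d where M: "x = Mat a b c d" "a * d - b * c \<doteq> 1" using x(1) by (rule carrier_Mat)
  have t': "tr x \<doteq> a + d" by (simp add: M)
  have "(tr x - 2) * (tr x + 2) \<doteq> 0" using x(3) unfolding cong_iff_dvd_diff by Groebner_Basis.algebra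
  then have "tr x - 2 \<doteq> 0 \<or> tr x + 2 \<doteq> 0" by (simp only: eqm_mult_0)
  then show thesis
  proof
    assume "tr x - 2 \<doteq> 0"
    then have "tr x \<doteq> 2" by (simp only: cong_diff_iff_cong_0)
    then obtain u v s where U: "x = Uni u v s" "\<not> s \<doteq> 0" "\<not> (u \<doteq> 0 \<and> v \<doteq> 0)"
      by (rule trace_two_Uni[OF x(1,2)])
    show thesis by (rule that[of "\<one>\<^bsub>G\<^esub>" u v s]) (use U in \<open>simp_all add: center_G Mat_one\<close>)
  next
    assume t: "tr x + 2 \<doteq> 0"
    define y where "y = Mat (-a) (-b) (-c) (-d)"
    have det: "(-a) * (-d) - (-b) * (-c) \<doteq> 1" using M by simp
    have yG: "y \<in> carrier G" using det by (simp add: y_def)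
    have "y \<notin> Z"
      using x(2) unfolding M(1) y_def Mat_in_center_iff[OF M(2)] Mat_in_center_iff[OF det]
      by (auto simp: eqm_0_iff dvd_diff_commute)
    moreover have "-a + -d \<doteq> 2" using t t' unfolding cong_iff_dvd_diff by Groebner_Basis.algebra
    then have "tr y \<doteq> 2" by (simp add: y_def)
    ultimately obtain u v s where U: "y = Uni u v s" "\<not> s \<doteq> 0" "\<not> (u \<doteq> 0 \<and> v \<doteq> 0)"
      using trace_two_Uni[OF yG] by blast
    have "x = Mat (-1) 0 0 (-1) \<otimes>\<^bsub>G\<^esub> y" by (simp add: M y_def)
    then show thesis using that[of "Mat (-1) 0 0 (-1)" u v s] U by (simp add: center_G)
  qed
qed

text \<open>
  Conjugating the transvection with axis $w = (u, v)$ by $i$, $j$ and $k$ gives transvections with axes $iw$, $jw$ and $kw$. If all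
  these were parallel to $w$, then $w$ would be a common eigenvector of the quaternions, so $w = 0$.
\<close>

lemma overgroup_of_quaternions:
  assumes H: "subgroup H G" and ab: "a\<^sup>2 + b\<^sup>2 \<doteq> -1"
    and i: "Mat 0 (-1) 1 0 \<in> H" and j: "Mat a b b (-a) \<in> H"
    and x: "x \<in> H" "x \<notin> Z" "(tr x)\<^sup>2 \<doteq> 4"
  shows "H = carrier G"
proof -
  interpret H: subgroup H G by fact
  have xG: "x \<in> carrier G" using x(1) H.subset by blast
  obtain z u v s where U: "z \<in> Z" "x = z \<otimes>\<^bsub>G\<^esub> Uni u v s" "\<not> s \<doteq> 0" "\<not> (u \<doteq> 0 \<and> v \<doteq> 0)"
    by (rule trace_square_four[OF xG x(2,3)])
  have "Mat 0 (-1) 1 0 \<otimes>\<^bsub>G\<^esub> Mat 0 (-1) 1 0 = Mat (-1) 0 0 (-1)" by simp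
  then have "Mat (-1) 0 0 (-1) \<in> H" using i H.m_closed by metis
  then have zH: "z \<in> H" and zG: "z \<in> carrier G" using U(1) H.one_closed H.subset by (auto simp: center_G Mat_one)
  have "inv\<^bsub>G\<^esub> z \<otimes>\<^bsub>G\<^esub> x = Uni u v s" using U(2) zG by (simp flip: G.m_assoc)
  then have UH: "Uni u v s \<in> H" using H.m_closed[OF H.m_inv_closed[OF zH] x(1)] by simp
  have *: "H = carrier G" if "Mat k l m n \<in> H" "k * n - l * m \<doteq> 1" "\<not> u * (m * u + n * v) - (k * u + l * v) * v \<doteq> 0" for k l m n
  proof (rule unipotents_generate[OF H _ _ U(3) U(3) that(3)])
    show "Uni u v s \<in> H" by (fact UH)
    have "Mat k l m n \<otimes>\<^bsub>G\<^esub> Uni u v s \<otimes>\<^bsub>G\<^esub> inv\<^bsub>G\<^esub> Mat k l m n \<in> H"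
      using that(1) UH H.m_closed H.m_inv_closed by blast
    then show "Uni (k * u + l * v) (m * u + n * v) s \<in> H" using Uni_conj[OF that(2)] by simp
  qed
  have k: "Mat (-b) a a b \<in> H" using H.m_closed[OF i j] by simp
  show ?thesis
  proof (rule ccontr)
    assume ne: "H \<noteq> carrier G"
    have 1: "u * (1 * u + 0 * v) - (0 * u + (-1) * v) * v \<doteq> 0" using *[OF i] ne by auto
    have dj: "a * (-a) - b * b \<doteq> 1"
      using ab unfolding cong_iff_dvd_diff by Groebner_Basis.algebra
    have 2: "u * (b * u + (-a) * v) - (a * u + b * v) * v \<doteq> 0" using *[OF j dj] ne by blast
    have dk: "(-b) * b - a * a \<doteq> 1"
      using ab unfolding cong_iff_dvd_diff by Groebner_Basis.algebra
    have 3: "u * (a * u + b * v) - ((-b) * u + a * v) * v \<doteq> 0" using *[OF k dk] ne by blast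
    \<comment> \<open>The second and third equations, combined with weights $b$ and $a$, give $u^2 = v^2$; the first gives $u^2 = -v^2$.\<close>
    have "2 * (u * u) \<doteq> 0" "2 * (v * v) \<doteq> 0"
      using 1 2 3 ab unfolding cong_iff_dvd_diff by (Groebner_Basis.algebra+)
    then show False using U(4) two_not_0 unfolding eqm_mult_0 by blast
  qed
qed

text \<open>
  After conjugation the given element has a nonzero lower left entry and then a vanishing upper left entry. Its commutator with
  $\mathrm{diag}(2, 1/2)$ is lower triangular with diagonal $(4, 1/4)$, and the commutator of that with an elementary matrix is a
  transvection, nontrivial since $3 \cdot 5 \neq 0$. A conjugate of the transvection has a different axis.
\<close>

lemma normal_subgroup_SL2:
  assumes N: "K \<lhd> G" and x: "x \<in> K" "x \<notin> Z"
  shows "K = carrier G"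
proof -
  interpret N: normal K G by fact
  have conj: "g \<otimes>\<^bsub>G\<^esub> h \<otimes>\<^bsub>G\<^esub> inv\<^bsub>G\<^esub> g \<in> K" if "h \<in> K" "g \<in> carrier G" for g h
    using that N.inv_op_closed2 by blast
  have "\<exists>a b c d. Mat a b c d \<in> K \<and> \<not> c \<doteq> 0"
  proof -
    obtain a b c d where M: "x = Mat a b c d" "a * d - b * c \<doteq> 1"
      using x(1) N.subset carrier_Mat by blast
    have nz: "\<not> (b \<doteq> 0 \<and> c \<doteq> 0 \<and> a - d \<doteq> 0)" using x(2) Mat_in_center_iff[OF M(2)] M(1) by blast
    show ?thesis
    proof (cases "c \<doteq> 0")
      case False then show ?thesis using x(1) M by blast
    next
      case c: True
      show ?thesis
      proof (cases "b \<doteq> 0")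
        case False
        have "Mat 0 (-1) 1 0 \<otimes>\<^bsub>G\<^esub> x \<otimes>\<^bsub>G\<^esub> inv\<^bsub>G\<^esub> Mat 0 (-1) 1 0 = Mat d (-c) (-b) a" by (simp add: M)
        then have "Mat d (-c) (-b) a \<in> K" using conj[OF x(1), of "Mat 0 (-1) 1 0"] by simp
        moreover have "\<not> -b \<doteq> 0" using False by (simp add: eqm_0_iff)
        ultimately show ?thesis by blast
      next
        case True
        have "Mat 1 0 1 1 \<otimes>\<^bsub>G\<^esub> x \<otimes>\<^bsub>G\<^esub> inv\<^bsub>G\<^esub> Mat 1 0 1 1 = Mat (a - b) b (a + c + (- b - d)) (b + d)" by (simp add: M)
        then have "Mat (a - b) b (a + c + (- b - d)) (b + d) \<in> K" using conj[OF x(1), of "Mat 1 0 1 1"] by simp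
        moreover have "\<not> a + c + (- b - d) \<doteq> 0"
        proof
          assume "a + c + (- b - d) \<doteq> 0"
          then have "a - d \<doteq> 0" using True c unfolding cong_iff_dvd_diff by Groebner_Basis.algebra
          then show False using nz True c by blast
        qed
        ultimately show ?thesis by blast
      qed
    qed
  qed
  then obtain a b c d where M: "Mat a b c d \<in> K" and c: "\<not> c \<doteq> 0" by blast
  obtain i where i: "c * i \<doteq> 1" using eqm_inverse[OF c] .
  have det: "a * d - b * c \<doteq> 1" using M N.subset Mat_in_carrier by blast
  obtain h where h: "2 * h \<doteq> 1" using eqm_inverse[OF two_not_0] .
  define y where "y = Mat 0 (-i) c (a + d)"
  have "Mat 1 (-a * i) 0 1 \<otimes>\<^bsub>G\<^esub> Mat a b c d \<otimes>\<^bsub>G\<^esub> inv\<^bsub>G\<^esub> Mat 1 (-a * i) 0 1 = y"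
  proof -
    have "a - a * i * c \<doteq> 0" "(a - a * i * c) * (a * i) + (b - a * i * d) \<doteq> -i" "c * (a * i) + d \<doteq> a + d"
      using i det unfolding cong_iff_dvd_diff by (Groebner_Basis.algebra+)
    then show ?thesis by (simp add: y_def)
  qed
  then have y: "y \<in> K" using conj[OF M, of "Mat 1 (-a * i) 0 1"] by simp
  define D where "D = Mat 2 0 0 h"
  have D: "D \<in> carrier G" "inv\<^bsub>G\<^esub> D = Mat h 0 0 2" using h by (simp_all add: D_def)
  have dety: "0 * (a + d) - (-i) * c \<doteq> 1" using i by (simp add: mult.commute)
  define w where "w = h * h * c * (a + d) - (a + d) * c"
  have "D \<otimes>\<^bsub>G\<^esub> y \<otimes>\<^bsub>G\<^esub> inv\<^bsub>G\<^esub> D \<otimes>\<^bsub>G\<^esub> inv\<^bsub>G\<^esub> y = Mat 4 0 w (h * h)"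
  proof -
    have "2 * i * 2 * c \<doteq> 4" "h * c * h * (a + d) - h * (a + d) * 2 * c \<doteq> w" "h * c * h * i \<doteq> h * h"
      using i h unfolding cong_iff_dvd_diff w_def by (Groebner_Basis.algebra+)
    then show ?thesis unfolding D(2) unfolding D_def y_def Mat_inv[OF dety] by (simp add: mult_ac)
  qed
  then have L: "Mat 4 0 w (h * h) \<in> K" using conj[OF y D(1)] y N.m_closed N.m_inv_closed by metis
  have detL: "4 * (h * h) - 0 * w \<doteq> 1" using h unfolding cong_iff_dvd_diff by Groebner_Basis.algebra
  define t where "t = h * h * h * h - 1"
  have invE: "inv\<^bsub>G\<^esub> (Mat 1 0 1 1) = Mat 1 0 (-1) 1" by simp
  have "Mat 4 0 w (h * h) \<otimes>\<^bsub>G\<^esub> (Mat 1 0 1 1 \<otimes>\<^bsub>G\<^esub> inv\<^bsub>G\<^esub> (Mat 4 0 w (h * h)) \<otimes>\<^bsub>G\<^esub> inv\<^bsub>G\<^esub> (Mat 1 0 1 1)) = Mat 1 0 t 1"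
    unfolding Mat_inv[OF detL] unfolding invE Mat_mult Mat_eq_iff t_def
    using h unfolding cong_iff_dvd_diff
    by (intro conjI; (Groebner_Basis.algebra | simp add: algebra_simps))
  moreover have "Mat 1 0 1 1 \<otimes>\<^bsub>G\<^esub> inv\<^bsub>G\<^esub> (Mat 4 0 w (h * h)) \<otimes>\<^bsub>G\<^esub> inv\<^bsub>G\<^esub> (Mat 1 0 1 1) \<in> K"
    using conj[OF N.m_inv_closed[OF L], of "Mat 1 0 1 1"] by simp
  ultimately have "Mat 1 0 t 1 \<in> K" using L N.m_closed by metis
  then have U1: "Uni 0 1 (-t) \<in> K" by (simp add: Uni_def)
  have U2: "Uni (-1) 0 (-t) \<in> K"
    using conj[OF U1, of "Mat 0 (-1) 1 0"] Uni_conj[of 0 0 "-1" 1 0 1 "-t"] by simp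
  have t: "\<not> -t \<doteq> 0"
  proof
    assume "-t \<doteq> 0"
    then have "3 * 5 \<doteq> 0" using h unfolding cong_iff_dvd_diff t_def by Groebner_Basis.algebra
    then show False using three_not_0 five_not_0 eqm_mult_0 by blast
  qed
  show ?thesis
    using unipotents_generate[OF N.subgroup_axioms U1 U2 t t] one_not_0 by simp
qed

text \<open>
  If $x$ has distinct eigenvalues, look for a traceless $g$ of determinant $1$ such that $gx$ is traceless too: then
  $g^2 = (gx)^2 = -1$, so $g$ inverts $x$. The condition on $gx$ is linear and leaves a nondegenerate binary
  quadratic form, which represents every nonzero value. If $x$ is a transvection up to sign, a matrix with
  eigenvalue $2$ on the axis turns it into its fourth power.
\<close>

lemma normalizing_element:
  assumes x: "x \<in> carrier G" "x \<notin> Z"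
  obtains g where "g \<in> carrier G" "g \<otimes>\<^bsub>G\<^esub> x \<noteq> x \<otimes>\<^bsub>G\<^esub> g"
    "x \<otimes>\<^bsub>G\<^esub> (g \<otimes>\<^bsub>G\<^esub> x \<otimes>\<^bsub>G\<^esub> inv\<^bsub>G\<^esub> g) = (g \<otimes>\<^bsub>G\<^esub> x \<otimes>\<^bsub>G\<^esub> inv\<^bsub>G\<^esub> g) \<otimes>\<^bsub>G\<^esub> x"
proof -
  obtain a b c d where M: "x = Mat a b c d" "a * d - b * c \<doteq> 1" using x(1) by (rule carrier_Mat)
  have nz: "\<not> (b \<doteq> 0 \<and> c \<doteq> 0 \<and> a - d \<doteq> 0)" using x(2) Mat_in_center_iff[OF M(2)] M(1) by blast
  note result = that
  define e where "e = a - d"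
  \<comment> \<open>The discriminant of the characteristic polynomial of $x$.\<close>
  define D where "D = e * e + 4 * (b * c)"
  show thesis
  proof (cases "D \<doteq> 0")
    case D: False
    have *: thesis if gdet: "r * r + s * t \<doteq> -1" and orth: "r * e + s * c + t * b \<doteq> 0" for r s t
    proof (rule result)
      have gd: "r * (-r) - s * t \<doteq> 1" using gdet unfolding cong_iff_dvd_diff by Groebner_Basis.algebra
      then show g: "Mat r s t (-r) \<in> carrier G" by simp
      have inv: "Mat r s t (-r) \<otimes>\<^bsub>G\<^esub> x \<otimes>\<^bsub>G\<^esub> inv\<^bsub>G\<^esub> (Mat r s t (-r)) = Mat d (-b) (-c) a"
      proof -
        have "(r * a + s * c) * (-r) + (r * b + s * d) * (-t) \<doteq> d" "(r * a + s * c) * (-s) + (r * b + s * d) * r \<doteq> -b"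
          "(t * a + (-r) * c) * (-r) + (t * b + (-r) * d) * (-t) \<doteq> -c" "(t * a + (-r) * c) * (-s) + (t * b + (-r) * d) * r \<doteq> a"
          using gdet orth unfolding cong_iff_dvd_diff e_def by (Groebner_Basis.algebra+)
        then show ?thesis unfolding Mat_inv[OF gd] M(1) Mat_mult Mat_eq_iff by blast
      qed
      show "x \<otimes>\<^bsub>G\<^esub> (Mat r s t (-r) \<otimes>\<^bsub>G\<^esub> x \<otimes>\<^bsub>G\<^esub> inv\<^bsub>G\<^esub> (Mat r s t (-r))) = (Mat r s t (-r) \<otimes>\<^bsub>G\<^esub> x \<otimes>\<^bsub>G\<^esub> inv\<^bsub>G\<^esub> (Mat r s t (-r))) \<otimes>\<^bsub>G\<^esub> x"
        unfolding inv unfolding M(1) by (simp add: algebra_simps)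
      show "Mat r s t (-r) \<otimes>\<^bsub>G\<^esub> x \<noteq> x \<otimes>\<^bsub>G\<^esub> Mat r s t (-r)"
      proof
        assume "Mat r s t (-r) \<otimes>\<^bsub>G\<^esub> x = x \<otimes>\<^bsub>G\<^esub> Mat r s t (-r)"
        then have "Mat r s t (-r) \<otimes>\<^bsub>G\<^esub> x \<otimes>\<^bsub>G\<^esub> inv\<^bsub>G\<^esub> (Mat r s t (-r)) = x"
          using G.conj_eqI x(1) g by blast
        then have "Mat d (-b) (-c) a = x" unfolding inv .
        then have "d \<doteq> a" "-b \<doteq> b" "-c \<doteq> c" by (simp_all add: M(1))
        then have "D \<doteq> 0" unfolding cong_iff_dvd_diff D_def e_def by Groebner_Basis.algebra
        then show False using D by blast
      qed
    qed
    show thesis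
    proof (cases "c \<doteq> 0")
      case True
      have "\<not> e \<doteq> 0"
      proof
        assume "e \<doteq> 0"
        then have "D \<doteq> 0" using True unfolding D_def cong_iff_dvd_diff by Groebner_Basis.algebra
        then show False using D by contradiction
      qed
      then obtain i where i: "e * i \<doteq> 1" by (rule eqm_inverse)
      show thesis
      proof (rule *)
        show "(- b * i) * (- b * i) + (-1 - b * i * (b * i)) * 1 \<doteq> -1" by (simp add: algebra_simps)
        show "(- b * i) * e + (-1 - b * i * (b * i)) * c + 1 * b \<doteq> 0"
          using i True unfolding cong_iff_dvd_diff by Groebner_Basis.algebra
      qed
    next
      case False
      then obtain i where i: "c * i \<doteq> 1" by (rule eqm_inverse)
      obtain u z where uz: "u\<^sup>2 + 1 \<doteq> D * z\<^sup>2" using squares_pigeonhole[OF D] .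
      then have uz: "u * u + 1 \<doteq> D * (z * z)" by (simp add: power2_eq_square)
      show thesis
      proof (rule *)
        \<comment> \<open>Completing the square in the form on the plane orthogonal to $x$ turns it into $u^2 - D z^2$.\<close>
        show "(u + e * z) * (u + e * z) + (- (i * ((u + e * z) * e)) - 2 * (b * z)) * (2 * (c * z)) \<doteq> -1"
          using i uz unfolding cong_iff_dvd_diff D_def by Groebner_Basis.algebra
        show "(u + e * z) * e + (- (i * ((u + e * z) * e)) - 2 * (b * z)) * c + 2 * (c * z) * b \<doteq> 0"
          using i uz unfolding cong_iff_dvd_diff D_def by Groebner_Basis.algebra
      qed
    qed
  next
    case True
    have "(a + d)\<^sup>2 \<doteq> 4" using True M(2) unfolding D_def e_def cong_iff_dvd_diff by Groebner_Basis.algebra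
    then have "(tr x)\<^sup>2 \<doteq> 4" by (simp add: M cong_def power_mod)
    then obtain z u v s where U: "z \<in> Z" "x = z \<otimes>\<^bsub>G\<^esub> Uni u v s" "\<not> s \<doteq> 0" "\<not> (u \<doteq> 0 \<and> v \<doteq> 0)"
      by (rule trace_square_four[OF x])
    obtain h where h: "2 * h \<doteq> 1" using eqm_inverse[OF two_not_0] .
    obtain m n where mn: "u * n - m * v \<doteq> 1" by (rule row_completion[OF U(4)])
    define g where "g = Mat (2 * (u * n) - h * (m * v)) (h * (m * u) - 2 * (u * m)) (2 * (v * n) - h * (n * v)) (h * (n * u) - 2 * (v * m))"
    have det: "(2 * (u * n) - h * (m * v)) * (h * (n * u) - 2 * (v * m)) - (h * (m * u) - 2 * (u * m)) * (2 * (v * n) - h * (n * v)) \<doteq> 1"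
      using h mn unfolding cong_iff_dvd_diff by Groebner_Basis.algebra
    then have g: "g \<in> carrier G" by (simp add: g_def)
    have zG: "z \<in> carrier G" and zc: "\<And>y. y \<in> carrier G \<Longrightarrow> z \<otimes>\<^bsub>G\<^esub> y = y \<otimes>\<^bsub>G\<^esub> z"
      using U(1) by (auto simp: group_center_def)
    have "(2 * (u * n) - h * (m * v)) * u + (h * (m * u) - 2 * (u * m)) * v \<doteq> 2 * u"
      "(2 * (v * n) - h * (n * v)) * u + (h * (n * u) - 2 * (v * m)) * v \<doteq> 2 * v"
      using h mn unfolding cong_iff_dvd_diff by (Groebner_Basis.algebra+)
    then have "g \<otimes>\<^bsub>G\<^esub> Uni u v s \<otimes>\<^bsub>G\<^esub> inv\<^bsub>G\<^esub> g = Uni (2 * u) (2 * v) s"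
      unfolding g_def Uni_conj[OF det] by (intro Uni_cong) simp_all
    also have "\<dots> = Uni u v (4 * s)" by (simp add: Uni_def mult_ac)
    finally have gU: "g \<otimes>\<^bsub>G\<^esub> Uni u v s \<otimes>\<^bsub>G\<^esub> inv\<^bsub>G\<^esub> g = Uni u v (4 * s)" .
    have "g \<otimes>\<^bsub>G\<^esub> x \<otimes>\<^bsub>G\<^esub> inv\<^bsub>G\<^esub> g = (g \<otimes>\<^bsub>G\<^esub> z) \<otimes>\<^bsub>G\<^esub> Uni u v s \<otimes>\<^bsub>G\<^esub> inv\<^bsub>G\<^esub> g"
      using g zG by (simp add: U(2) G.m_assoc)
    also have "\<dots> = z \<otimes>\<^bsub>G\<^esub> (g \<otimes>\<^bsub>G\<^esub> Uni u v s \<otimes>\<^bsub>G\<^esub> inv\<^bsub>G\<^esub> g)"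
      using g zG zc[OF g, symmetric] by (simp add: G.m_assoc)
    finally have gx: "g \<otimes>\<^bsub>G\<^esub> x \<otimes>\<^bsub>G\<^esub> inv\<^bsub>G\<^esub> g = z \<otimes>\<^bsub>G\<^esub> Uni u v (4 * s)" by (simp add: gU)
    have com: "(z \<otimes>\<^bsub>G\<^esub> Uni u v k) \<otimes>\<^bsub>G\<^esub> (z \<otimes>\<^bsub>G\<^esub> Uni u v l) = z \<otimes>\<^bsub>G\<^esub> z \<otimes>\<^bsub>G\<^esub> Uni u v (k + l)" for k l
    proof -
      have "(z \<otimes>\<^bsub>G\<^esub> Uni u v k) \<otimes>\<^bsub>G\<^esub> (z \<otimes>\<^bsub>G\<^esub> Uni u v l) = z \<otimes>\<^bsub>G\<^esub> (Uni u v k \<otimes>\<^bsub>G\<^esub> z) \<otimes>\<^bsub>G\<^esub> Uni u v l"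
        using zG by (simp add: G.m_assoc)
      also have "\<dots> = z \<otimes>\<^bsub>G\<^esub> z \<otimes>\<^bsub>G\<^esub> (Uni u v k \<otimes>\<^bsub>G\<^esub> Uni u v l)"
        using zG zc[of "Uni u v k", symmetric] by (simp add: G.m_assoc)
      finally show ?thesis by (simp add: Uni_add)
    qed
    show thesis
    proof (rule that[OF g])
      show "x \<otimes>\<^bsub>G\<^esub> (g \<otimes>\<^bsub>G\<^esub> x \<otimes>\<^bsub>G\<^esub> inv\<^bsub>G\<^esub> g) = (g \<otimes>\<^bsub>G\<^esub> x \<otimes>\<^bsub>G\<^esub> inv\<^bsub>G\<^esub> g) \<otimes>\<^bsub>G\<^esub> x"
        unfolding gx unfolding U(2) com by (simp add: add.commute)
      show "g \<otimes>\<^bsub>G\<^esub> x \<noteq> x \<otimes>\<^bsub>G\<^esub> g"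
      proof
        assume "g \<otimes>\<^bsub>G\<^esub> x = x \<otimes>\<^bsub>G\<^esub> g"
        then have "g \<otimes>\<^bsub>G\<^esub> x \<otimes>\<^bsub>G\<^esub> inv\<^bsub>G\<^esub> g = x" using G.conj_eqI x(1) g by blast
        then have "z \<otimes>\<^bsub>G\<^esub> Uni u v (4 * s) = z \<otimes>\<^bsub>G\<^esub> Uni u v s" using gx U(2) by metis
        then have "Uni u v (4 * s) = Uni u v s" using zG by (simp add: G.left_cancel)
        then have "4 * s * (u * u) \<doteq> s * (u * u)" "- (4 * s * (v * v)) \<doteq> - (s * (v * v))"
          by (simp_all add: Uni_def)
        then have "3 * (s * (u * u)) \<doteq> 0" "3 * (s * (v * v)) \<doteq> 0"
          unfolding cong_iff_dvd_diff by (Groebner_Basis.algebra+)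
        then show False using U(3,4) three_not_0 unfolding eqm_mult_0 by blast
      qed
    qed
  qed
qed

end

section \<open>The binary tetrahedral subgroup\<close>

context SL2_prime begin

lemma Z_subset_carrier: "Z \<subseteq> carrier G"
  by (auto simp: group_center_def)

lemma minus_one_noteq: "Mat 1 0 0 1 \<noteq> Mat (-1) 0 0 (-1)"
proof
  assume "Mat 1 0 0 1 = Mat (-1) 0 0 (-1)"
  then have "2 \<doteq> 0" by (simp add: cong_iff_dvd_diff)
  then show False using two_not_0 by contradiction
qed

lemma card_Z: "card Z = 2"
  using minus_one_noteq by (simp add: center_G)

lemma Z_subgroup: "subgroup Z G"
proof (rule G.subgroupI)
  show "Z \<subseteq> carrier G" by (rule Z_subset_carrier)
qed (auto simp: center_G)

lemma center_central: "z \<in> Z \<Longrightarrow> x \<in> carrier G \<Longrightarrow> z \<otimes>\<^bsub>G\<^esub> x = x \<otimes>\<^bsub>G\<^esub> z"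
  by (simp add: group_center_def)

lemma ct_group_subgroup:
  assumes H: "subgroup H G" "Z \<subseteq> H" and ss: "\<And>x. x \<in> H - Z \<Longrightarrow> \<not> (tr x)\<^sup>2 \<doteq> 4"
  shows "ct_group (G\<lparr>carrier := H\<rparr>) Z"
proof -
  interpret H: subgroup H G by fact
  have inv: "inv\<^bsub>G\<lparr>carrier := H\<rparr>\<^esub> x = inv\<^bsub>G\<^esub> x" if "x \<in> H" for x
    using G.m_inv_consistent[OF H(1) that] .
  show ?thesis
  proof (intro ct_group.intro ct_group_axioms.intro)
    show "group (G\<lparr>carrier := H\<rparr>)" using H(1) G.subgroup_imp_group by blast
    show "finite (carrier (G\<lparr>carrier := H\<rparr>))" using H.subset finite_G finite_subset by auto
    show "subgroup Z (G\<lparr>carrier := H\<rparr>)" using G.subgroup_incl[OF Z_subgroup H] .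
    show "card Z = 2" by (rule card_Z)
  next
    fix z x assume "z \<in> Z" "x \<in> carrier (G\<lparr>carrier := H\<rparr>)"
    then show "z \<otimes>\<^bsub>G\<lparr>carrier := H\<rparr>\<^esub> x = x \<otimes>\<^bsub>G\<lparr>carrier := H\<rparr>\<^esub> z"
      using center_central by simp
  next
    fix x y w
    assume "x \<in> carrier (G\<lparr>carrier := H\<rparr>)" "y \<in> carrier (G\<lparr>carrier := H\<rparr>) - Z" "w \<in> carrier (G\<lparr>carrier := H\<rparr>)"
      "x \<otimes>\<^bsub>G\<lparr>carrier := H\<rparr>\<^esub> y = y \<otimes>\<^bsub>G\<lparr>carrier := H\<rparr>\<^esub> x" "y \<otimes>\<^bsub>G\<lparr>carrier := H\<rparr>\<^esub> w = w \<otimes>\<^bsub>G\<lparr>carrier := H\<rparr>\<^esub> y"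
    then show "x \<otimes>\<^bsub>G\<lparr>carrier := H\<rparr>\<^esub> w = w \<otimes>\<^bsub>G\<lparr>carrier := H\<rparr>\<^esub> x"
      using commute_trans[of x y w] by simp
  next
    fix x n
    assume a: "x \<in> carrier (G\<lparr>carrier := H\<rparr>) - Z" "n \<in> carrier (G\<lparr>carrier := H\<rparr>)"
     and c: "x \<otimes>\<^bsub>G\<lparr>carrier := H\<rparr>\<^esub> (n \<otimes>\<^bsub>G\<lparr>carrier := H\<rparr>\<^esub> x \<otimes>\<^bsub>G\<lparr>carrier := H\<rparr>\<^esub> inv\<^bsub>G\<lparr>carrier := H\<rparr>\<^esub> n)
        = n \<otimes>\<^bsub>G\<lparr>carrier := H\<rparr>\<^esub> x \<otimes>\<^bsub>G\<lparr>carrier := H\<rparr>\<^esub> inv\<^bsub>G\<lparr>carrier := H\<rparr>\<^esub> n \<otimes>\<^bsub>G\<lparr>carrier := H\<rparr>\<^esub> x"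
    have xG: "x \<in> carrier G" "n \<in> carrier G" using a H.subset by auto
    have nx: "n \<otimes>\<^bsub>G\<^esub> x \<otimes>\<^bsub>G\<^esub> inv\<^bsub>G\<^esub> n \<in> carrier G" using xG by simp
    have "n \<otimes>\<^bsub>G\<^esub> x \<otimes>\<^bsub>G\<^esub> inv\<^bsub>G\<^esub> n = x \<or> n \<otimes>\<^bsub>G\<^esub> x \<otimes>\<^bsub>G\<^esub> inv\<^bsub>G\<^esub> n = inv\<^bsub>G\<^esub> x"
      using a c ss[of x] by (intro same_trace_commuting[OF xG(1) nx _ tr_conj[OF xG]]) (simp_all add: inv)
    then show "n \<otimes>\<^bsub>G\<lparr>carrier := H\<rparr>\<^esub> x \<otimes>\<^bsub>G\<lparr>carrier := H\<rparr>\<^esub> inv\<^bsub>G\<lparr>carrier := H\<rparr>\<^esub> n = x \<or>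
        n \<otimes>\<^bsub>G\<lparr>carrier := H\<rparr>\<^esub> x \<otimes>\<^bsub>G\<lparr>carrier := H\<rparr>\<^esub> inv\<^bsub>G\<lparr>carrier := H\<rparr>\<^esub> n = inv\<^bsub>G\<lparr>carrier := H\<rparr>\<^esub> x"
      using a by (simp add: inv)
  qed
qed

end

text \<open>
  The numbers $a$ and $b$ provide matrices that satisfy the relations of the quaternions $i$ and $j$, and $h$ is one half.
\<close>

locale SL2_quaternions = SL2_prime +
  fixes a b h :: int
  assumes ab: "a\<^sup>2 + b\<^sup>2 \<doteq> -1" and h: "2 * h \<doteq> 1"
    and p_mod_8: "p mod 8 = 3 \<or> p mod 8 = 5" and p_mod_5: "p mod 5 = 2 \<or> p mod 5 = 3"
begin

definition qi where "qi = Mat 0 (-1) 1 0"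
definition qj where "qj = Mat a b b (-a)"
definition qk where "qk = Mat (-b) a a b"
text \<open>
  The quaternion $-(1 + i + j + k)/2$, of order $3$; conjugation by it permutes $i$, $j$, $k$ cyclically.
\<close>

definition qr where "qr = Mat (- (h * (1 + a - b))) (- (h * (a + b - 1))) (- (h * (1 + a + b))) (- (h * (1 - a + b)))"
definition minus_one where "minus_one = Mat (-1) 0 0 (-1)"

lemma ab': "a * a + b * b \<doteq> -1" using ab by (simp add: power2_eq_square)

lemma det_j: "a * (-a) - b * b \<doteq> 1" and det_k: "(-b) * b - a * a \<doteq> 1"
  using ab' unfolding cong_iff_dvd_diff by (Groebner_Basis.algebra+)

lemma det_r: "(- (h * (1 + a - b))) * (- (h * (1 - a + b))) - (- (h * (a + b - 1))) * (- (h * (1 + a + b))) \<doteq> 1"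
  using ab' h unfolding cong_iff_dvd_diff by Groebner_Basis.algebra

lemma q_carrier [simp]: "qi \<in> carrier G" "qj \<in> carrier G" "qk \<in> carrier G" "qr \<in> carrier G" "minus_one \<in> carrier G"
  using det_j det_k det_r unfolding qi_def qj_def qk_def qr_def minus_one_def Mat_in_carrier by simp_all

lemma q_relations:
  "qi \<otimes>\<^bsub>G\<^esub> qi = minus_one" "qi \<otimes>\<^bsub>G\<^esub> qj = qk" "qj \<otimes>\<^bsub>G\<^esub> qi = minus_one \<otimes>\<^bsub>G\<^esub> qk"
  "qr \<otimes>\<^bsub>G\<^esub> qi = qj \<otimes>\<^bsub>G\<^esub> qr" "qr \<otimes>\<^bsub>G\<^esub> qj = qk \<otimes>\<^bsub>G\<^esub> qr" "qr \<otimes>\<^bsub>G\<^esub> qk = qi \<otimes>\<^bsub>G\<^esub> qr"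
  "qr \<otimes>\<^bsub>G\<^esub> qr \<otimes>\<^bsub>G\<^esub> qr = \<one>\<^bsub>G\<^esub>"
  unfolding qi_def qj_def qk_def qr_def minus_one_def Mat_one Mat_mult Mat_eq_iff
  using ab' h unfolding cong_iff_dvd_diff
  by (intro conjI; (Groebner_Basis.algebra | simp add: algebra_simps))+

lemma not_commute_ij: "qi \<otimes>\<^bsub>G\<^esub> qj \<noteq> qj \<otimes>\<^bsub>G\<^esub> qi"
proof
  assume "qi \<otimes>\<^bsub>G\<^esub> qj = qj \<otimes>\<^bsub>G\<^esub> qi"
  then have "2 * (a * a + b * b) \<doteq> 0"
    unfolding qi_def qj_def Mat_mult Mat_eq_iff cong_iff_dvd_diff by Groebner_Basis.algebra
  then have "2 \<doteq> 0" using ab' unfolding cong_iff_dvd_diff by Groebner_Basis.algebra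
  then show False using two_not_0 by contradiction
qed

lemma not_commute_r: "qr \<otimes>\<^bsub>G\<^esub> (qi \<otimes>\<^bsub>G\<^esub> qr \<otimes>\<^bsub>G\<^esub> inv\<^bsub>G\<^esub> qi) \<noteq> (qi \<otimes>\<^bsub>G\<^esub> qr \<otimes>\<^bsub>G\<^esub> inv\<^bsub>G\<^esub> qi) \<otimes>\<^bsub>G\<^esub> qr"
proof
  have iri: "qi \<otimes>\<^bsub>G\<^esub> qr \<otimes>\<^bsub>G\<^esub> inv\<^bsub>G\<^esub> qi =
    Mat (- (h * (1 - a + b))) (h * (1 + a + b)) (h * (a + b - 1)) (- (h * (1 + a - b)))"
    unfolding qi_def qr_def by (simp add: algebra_simps)
  assume "qr \<otimes>\<^bsub>G\<^esub> (qi \<otimes>\<^bsub>G\<^esub> qr \<otimes>\<^bsub>G\<^esub> inv\<^bsub>G\<^esub> qi) = (qi \<otimes>\<^bsub>G\<^esub> qr \<otimes>\<^bsub>G\<^esub> inv\<^bsub>G\<^esub> qi) \<otimes>\<^bsub>G\<^esub> qr"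
  then have c: "(- (h * (1 + a - b)) - - (h * (1 - a + b))) * (h * (1 + a + b)) \<doteq> - (h * (a + b - 1)) * (- (h * (1 - a + b)) - - (h * (1 + a - b)))"
    "- (h * (a + b - 1)) * (h * (a + b - 1)) \<doteq> - (h * (1 + a + b)) * (h * (1 + a + b))"
    unfolding iri unfolding qr_def Mat_commute_iff by blast+
  have "a - b \<doteq> 0" "a + b \<doteq> 0"
    using c h unfolding cong_iff_dvd_diff by (Groebner_Basis.algebra+)
  then have "2 \<doteq> 0" using ab' unfolding cong_iff_dvd_diff by Groebner_Basis.algebra
  then show False using two_not_0 by contradiction
qed

lemma not_commute_imp_not_center:
  assumes "x \<in> carrier G" "y \<in> carrier G" "x \<otimes>\<^bsub>G\<^esub> y \<noteq> y \<otimes>\<^bsub>G\<^esub> x"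
  shows "x \<notin> Z" "y \<notin> Z"
  using assms unfolding group_center_def by fastforce+

text \<open>
  This is where the two congruences on $p$ enter: $p^2 - 1$ is $8$ modulo $16$ and $3$ modulo $5$.
\<close>

lemma order_G_mod: "\<not> 16 dvd order G" "\<not> 5 dvd order G"
proof -
  have eq: "int (order G) = int p * ((int p)\<^sup>2 - 1)" using p_gt_5 by (simp add: order_G of_nat_diff)
  have red: "[int (order G) = (int p mod m) * ((int p mod m)\<^sup>2 - 1)] (mod m)" for m
    unfolding eq by (intro cong_mult cong_diff cong_pow) simp_all
  have "int p mod 16 = 3 \<or> int p mod 16 = 5 \<or> int p mod 16 = 11 \<or> int p mod 16 = 13" using p_mod_8 by presburger
  then have "int (order G) mod 16 = 8" using red[of 16] by (auto simp: cong_def)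
  then show "\<not> 16 dvd order G" by presburger
  have "int p mod 5 = 2 \<or> int p mod 5 = 3" using p_mod_5 by presburger
  then have "int (order G) mod 5 \<noteq> 0" using red[of 5] by (auto simp: cong_def)
  then show "\<not> 5 dvd order G" by presburger
qed

lemma minus_one_square: "minus_one \<otimes>\<^bsub>G\<^esub> minus_one = \<one>\<^bsub>G\<^esub>" by (simp add: minus_one_def Mat_one)

lemma Z_eq: "Z = {\<one>\<^bsub>G\<^esub>, minus_one}" by (simp add: center_G minus_one_def Mat_one)

text \<open>
  The class equation applies. Conjugation by $j$ inverts $i$ without fixing it. A centralizer of
  index $2$ would contain all squares, in particular the two elements $r$ and $iri^{-1}$ of order $3$, which do not commute.
\<close>

lemma card_overgroup:
  assumes H: "subgroup H G" and q: "qi \<in> H" "qr \<in> H"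
    and ss: "\<And>x. x \<in> H - Z \<Longrightarrow> \<not> (tr x)\<^sup>2 \<doteq> 4"
  shows "card H = 24"
proof -
  interpret H: subgroup H G by fact
  let ?H = "G\<lparr>carrier := H\<rparr>"
  have "minus_one \<in> H" using H.m_closed[OF q(1) q(1)] q_relations by simp
  then have ZH: "Z \<subseteq> H" by (simp add: Z_eq)
  interpret ct: ct_group ?H Z by (rule ct_group_subgroup[OF H ZH ss])
  have inv: "inv\<^bsub>?H\<^esub> x = inv\<^bsub>G\<^esub> x" if "x \<in> H" for x
    using G.m_inv_consistent[OF H that] .
  have ord: "order ?H = card H" by (simp add: order_def)
  have j: "qj = qr \<otimes>\<^bsub>G\<^esub> qi \<otimes>\<^bsub>G\<^esub> inv\<^bsub>G\<^esub> qr" using q_relations(4) by (simp add: G.m_assoc)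
  then have qj: "qj \<in> H" using q H.m_closed H.m_inv_closed by simp
  have iZ: "qi \<notin> Z" using not_commute_imp_not_center[OF _ _ not_commute_ij] by simp
  have "order ?H = 24"
  proof (rule ct.order_24)
    show "qi \<in> carrier ?H - Z" using q iZ by simp
    have "qj \<otimes>\<^bsub>G\<^esub> qi = (minus_one \<otimes>\<^bsub>G\<^esub> qi) \<otimes>\<^bsub>G\<^esub> qj" using q_relations(2,3) by (simp add: G.m_assoc)
    then have "qj \<otimes>\<^bsub>G\<^esub> qi \<otimes>\<^bsub>G\<^esub> inv\<^bsub>G\<^esub> qj = minus_one \<otimes>\<^bsub>G\<^esub> qi" by (intro G.conj_eqI) simp_all
    moreover have "qi \<otimes>\<^bsub>G\<^esub> (minus_one \<otimes>\<^bsub>G\<^esub> qi) = minus_one \<otimes>\<^bsub>G\<^esub> qi \<otimes>\<^bsub>G\<^esub> qi"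
      using center_central[of minus_one "qi"] by (simp add: Z_eq G.m_assoc)
    ultimately show "qj \<in> ct.torus_normalizer qi"
      using qj q \<open>minus_one \<in> H\<close> by (simp add: ct.torus_normalizer_def centralizer_def inv)
    show "qj \<notin> centralizer ?H qi" using not_commute_ij by (simp add: centralizer_def)
    show "\<not> 16 dvd order ?H" "\<not> 5 dvd order ?H"
      using G.lagrange[OF H] order_G_mod unfolding ord by (metis dvd_mult)+
    fix y assume y: "y \<in> carrier ?H - Z"
    have yG: "y \<in> carrier G" "y \<notin> Z" using y H.subset by auto
    show "order ?H \<noteq> 2 * card (centralizer ?H y)"
    proof
      assume "order ?H = 2 * card (centralizer ?H y)"
      then have sq: "x \<otimes>\<^bsub>G\<^esub> x \<in> centralizer ?H y" if "x \<in> H" for x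
        using ct.card_index_two_square[OF ct.finite_H ct.centralizer_subgroup] y that by simp
      define s where "s = qi \<otimes>\<^bsub>G\<^esub> qr \<otimes>\<^bsub>G\<^esub> inv\<^bsub>G\<^esub> qi"
      have s: "s \<in> H" using q by (simp add: s_def)
      have s3: "s \<otimes>\<^bsub>G\<^esub> s \<otimes>\<^bsub>G\<^esub> s = \<one>\<^bsub>G\<^esub>"
        unfolding s_def by (rule G.conj_cube) (simp_all add: q_relations(7))
      have cube: "x \<in> centralizer ?H y" if "x \<in> H" "x \<otimes>\<^bsub>G\<^esub> x \<otimes>\<^bsub>G\<^esub> x = \<one>\<^bsub>G\<^esub>" for x
      proof -
        have "(x \<otimes>\<^bsub>G\<^esub> x) \<otimes>\<^bsub>G\<^esub> (x \<otimes>\<^bsub>G\<^esub> x) \<in> centralizer ?H y"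
          using sq[OF H.m_closed[OF that(1) that(1)]] .
        moreover have "(x \<otimes>\<^bsub>G\<^esub> x) \<otimes>\<^bsub>G\<^esub> (x \<otimes>\<^bsub>G\<^esub> x) = x"
          using G.square_square_of_cube[OF _ that(2)] that(1) H.subset by blast
        ultimately show ?thesis by simp
      qed
      have "qr \<in> centralizer ?H y" "s \<in> centralizer ?H y" using cube q_relations(7) s3 s q by blast+
      then have "qr \<otimes>\<^bsub>G\<^esub> s = s \<otimes>\<^bsub>G\<^esub> qr"
        using commute_trans[of qr y s] yG s H.subset by (auto simp: centralizer_def)
      then show False using not_commute_r by (simp add: s_def)
    qed
  qed
  then show ?thesis by (simp add: ord)
qed

end

context SL2_quaternions begin

definition imag_units where "imag_units = {qi, qj, qk, minus_one \<otimes>\<^bsub>G\<^esub> qi, minus_one \<otimes>\<^bsub>G\<^esub> qj, minus_one \<otimes>\<^bsub>G\<^esub> qk}"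

text \<open>
  The binary tetrahedral group, realized as the normalizer of the quaternion group. In this form it is evidently a subgroup, and its order follows from
  \<open>card_overgroup\<close> rather than from an enumeration.
\<close>

definition bin_tet where "bin_tet = {x \<in> carrier G. \<forall>q\<in>imag_units. x \<otimes>\<^bsub>G\<^esub> q \<otimes>\<^bsub>G\<^esub> inv\<^bsub>G\<^esub> x \<in> imag_units}"

lemma S_sub: "imag_units \<subseteq> carrier G" by (auto simp: imag_units_def)

lemma B_subgroup: "subgroup bin_tet G"
  unfolding bin_tet_def using S_sub by (intro G.set_normalizer_subgroup) (auto simp: imag_units_def)

lemma B_I:
  assumes x: "x \<in> carrier G" and q: "\<And>q. q \<in> {qi, qj, qk} \<Longrightarrow> \<exists>w\<in>imag_units. x \<otimes>\<^bsub>G\<^esub> q = w \<otimes>\<^bsub>G\<^esub> x"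
  shows "x \<in> bin_tet"
proof -
  have m1c: "minus_one \<otimes>\<^bsub>G\<^esub> y = y \<otimes>\<^bsub>G\<^esub> minus_one" if "y \<in> carrier G" for y
    using center_central[of minus_one y] that by (simp add: Z_eq)
  have mm: "minus_one \<otimes>\<^bsub>G\<^esub> (minus_one \<otimes>\<^bsub>G\<^esub> y) = y" if "y \<in> carrier G" for y
    using that minus_one_square by (metis G.l_one G.m_assoc q_carrier(5))
  have mS: "minus_one \<otimes>\<^bsub>G\<^esub> w \<in> imag_units" if "w \<in> imag_units" for w
    using that mm[of qi] mm[of qj] mm[of qk] unfolding imag_units_def by (elim insertE) simp_all
  have 1: "x \<otimes>\<^bsub>G\<^esub> q \<otimes>\<^bsub>G\<^esub> inv\<^bsub>G\<^esub> x \<in> imag_units" if "q \<in> {qi, qj, qk}" for q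
  proof -
    from q[OF that] obtain w where "w \<in> imag_units" "x \<otimes>\<^bsub>G\<^esub> q = w \<otimes>\<^bsub>G\<^esub> x" by blast
    then show ?thesis using G.conj_eqI[OF x, of w q] S_sub by auto
  qed
  have 2: "x \<otimes>\<^bsub>G\<^esub> (minus_one \<otimes>\<^bsub>G\<^esub> q) \<otimes>\<^bsub>G\<^esub> inv\<^bsub>G\<^esub> x \<in> imag_units" if "q \<in> {qi, qj, qk}" for q
  proof -
    have qG: "q \<in> carrier G" using that by auto
    have "x \<otimes>\<^bsub>G\<^esub> (minus_one \<otimes>\<^bsub>G\<^esub> q) \<otimes>\<^bsub>G\<^esub> inv\<^bsub>G\<^esub> x = (x \<otimes>\<^bsub>G\<^esub> minus_one) \<otimes>\<^bsub>G\<^esub> q \<otimes>\<^bsub>G\<^esub> inv\<^bsub>G\<^esub> x"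
      using x qG by (simp add: G.m_assoc)
    also have "\<dots> = minus_one \<otimes>\<^bsub>G\<^esub> (x \<otimes>\<^bsub>G\<^esub> q \<otimes>\<^bsub>G\<^esub> inv\<^bsub>G\<^esub> x)"
      using x qG by (simp add: G.m_assoc flip: m1c[OF x])
    finally show ?thesis using mS[OF 1[OF that]] by simp
  qed
  show ?thesis unfolding bin_tet_def using x 1 2 by (auto simp: imag_units_def)
qed

lemma qi_B: "qi \<in> bin_tet"
proof (rule B_I)
  have "qi \<otimes>\<^bsub>G\<^esub> qj = (minus_one \<otimes>\<^bsub>G\<^esub> qj) \<otimes>\<^bsub>G\<^esub> qi" "qi \<otimes>\<^bsub>G\<^esub> qk = (minus_one \<otimes>\<^bsub>G\<^esub> qk) \<otimes>\<^bsub>G\<^esub> qi"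
    unfolding qi_def qj_def qk_def minus_one_def by simp_all
  then show "\<exists>w\<in>imag_units. qi \<otimes>\<^bsub>G\<^esub> q = w \<otimes>\<^bsub>G\<^esub> qi" if "q \<in> {qi, qj, qk}" for q
    using that unfolding imag_units_def by blast
qed simp

lemma qr_B: "qr \<in> bin_tet"
  by (rule B_I) (use q_relations in \<open>auto simp: imag_units_def\<close>)

lemma qj_B: "qj \<in> bin_tet"
proof -
  have "qj = qr \<otimes>\<^bsub>G\<^esub> qi \<otimes>\<^bsub>G\<^esub> inv\<^bsub>G\<^esub> qr" using q_relations(4) by (simp add: G.m_assoc)
  then show ?thesis using qi_B qr_B B_subgroup by (metis subgroup.m_closed subgroup.m_inv_closed)
qed

lemma center_subset_of_qi:
  assumes "subgroup K G" "qi \<in> K" shows "Z \<subseteq> K"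
  using assms q_relations(1) subgroup.m_closed[OF assms(1), of qi qi] subgroup.one_closed[OF assms(1)]
  by (auto simp: Z_eq)

lemma Uni_not_center:
  assumes "\<not> s \<doteq> 0" "\<not> (u \<doteq> 0 \<and> v \<doteq> 0)" shows "Uni u v s \<notin> Z"
proof
  have det: "(1 - s * (u * v)) * (1 + s * (u * v)) - s * (u * u) * - (s * (v * v)) \<doteq> 1" by (simp add: algebra_simps)
  assume "Uni u v s \<in> Z"
  then have "s * (u * u) \<doteq> 0" "- (s * (v * v)) \<doteq> 0" unfolding Uni_def Mat_in_center_iff[OF det] by blast+
  then have "s * (u * u) \<doteq> 0" "s * (v * v) \<doteq> 0" by (simp_all add: eqm_0_iff)
  then show False using assms unfolding eqm_mult_0 by blast
qed

text \<open>
  A transvection in the normalizer has order $p > 6$, but it permutes the six imaginary units. So nontrivial powers of it commute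
  with $i$ and with $j$, and then $i$ and $j$ would commute.
\<close>

lemma B_semisimple:
  assumes "x \<in> bin_tet - Z" shows "\<not> (tr x)\<^sup>2 \<doteq> 4"
proof
  interpret B: subgroup bin_tet G by (rule B_subgroup)
  assume "(tr x)\<^sup>2 \<doteq> 4"
  then obtain z u v s where U: "z \<in> Z" "x = z \<otimes>\<^bsub>G\<^esub> Uni u v s" "\<not> s \<doteq> 0" "\<not> (u \<doteq> 0 \<and> v \<doteq> 0)"
    using trace_square_four[of x] assms B.subset by blast
  have zB: "z \<in> bin_tet" using U(1) center_subset_of_qi[OF B_subgroup qi_B] by blast
  have "inv\<^bsub>G\<^esub> z \<otimes>\<^bsub>G\<^esub> x = Uni u v s" using U(2) zB B.subset by (simp add: subsetD flip: G.m_assoc)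
  then have UB: "Uni u v s \<in> bin_tet" using assms zB B.m_closed B.m_inv_closed by fastforce
  have p7: "p > 6" using p_gt_5 p_mod_8 by (cases "p = 6") auto
  have *: "\<exists>t. \<not> t \<doteq> 0 \<and> Uni u v t \<otimes>\<^bsub>G\<^esub> q = q \<otimes>\<^bsub>G\<^esub> Uni u v t" if q: "q \<in> imag_units" for q
  proof -
    have qG: "q \<in> carrier G" using q S_sub by blast
    define f where "f = (\<lambda>n::nat. Uni u v (int n * s) \<otimes>\<^bsub>G\<^esub> q \<otimes>\<^bsub>G\<^esub> inv\<^bsub>G\<^esub> (Uni u v (int n * s)))"
    have UnB: "Uni u v (int n * s) \<in> bin_tet" for n using G.subgroup_nat_pow[OF B_subgroup UB, of n] by (simp add: Uni_pow)
    have "f n \<in> imag_units" for n using UnB[of n] q unfolding f_def bin_tet_def by blast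
    then have "f ` {..6} \<subseteq> imag_units" by blast
    then have "card (f ` {..6}) \<le> card imag_units" by (intro card_mono) (auto simp: imag_units_def)
    also have "card imag_units \<le> 6" unfolding imag_units_def by (simp add: card_insert_if)
    finally have "\<not> inj_on f {..6}" using card_image[of f "{..6}"] by auto
    then obtain n m where nm: "n < m" "m \<le> 6" "f n = f m"
      unfolding inj_on_def by (metis atMost_iff linorder_neqE_nat)
    define t where "t = (int m - int n) * s"
    have "\<not> int m - int n \<doteq> 0" using nm p7 by (intro small_not_eqm_0) auto
    then have t: "\<not> t \<doteq> 0" using U(3) unfolding t_def eqm_mult_0 by blast
    have inv: "inv\<^bsub>G\<^esub> (Uni u v k) = Uni u v (-k)" for k
      by (rule G.inv_equality) (simp_all add: Uni_add Uni_0)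
    have "Uni u v (- (int n * s)) \<otimes>\<^bsub>G\<^esub> f n \<otimes>\<^bsub>G\<^esub> Uni u v (int m * s) = q \<otimes>\<^bsub>G\<^esub> Uni u v t"
    proof -
      have "Uni u v (- (int n * s)) \<otimes>\<^bsub>G\<^esub> f n \<otimes>\<^bsub>G\<^esub> Uni u v (int m * s)
        = (Uni u v (- (int n * s)) \<otimes>\<^bsub>G\<^esub> Uni u v (int n * s)) \<otimes>\<^bsub>G\<^esub> q \<otimes>\<^bsub>G\<^esub> (Uni u v (- (int n * s)) \<otimes>\<^bsub>G\<^esub> Uni u v (int m * s))"
        unfolding f_def inv using qG by (simp add: G.m_assoc)
      then show ?thesis using qG by (simp add: Uni_add Uni_0 t_def algebra_simps)
    qed
    moreover have "Uni u v (- (int n * s)) \<otimes>\<^bsub>G\<^esub> f m \<otimes>\<^bsub>G\<^esub> Uni u v (int m * s) = Uni u v t \<otimes>\<^bsub>G\<^esub> q"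
    proof -
      have "Uni u v (- (int n * s)) \<otimes>\<^bsub>G\<^esub> f m \<otimes>\<^bsub>G\<^esub> Uni u v (int m * s)
        = (Uni u v (- (int n * s)) \<otimes>\<^bsub>G\<^esub> Uni u v (int m * s)) \<otimes>\<^bsub>G\<^esub> q \<otimes>\<^bsub>G\<^esub> (Uni u v (- (int m * s)) \<otimes>\<^bsub>G\<^esub> Uni u v (int m * s))"
        unfolding f_def inv using qG by (simp add: G.m_assoc)
      then show ?thesis using qG by (simp add: Uni_add Uni_0 t_def algebra_simps)
    qed
    ultimately show ?thesis using t nm(3) by metis
  qed
  obtain t where t: "\<not> t \<doteq> 0" "Uni u v t \<otimes>\<^bsub>G\<^esub> qi = qi \<otimes>\<^bsub>G\<^esub> Uni u v t" using *[of qi] by (auto simp: imag_units_def)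
  obtain t' where t': "\<not> t' \<doteq> 0" "Uni u v t' \<otimes>\<^bsub>G\<^esub> qj = qj \<otimes>\<^bsub>G\<^esub> Uni u v t'" using *[of qj] by (auto simp: imag_units_def)
  have c: "Uni u v t \<otimes>\<^bsub>G\<^esub> Uni u v t' = Uni u v t' \<otimes>\<^bsub>G\<^esub> Uni u v t" by (simp add: Uni_add add.commute)
  have "qi \<otimes>\<^bsub>G\<^esub> Uni u v t' = Uni u v t' \<otimes>\<^bsub>G\<^esub> qi"
    by (rule commute_trans[of _ "Uni u v t"]) (use t c Uni_not_center[OF t(1) U(4)] in simp_all)
  then have "qi \<otimes>\<^bsub>G\<^esub> qj = qj \<otimes>\<^bsub>G\<^esub> qi"
    by (rule commute_trans[of _ "Uni u v t'", rotated 4]) (use t' Uni_not_center[OF t'(1) U(4)] in simp_all)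
  then show False using not_commute_ij by contradiction
qed

lemma card_B: "card bin_tet = 24"
  using card_overgroup[OF B_subgroup qi_B qr_B B_semisimple] .

lemma B_maximal:
  assumes K: "subgroup K G" "bin_tet \<subseteq> K" shows "K = bin_tet \<or> K = carrier G"
proof (cases "\<exists>x\<in>K - Z. (tr x)\<^sup>2 \<doteq> 4")
  case True
  then obtain x where x: "x \<in> K" "x \<notin> Z" "(tr x)\<^sup>2 \<doteq> 4" by blast
  have "Mat 0 (-1) 1 0 \<in> K" "Mat a b b (-a) \<in> K"
    using K(2) qi_B qj_B unfolding qi_def qj_def by blast+
  then show ?thesis using overgroup_of_quaternions[OF K(1) ab _ _ x] by blast
next
  case False
  then have "card K = 24" using card_overgroup[OF K(1)] K(2) qi_B qr_B by blast
  moreover have "finite K" using K(1) finite_G finite_subset subgroup.subset by blast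
  ultimately show ?thesis using card_subset_eq[OF _ K(2)] card_B by metis
qed

lemma B_proper: "bin_tet \<noteq> carrier G"
proof
  assume "bin_tet = carrier G"
  moreover have "Uni 1 0 1 \<notin> Z" using Uni_not_center one_not_0 by blast
  moreover have "(tr (Uni 1 0 1))\<^sup>2 \<doteq> 4" by (simp add: Uni_def cong_def power_mod)
  ultimately show False using B_semisimple[of "Uni 1 0 1"] by simp
qed

text \<open>
  The centralizer of $r$, cyclic of order $6$ and generated by $-r$; its image in the quotient by the center has order $3$.
\<close>

definition bin_tet_C6 where "bin_tet_C6 = {x \<in> bin_tet. qr \<otimes>\<^bsub>G\<^esub> x = x \<otimes>\<^bsub>G\<^esub> qr}"

lemma T_subgroup: "subgroup bin_tet_C6 G"
proof -
  have "bin_tet_C6 = bin_tet \<inter> centralizer G qr" using B_subgroup subgroup.subset by (auto simp: bin_tet_C6_def centralizer_def)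
  then show ?thesis using B_subgroup G.centralizer_subgroup[of qr] G.subgroups_Inter_pair by simp
qed

lemma qi_not_T: "qi \<notin> bin_tet_C6"
proof
  assume "qi \<in> bin_tet_C6"
  then have "qr \<otimes>\<^bsub>G\<^esub> qi = qi \<otimes>\<^bsub>G\<^esub> qr" by (simp add: bin_tet_C6_def)
  then have "qi = qj" using q_relations(4) by simp
  then show False using not_commute_ij by simp
qed

lemma qr_T: "qr \<in> bin_tet_C6" using qr_B by (simp add: bin_tet_C6_def)

lemma Z_T: "Z \<subseteq> bin_tet_C6"
  using center_subset_of_qi[OF B_subgroup qi_B] center_central[of _ qr] by (auto simp: bin_tet_C6_def)

lemma qr_not_center: "qr \<notin> Z" 
  using not_commute_imp_not_center[OF _ _ not_commute_r] by simp

text \<open>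
  The order is a multiple of $6$ and divides $24$. If it is $12$, the subgroup contains the squares of all elements of the group of order $24$, hence
  $r$ and $iri^{-1} = -kr$, hence $k$ and its conjugate $i$, and then \<open>card_overgroup\<close> makes it too large.
\<close>

lemma card_intermediate:
  assumes K: "subgroup K G" "bin_tet_C6 \<subseteq> K" "K \<subseteq> bin_tet" 
  shows "card K = 6 \<or> K = bin_tet"
proof -
  let ?B = "G\<lparr>carrier := bin_tet\<rparr>"
  interpret B: group ?B using B_subgroup G.subgroup_imp_group by blast
  interpret K: subgroup K G by fact
  have fB: "finite bin_tet" using card_B by (metis card.infinite zero_neq_numeral)
  have "card K dvd 24" using G.card_subgroup_dvd[OF K(1) B_subgroup K(3)] card_B by simp
  moreover have "2 dvd card K" using G.card_subgroup_dvd[OF Z_subgroup K(1)] Z_T K(2) card_Z by auto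
  moreover have "3 dvd card K"
  proof -
    have "qr [^]\<^bsub>G\<^esub> (3::nat) = \<one>\<^bsub>G\<^esub>" using q_relations(7) by (simp add: numeral_3_eq_3)
    then have "G.ord qr dvd 3" using G.pow_eq_id by simp
    moreover have "m = 1 \<or> m = 3" if "m dvd 3" for m :: nat
    proof -
      have "m \<le> 3" using that by (rule dvd_imp_le) simp
      then have "m = 0 \<or> m = 1 \<or> m = 2 \<or> m = 3" by linarith
      then show ?thesis using that by auto
    qed
    ultimately have "G.ord qr = 1 \<or> G.ord qr = 3" by blast
    moreover have "qr \<noteq> \<one>\<^bsub>G\<^esub>" using qr_not_center Z_eq by auto
    ultimately have "G.ord qr = 3" using G.ord_eq_1[of qr] by auto
    then have "card (generate G {qr}) = 3" using G.generate_pow_card[of qr] by simp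
    moreover have "generate G {qr} \<subseteq> K" using G.generate_subgroup_incl[OF _ K(1)] qr_T K(2) by blast
    ultimately show ?thesis using G.card_subgroup_dvd[OF G.generate_is_subgroup[of "{qr}"] K(1)] by simp
  qed
  moreover have "card K \<noteq> 12"
  proof
    assume c: "card K = 12"
    have sq: "x \<otimes>\<^bsub>G\<^esub> x \<in> K" if "x \<in> bin_tet" for x
      using B.card_index_two_square[of K x] fB G.subgroup_incl[OF K(1) B_subgroup K(3)] c card_B that
      by (simp add: order_def)
    interpret BS: subgroup bin_tet G by (rule B_subgroup)
    define s where "s = qi \<otimes>\<^bsub>G\<^esub> qr \<otimes>\<^bsub>G\<^esub> inv\<^bsub>G\<^esub> qi"
    have s: "s \<in> bin_tet" using qi_B qr_B by (simp add: s_def)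
    have "(s \<otimes>\<^bsub>G\<^esub> s) \<otimes>\<^bsub>G\<^esub> (s \<otimes>\<^bsub>G\<^esub> s) \<in> K" using sq s by blast
    moreover have "(s \<otimes>\<^bsub>G\<^esub> s) \<otimes>\<^bsub>G\<^esub> (s \<otimes>\<^bsub>G\<^esub> s) = s"
      unfolding s_def by (intro G.square_square_of_cube G.conj_cube) (simp_all add: q_relations(7))
    ultimately have "s \<in> K" by simp
    have qrK: "qr \<in> K" using qr_T K(2) by blast
    have "qi \<otimes>\<^bsub>G\<^esub> qr = (minus_one \<otimes>\<^bsub>G\<^esub> qk \<otimes>\<^bsub>G\<^esub> qr) \<otimes>\<^bsub>G\<^esub> qi"
      unfolding qi_def qk_def qr_def minus_one_def Mat_mult Mat_eq_iff
      using ab' unfolding cong_iff_dvd_diff by (intro conjI; Groebner_Basis.algebra)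
    then have "s = minus_one \<otimes>\<^bsub>G\<^esub> qk \<otimes>\<^bsub>G\<^esub> qr" unfolding s_def by (intro G.conj_eqI) simp_all
    then have "minus_one \<otimes>\<^bsub>G\<^esub> (s \<otimes>\<^bsub>G\<^esub> inv\<^bsub>G\<^esub> qr) = qk"
      by (simp add: G.m_assoc) (simp add: minus_one_square flip: G.m_assoc)
    moreover have "minus_one \<in> K" using Z_T K(2) by (auto simp: Z_eq)
    ultimately have "qk \<in> K" using \<open>s \<in> K\<close> qrK K.m_closed K.m_inv_closed by metis
    then have "qr \<otimes>\<^bsub>G\<^esub> qk \<otimes>\<^bsub>G\<^esub> inv\<^bsub>G\<^esub> qr \<in> K" using qrK by simp
    moreover have "qr \<otimes>\<^bsub>G\<^esub> qk \<otimes>\<^bsub>G\<^esub> inv\<^bsub>G\<^esub> qr = qi" using q_relations(6) by (intro G.conj_eqI) simp_all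
    ultimately have "qi \<in> K" by simp
    then have "card K = 24" using card_overgroup[OF K(1) _ qrK] B_semisimple K(3) by blast
    then show False using c by simp
  qed
  moreover have "card K = 6 \<or> card K = 24" if "n dvd 24" "2 dvd n" "3 dvd n" "n \<noteq> 12" "n = card K" for n
  proof -
    have "6 dvd n" using that(2,3) by presburger
    then obtain m where m: "n = 6 * m" by blast
    then have "m dvd 4" using that(1) dvd_mult_cancel_left[of 6 m 4] by simp
    then have "m \<le> 4" by (rule dvd_imp_le) simp
    then have "m = 0 \<or> m = 1 \<or> m = 2 \<or> m = 3 \<or> m = 4" by linarith
    then have "m = 1 \<or> m = 2 \<or> m = 4" using \<open>m dvd 4\<close> by auto
    then show ?thesis using m that(4,5) by auto
  qed
  ultimately have "card K = 6 \<or> card K = 24" by blast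
  then show ?thesis using card_subset_eq[OF fB K(3)] card_B by metis
qed

lemma card_T: "card bin_tet_C6 = 6"
  using card_intermediate[OF T_subgroup] qi_not_T qi_B by (auto simp: bin_tet_C6_def)

lemma T_maximal:
  assumes K: "subgroup K G" "bin_tet_C6 \<subseteq> K" "K \<subseteq> bin_tet" shows "K = bin_tet_C6 \<or> K = bin_tet"
proof -
  have "finite K" using K(1) finite_G finite_subset subgroup.subset by blast
  then show ?thesis using card_intermediate[OF K] card_T card_subset_eq[OF _ K(2)] by metis
qed

end

section \<open>Depth and length of the projective group\<close>

context SL2_prime begin

lemma Z_normal: "Z \<lhd> G"
  unfolding G.normal_inv_iff
proof (intro conjI ballI)
  show "subgroup Z G" by (rule Z_subgroup)
  fix x z assume "x \<in> carrier G" "z \<in> Z"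
  then show "x \<otimes>\<^bsub>G\<^esub> z \<otimes>\<^bsub>G\<^esub> inv\<^bsub>G\<^esub> x \<in> Z"
    using G.conj_eqI[of x z z] center_central[of z x] Z_subset_carrier by auto
qed

sublocale Zn: normal Z G by (rule Z_normal)

lemma L2_eq: "L2 p = G Mod Z" by (simp add: PSL2_def)

lemma finite_quot: "finite (carrier (G Mod Z))"
  unfolding Zn.carrier_quot using finite_G by simp

lemma proj_Uni_noteq: "Zn.proj (Uni 1 0 1) \<noteq> Z"
proof
  assume "Zn.proj (Uni 1 0 1) = Z"
  then have "Uni 1 0 1 \<in> Z" using Zn.proj_eq_one_iff by simp
  moreover have det: "(1 - 1 * (1 * 0)) * (1 + 1 * (1 * 0)) - 1 * (1 * 1) * - (1 * (0 * 0)) \<doteq> 1" by simp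
  ultimately have "1 * (1 * 1) \<doteq> 0" unfolding Uni_def Mat_in_center_iff[OF det] by blast
  then show False using one_not_0 by simp
qed

lemma simple_quot: "simple_group (G Mod Z)"
proof (intro simple_group.intro simple_group_axioms.intro)
  show "group (G Mod Z)" by (rule Zn.factorgroup_is_group)
  have "{Z, Zn.proj (Uni 1 0 1)} \<subseteq> carrier (G Mod Z)"
    using Zn.quot.one_closed by (auto simp: Zn.carrier_quot)
  then have "card {Z, Zn.proj (Uni 1 0 1)} \<le> order (G Mod Z)"
    unfolding order_def by (rule card_mono[OF finite_quot])
  then show "order (G Mod Z) > 1" using proj_Uni_noteq by auto
  fix N assume N: "N \<lhd> G Mod Z"
  have sN: "subgroup N (G Mod Z)" using N normal_imp_subgroup by blast
  have "Zn.preim N \<lhd> G"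
    unfolding G.normal_inv_iff
  proof (intro conjI ballI)
    show "subgroup (Zn.preim N) G" by (rule Zn.preim_subgroup[OF sN])
    fix x y assume x: "x \<in> carrier G" and "y \<in> Zn.preim N"
    then have y: "y \<in> carrier G" "Zn.proj y \<in> N" by (auto simp: Zn.preim_def)
    have "Zn.proj x \<otimes>\<^bsub>G Mod Z\<^esub> Zn.proj y \<otimes>\<^bsub>G Mod Z\<^esub> inv\<^bsub>G Mod Z\<^esub> (Zn.proj x) \<in> N"
      using normal.inv_op_closed2[OF N _ y(2)] Zn.ph.hom_closed[OF x] by blast
    moreover have "Zn.proj (x \<otimes>\<^bsub>G\<^esub> y \<otimes>\<^bsub>G\<^esub> inv\<^bsub>G\<^esub> x) = Zn.proj x \<otimes>\<^bsub>G Mod Z\<^esub> Zn.proj y \<otimes>\<^bsub>G Mod Z\<^esub> inv\<^bsub>G Mod Z\<^esub> (Zn.proj x)"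
      using Zn.ph.hom_mult[of "x \<otimes>\<^bsub>G\<^esub> y" "inv\<^bsub>G\<^esub> x"] Zn.ph.hom_mult[of x y] Zn.ph.hom_inv[of x] x y(1) by simp
    ultimately show "x \<otimes>\<^bsub>G\<^esub> y \<otimes>\<^bsub>G\<^esub> inv\<^bsub>G\<^esub> x \<in> Zn.preim N" using x y(1) by (simp add: Zn.preim_def)
  qed
  then have "Zn.preim N \<subseteq> Z \<or> Zn.preim N = carrier G" using normal_subgroup_SL2 by blast
  then have "Zn.preim N = Z \<or> Zn.preim N = carrier G" using Zn.H_preim[OF sN] by blast
  then show "N = carrier (G Mod Z) \<or> N = {\<one>\<^bsub>G Mod Z\<^esub>}"
  proof
    assume e: "Zn.preim N = carrier G"
    have "N = Zn.proj ` carrier G" using Zn.proj_preim[OF sN] unfolding e by simp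
    then show ?thesis using Zn.carrier_quot by simp
  next
    assume e: "Zn.preim N = Z"
    have "N = Zn.proj ` Z" using Zn.proj_preim[OF sN] unfolding e by simp
    moreover have "Zn.proj ` Z = (\<lambda>_. Z) ` Z"
      using Zn.proj_eq_one_iff Z_subset_carrier by (intro image_cong) auto
    moreover have "(\<lambda>_. Z) ` Z = {Z}" by (rule image_constant[OF Zn.one_closed])
    ultimately have "N = {Z}" by simp
    then show ?thesis by simp
  qed
qed

text \<open>
  A subgroup $M$ whose trivial subgroup is maximal is generated by any nontrivial element, say by the image of $x$. So $M$ lies in the image of the
  centralizer of $x$, and equals it when $M$ is maximal. The normalizer of this centralizer is larger, so it is everything, against simplicity.
\<close>

lemma not_cyclic_maximal:
  assumes M: "maximal_subgroup M (G Mod Z)" and min: "maximal_subgroup {Z} ((G Mod Z)\<lparr>carrier := M\<rparr>)"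
  shows False
proof -
  let ?Q = "G Mod Z"
  have M': "maximal_subgroup M (?Q\<lparr>carrier := carrier ?Q\<rparr>)" using M by simp
  note Mmax = maximal_subgroup_restrictD[OF Zn.quot.is_group Zn.quot.subgroup_self M']
  note Zmax = maximal_subgroup_restrictD[OF Zn.quot.is_group Mmax(1) min]
  interpret M: subgroup M ?Q by (rule Mmax(1))
  obtain y where y: "y \<in> M" "y \<noteq> Z" using Zmax(2) by blast
  then have "y \<in> Zn.proj ` carrier G" using M.subset unfolding Zn.carrier_quot by blast
  then obtain x where x: "x \<in> carrier G" "y = Zn.proj x" by blast
  then have xZ: "x \<notin> Z" using y(2) Zn.proj_eq_one_iff by blast
  have gen: "subgroup (generate ?Q {y}) ?Q" using y M.subset by (intro Zn.quot.generate_is_subgroup) auto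
  have "generate ?Q {y} = M"
  proof -
    have "{Z} \<subseteq> generate ?Q {y}" using subgroup.one_closed[OF gen] by simp
    moreover have "generate ?Q {y} \<subseteq> M" using y by (intro Zn.quot.generate_subgroup_incl Mmax(1)) auto
    ultimately have "generate ?Q {y} = {Z} \<or> generate ?Q {y} = M" using Zmax(3)[OF gen] by blast
    moreover have "y \<in> generate ?Q {y}" by (rule generate.incl) simp
    ultimately show ?thesis using y by blast
  qed
  define C where "C = centralizer G x"
  have C: "subgroup C G" unfolding C_def by (rule G.centralizer_subgroup[OF x(1)])
  interpret C: subgroup C G by (rule C)
  have ZC: "Z \<subseteq> C"
  proof
    fix z assume z: "z \<in> Z"
    then have "x \<otimes>\<^bsub>G\<^esub> z = z \<otimes>\<^bsub>G\<^esub> x" using center_central[OF z x(1)] by metis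
    then show "z \<in> C" using subsetD[OF Z_subset_carrier z] unfolding C_def centralizer_def by blast
  qed
  have xC: "x \<in> C" using x unfolding C_def centralizer_def by blast
  have Cne: "C \<noteq> carrier G"
  proof
    assume "C = carrier G"
    then have "x \<in> Z" using x(1) unfolding C_def centralizer_def group_center_def by blast
    then show False using xZ by contradiction
  qed
  have MC: "M \<subseteq> Zn.proj ` C"
    unfolding \<open>generate ?Q {y} = M\<close>[symmetric] using xC x(2)
    by (intro Zn.quot.generate_subgroup_incl Zn.proj_subgroup C) auto
  have pC: "Zn.proj ` C = M"
  proof -
    have "Zn.proj ` C \<subseteq> carrier ?Q" using C.subset by (auto simp: Zn.carrier_quot)
    then have "Zn.proj ` C = M \<or> Zn.proj ` C = carrier ?Q"
      using Mmax(3)[OF Zn.proj_subgroup[OF C] MC] by blast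
    moreover have "Zn.proj ` C \<noteq> carrier ?Q"
    proof
      assume "Zn.proj ` C = carrier ?Q"
      then have "Zn.preim (Zn.proj ` C) = carrier G" by (auto simp: Zn.preim_def Zn.carrier_quot)
      then show False using Zn.preim_proj[OF C ZC] Cne by simp
    qed
    ultimately show ?thesis by blast
  qed
  obtain g where g: "g \<in> carrier G" "g \<otimes>\<^bsub>G\<^esub> x \<noteq> x \<otimes>\<^bsub>G\<^esub> g"
    "x \<otimes>\<^bsub>G\<^esub> (g \<otimes>\<^bsub>G\<^esub> x \<otimes>\<^bsub>G\<^esub> inv\<^bsub>G\<^esub> g) = (g \<otimes>\<^bsub>G\<^esub> x \<otimes>\<^bsub>G\<^esub> inv\<^bsub>G\<^esub> g) \<otimes>\<^bsub>G\<^esub> x"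
    by (rule normalizing_element[OF x(1) xZ])
  define L where "L = {k \<in> carrier G. \<forall>c\<in>C. k \<otimes>\<^bsub>G\<^esub> c \<otimes>\<^bsub>G\<^esub> inv\<^bsub>G\<^esub> k \<in> C}"
  have L: "subgroup L G" unfolding L_def
    using finite_subset[OF C.subset finite_G] C.subset by (rule G.set_normalizer_subgroup)
  have conj: "(k \<otimes>\<^bsub>G\<^esub> c \<otimes>\<^bsub>G\<^esub> inv\<^bsub>G\<^esub> k) \<otimes>\<^bsub>G\<^esub> (k \<otimes>\<^bsub>G\<^esub> d \<otimes>\<^bsub>G\<^esub> inv\<^bsub>G\<^esub> k) = k \<otimes>\<^bsub>G\<^esub> (c \<otimes>\<^bsub>G\<^esub> d) \<otimes>\<^bsub>G\<^esub> inv\<^bsub>G\<^esub> k"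
    if "k \<in> carrier G" "c \<in> carrier G" "d \<in> carrier G" for k c d
    using that by (simp add: G.m_assoc) (simp flip: G.m_assoc)
  have gx: "g \<otimes>\<^bsub>G\<^esub> x \<otimes>\<^bsub>G\<^esub> inv\<^bsub>G\<^esub> g \<in> carrier G" using g(1) x(1) by simp
  have gxZ: "g \<otimes>\<^bsub>G\<^esub> x \<otimes>\<^bsub>G\<^esub> inv\<^bsub>G\<^esub> g \<notin> Z"
  proof
    assume a: "g \<otimes>\<^bsub>G\<^esub> x \<otimes>\<^bsub>G\<^esub> inv\<^bsub>G\<^esub> g \<in> Z"
    have "inv\<^bsub>G\<^esub> g \<otimes>\<^bsub>G\<^esub> (g \<otimes>\<^bsub>G\<^esub> x \<otimes>\<^bsub>G\<^esub> inv\<^bsub>G\<^esub> g) \<otimes>\<^bsub>G\<^esub> inv\<^bsub>G\<^esub> (inv\<^bsub>G\<^esub> g) \<in> Z"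
      using Zn.inv_op_closed2[OF _ a, of "inv\<^bsub>G\<^esub> g"] g(1) by simp
    moreover have "inv\<^bsub>G\<^esub> g \<otimes>\<^bsub>G\<^esub> (g \<otimes>\<^bsub>G\<^esub> x \<otimes>\<^bsub>G\<^esub> inv\<^bsub>G\<^esub> g) \<otimes>\<^bsub>G\<^esub> inv\<^bsub>G\<^esub> (inv\<^bsub>G\<^esub> g) = x"
      using g(1) x(1) by (simp add: G.m_assoc) (simp flip: G.m_assoc)
    ultimately show False using xZ by simp
  qed
  have gL: "g \<in> L"
  proof -
    have "g \<otimes>\<^bsub>G\<^esub> c \<otimes>\<^bsub>G\<^esub> inv\<^bsub>G\<^esub> g \<in> C" if c: "c \<in> C" for c
    proof -
      have cG: "c \<in> carrier G" and xc: "x \<otimes>\<^bsub>G\<^esub> c = c \<otimes>\<^bsub>G\<^esub> x" using c unfolding C_def centralizer_def by blast+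
      have "x \<otimes>\<^bsub>G\<^esub> (g \<otimes>\<^bsub>G\<^esub> c \<otimes>\<^bsub>G\<^esub> inv\<^bsub>G\<^esub> g) = (g \<otimes>\<^bsub>G\<^esub> c \<otimes>\<^bsub>G\<^esub> inv\<^bsub>G\<^esub> g) \<otimes>\<^bsub>G\<^esub> x"
      proof (rule commute_trans[OF x(1) gx _ gxZ g(3)])
        show "g \<otimes>\<^bsub>G\<^esub> c \<otimes>\<^bsub>G\<^esub> inv\<^bsub>G\<^esub> g \<in> carrier G" using g(1) cG by simp
        show "(g \<otimes>\<^bsub>G\<^esub> x \<otimes>\<^bsub>G\<^esub> inv\<^bsub>G\<^esub> g) \<otimes>\<^bsub>G\<^esub> (g \<otimes>\<^bsub>G\<^esub> c \<otimes>\<^bsub>G\<^esub> inv\<^bsub>G\<^esub> g) =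
          (g \<otimes>\<^bsub>G\<^esub> c \<otimes>\<^bsub>G\<^esub> inv\<^bsub>G\<^esub> g) \<otimes>\<^bsub>G\<^esub> (g \<otimes>\<^bsub>G\<^esub> x \<otimes>\<^bsub>G\<^esub> inv\<^bsub>G\<^esub> g)"
          unfolding conj[OF g(1) x(1) cG] conj[OF g(1) cG x(1)] xc ..
      qed
      then show ?thesis using g(1) cG unfolding C_def centralizer_def by blast
    qed
    then show ?thesis using g(1) unfolding L_def by blast
  qed
  have CL: "C \<subseteq> L"
  proof
    fix k assume k: "k \<in> C"
    then have "k \<otimes>\<^bsub>G\<^esub> c \<otimes>\<^bsub>G\<^esub> inv\<^bsub>G\<^esub> k \<in> C" if "c \<in> C" for c using that by blast
    then show "k \<in> L" using k C.subset unfolding L_def by blast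
  qed
  have gC: "g \<notin> C" using g(2) unfolding C_def centralizer_def by force
  have "Zn.proj ` L = M \<or> Zn.proj ` L = carrier ?Q"
  proof (rule Mmax(3)[OF Zn.proj_subgroup[OF L]])
    show "M \<subseteq> Zn.proj ` L" using CL pC by blast
    show "Zn.proj ` L \<subseteq> carrier ?Q" using subgroup.subset[OF L] by (auto simp: Zn.carrier_quot)
  qed
  then show False
  proof
    assume "Zn.proj ` L = M"
    then have "L = C" using Zn.preim_proj[OF L] Zn.preim_proj[OF C ZC] pC CL ZC by (metis order.trans)
    then show False using gL gC by blast
  next
    assume "Zn.proj ` L = carrier ?Q"
    then have "Zn.preim (Zn.proj ` L) = carrier G" by (auto simp: Zn.preim_def Zn.carrier_quot)
    then have "L = carrier G" using Zn.preim_proj[OF L] CL ZC by auto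
    then have "C \<lhd> G" using C unfolding G.normal_inv_iff L_def by blast
    then show False using normal_subgroup_SL2[OF _ xC xZ] Cne by blast
  qed
qed

lemma tr_cube:
  assumes "y \<in> carrier G" shows "tr (y \<otimes>\<^bsub>G\<^esub> y \<otimes>\<^bsub>G\<^esub> y) \<doteq> tr y ^ 3 - 3 * tr y"
proof -
  obtain a b c d where M: "y = Mat a b c d" "a * d - b * c \<doteq> 1" using assms by (rule carrier_Mat)
  have t: "tr y \<doteq> a + d" by (simp add: M)
  have "tr (y \<otimes>\<^bsub>G\<^esub> y \<otimes>\<^bsub>G\<^esub> y) \<doteq> ((a * a + b * c) * a + (a * b + b * d) * c) + ((c * a + d * c) * b + (c * b + d * d) * d)"
    by (simp add: M)
  moreover have "((a * a + b * c) * a + (a * b + b * d) * c) + ((c * a + d * c) * b + (c * b + d * d) * d) \<doteq> tr y ^ 3 - 3 * tr y"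
    using M(2) t unfolding cong_iff_dvd_diff by Groebner_Basis.algebra
  ultimately show ?thesis by (rule cong_trans)
qed

lemma tr_square:
  assumes "y \<in> carrier G" shows "tr (y \<otimes>\<^bsub>G\<^esub> y) \<doteq> tr y * tr y - 2"
proof -
  obtain a b c d where M: "y = Mat a b c d" "a * d - b * c \<doteq> 1" using assms by (rule carrier_Mat)
  have t: "tr y \<doteq> a + d" by (simp add: M)
  have "tr (y \<otimes>\<^bsub>G\<^esub> y) \<doteq> (a * a + b * c) + (c * b + d * d)"
    by (simp add: M)
  moreover have "(a * a + b * c) + (c * b + d * d) \<doteq> tr y * tr y - 2"
    using M(2) t unfolding cong_iff_dvd_diff by Groebner_Basis.algebra
  ultimately show ?thesis by (rule cong_trans)
qed

text \<open>
  By Cayley and Hamilton $y^2 + y + 1 = 0$.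
\<close>

lemma trace_minus_one:
  assumes "y \<in> carrier G" "tr y \<doteq> -1"
  shows "y \<otimes>\<^bsub>G\<^esub> y \<otimes>\<^bsub>G\<^esub> y = \<one>\<^bsub>G\<^esub>" "y \<notin> Z"
proof -
  obtain a b c d where M: "y = Mat a b c d" "a * d - b * c \<doteq> 1" using assms(1) by (rule carrier_Mat)
  have t: "a + d \<doteq> -1" using assms(2) by (simp add: M)
  show "y \<otimes>\<^bsub>G\<^esub> y \<otimes>\<^bsub>G\<^esub> y = \<one>\<^bsub>G\<^esub>"
    unfolding M(1) Mat_one Mat_mult Mat_eq_iff
    using t M(2) unfolding cong_iff_dvd_diff by (intro conjI; Groebner_Basis.algebra)
  show "y \<notin> Z"
  proof
    assume "y \<in> Z"
    then have "b \<doteq> 0" "c \<doteq> 0" "a - d \<doteq> 0" using Mat_in_center_iff[OF M(2)] M(1) by blast+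
    then have "3 \<doteq> 0" using t M(2) unfolding cong_iff_dvd_diff by Groebner_Basis.algebra
    then show False using three_not_0 by contradiction
  qed
qed

text \<open>
  Both parts concern a matrix $x$ with trace $41/2$. Its power with exponent $3^j$ has trace $-1$, so it is of order $3$ also modulo the center. As $x$ has
  odd order it has a square root $s$ among its powers, and $\mathrm{tr}(s)^2 = \mathrm{tr}(x) + 2$.
\<close>

lemma element_of_order_power_of_3:
  assumes c: "trace_num j + 2 ^ (3 ^ j) \<doteq> 0"
  shows "\<exists>y\<in>carrier (G Mod Z). Zn.quot.ord y = 3 ^ Suc j"
    and "\<exists>s t. s\<^sup>2 \<doteq> 10 * t\<^sup>2 \<and> \<not> t \<doteq> 0"
proof -
  obtain h where h: "2 * h \<doteq> 1" using eqm_inverse[OF two_not_0] .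
  define x where "x = Mat 0 (-1) 1 (41 * h)"
  have x: "x \<in> carrier G" by (simp add: x_def)
  have trx: "2 * tr x \<doteq> 41"
  proof -
    have "tr x \<doteq> 41 * h" by (simp add: x_def)
    then have "2 * tr x \<doteq> 2 * (41 * h)" by (rule cong_scalar_left)
    also have "2 * (41 * h) = 41 * (2 * h)" by simp
    also have "41 * (2 * h) \<doteq> 41 * 1" using h by (rule cong_scalar_left)
    finally show ?thesis by simp
  qed
  define pw where "pw = (\<lambda>i. x [^]\<^bsub>G\<^esub> (3 ^ i :: nat))"
  have pw: "pw i \<in> carrier G" for i using x by (simp add: pw_def)
  have pw_Suc: "pw (Suc i) = pw i \<otimes>\<^bsub>G\<^esub> pw i \<otimes>\<^bsub>G\<^esub> pw i" for i
  proof -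
    have "(3::nat) ^ Suc i = 3 ^ i + 3 ^ i + 3 ^ i" by simp
    then show ?thesis unfolding pw_def by (simp only: G.nat_pow_mult[OF x])
  qed
  have trace: "tr (pw i) * 2 ^ (3 ^ i) \<doteq> trace_num i" for i
  proof (induction i)
    case 0 then show ?case using trx x by (simp add: pw_def mult.commute)
  next
    case (Suc i)
    define t m n where "t = tr (pw i)" and "m = (2::int) ^ (3 ^ i)" and "n = trace_num i"
    have "tr (pw (Suc i)) \<doteq> t ^ 3 - 3 * t" unfolding pw_Suc t_def by (rule tr_cube[OF pw])
    then have "tr (pw (Suc i)) * m ^ 3 \<doteq> n ^ 3 - 3 * m ^ 2 * n"
      using Suc unfolding t_def[symmetric] m_def[symmetric] n_def[symmetric] cong_iff_dvd_diff
      by Groebner_Basis.algebra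
    moreover have "(2::int) ^ (3 ^ Suc i) = m ^ 3" by (simp add: m_def flip: power_mult)
    ultimately show ?case by (simp add: m_def n_def)
  qed
  have two_pow: "\<not> 2 ^ n \<doteq> 0" for n
    by (induction n) (use one_not_0 two_not_0 in \<open>simp_all add: eqm_mult_0\<close>)
  have "(tr (pw j) + 1) * 2 ^ (3 ^ j) \<doteq> 0"
    using cong_trans[OF cong_add[OF trace[of j] cong_refl] c] by (simp add: distrib_right)
  then have "tr (pw j) + 1 \<doteq> 0" using two_pow eqm_mult_0 by blast
  then have t1: "tr (pw j) \<doteq> -1" by (simp add: cong_iff_dvd_diff)
  have one: "pw (Suc j) = \<one>\<^bsub>G\<^esub>" using trace_minus_one(1)[OF pw t1] pw_Suc by simp
  let ?y = "Zn.proj x"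
  have y: "?y \<in> carrier (G Mod Z)" using x by (auto simp: Zn.carrier_quot)
  have ypow: "?y [^]\<^bsub>G Mod Z\<^esub> (n::nat) = Zn.proj (x [^]\<^bsub>G\<^esub> n)" for n
    using Zn.ph.hom_nat_pow[OF x] by simp
  have "Zn.quot.ord ?y dvd 3 ^ Suc j"
    using one Zn.quot.pow_eq_id[OF y, of "3 ^ Suc j"] ypow Zn.ph.hom_one by (simp add: pw_def)
  then obtain i where i: "i \<le> Suc j" "Zn.quot.ord ?y = 3 ^ i"
    using divides_primepow_nat[of 3 "Zn.quot.ord ?y" "Suc j"] by auto
  have "\<not> Zn.quot.ord ?y dvd 3 ^ j"
  proof
    assume "Zn.quot.ord ?y dvd 3 ^ j"
    then have "Zn.proj (pw j) = Z" using Zn.quot.pow_eq_id[OF y, of "3 ^ j"] ypow by (simp add: pw_def)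
    then show False using Zn.proj_eq_one_iff[OF pw] trace_minus_one(2)[OF pw t1] by blast
  qed
  then have "i = Suc j" using i le_imp_power_dvd[of i j "3::nat"] by (metis le_SucE)
  then show "\<exists>y\<in>carrier (G Mod Z). Zn.quot.ord y = 3 ^ Suc j" using i y by blast
  have "odd ((3::nat) ^ Suc j)" by simp
  then obtain k where k: "(3::nat) ^ Suc j = 2 * k + 1" by (rule oddE)
  \<comment> \<open>Since $x^{2k+1} = 1$, the power $x^{k+1}$ is a square root of $x$.\<close>
  define s where "s = x [^]\<^bsub>G\<^esub> (k + 1)"
  have s: "s \<in> carrier G" using x by (simp add: s_def)
  have "s \<otimes>\<^bsub>G\<^esub> s = x [^]\<^bsub>G\<^esub> ((2 * k + 1) + 1)"
    unfolding s_def G.nat_pow_mult[OF x] by (rule arg_cong[where f = "\<lambda>n. x [^]\<^bsub>G\<^esub> n"]) simp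
  also have "\<dots> = x [^]\<^bsub>G\<^esub> (2 * k + 1) \<otimes>\<^bsub>G\<^esub> x" by simp
  also have "\<dots> = x" using one k x by (simp add: pw_def)
  finally have "tr x \<doteq> tr s * tr s - 2" using tr_square[OF s] by simp
  then have "4 * tr x + 8 \<doteq> 4 * (tr s * tr s - 2) + 8" by (intro cong_add cong_scalar_left cong_refl)
  then have "(2 * tr s)\<^sup>2 \<doteq> 4 * tr x + 8" by (simp add: power2_eq_square cong_sym_eq)
  also have "4 * tr x + 8 \<doteq> 2 * 41 + 8" using cong_add[OF cong_scalar_left[OF trx, of 2] cong_refl[of 8]] by simp
  finally have "(2 * tr s)\<^sup>2 \<doteq> 10 * 3\<^sup>2" by simp
  then show "\<exists>s t. s\<^sup>2 \<doteq> 10 * t\<^sup>2 \<and> \<not> t \<doteq> 0" using three_not_0 by blast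
qed

end

context SL2_quaternions begin

lemma not_comm_quot: "\<not> comm_group (G Mod Z)"
proof
  assume "comm_group (G Mod Z)"
  then interpret c: comm_group "G Mod Z" .
  have "Zn.proj (qr \<otimes>\<^bsub>G\<^esub> qi) = Zn.proj (qi \<otimes>\<^bsub>G\<^esub> qr)"
    using Zn.ph.hom_mult[of qr qi] Zn.ph.hom_mult[of qi qr] c.m_comm Zn.ph.hom_closed by simp
  then have "qr \<otimes>\<^bsub>G\<^esub> qi \<in> Zn.proj (qi \<otimes>\<^bsub>G\<^esub> qr)"
    using G.rcos_self[OF _ Zn.is_subgroup, of "qr \<otimes>\<^bsub>G\<^esub> qi"] by simp
  then obtain z where z: "z \<in> Z" "qj \<otimes>\<^bsub>G\<^esub> qr = z \<otimes>\<^bsub>G\<^esub> (qi \<otimes>\<^bsub>G\<^esub> qr)"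
    using q_relations(4) by (auto simp: r_coset_def)
  then have "qj = z \<otimes>\<^bsub>G\<^esub> qi" using Z_subset_carrier by (auto simp flip: G.m_assoc)
  then show False using not_commute_ij center_central[OF z(1), of qi] z(1) Z_subset_carrier
    by (auto simp: G.m_assoc)
qed

text \<open>
  The chain is $L_2(p) > A_4 > C_3 > 1$.
\<close>

lemma depth_quot: "group_depth (G Mod Z) = 3"
proof -
  let ?Q = "G Mod Z"
  have BT: "bin_tet_C6 \<subset> bin_tet" using qi_B qi_not_T by (auto simp: bin_tet_C6_def)
  have BG: "bin_tet \<subset> carrier G" using subgroup.subset[OF B_subgroup] B_proper by blast
  have ZB: "Z \<subseteq> bin_tet" using Z_T BT by blast
  have max1: "maximal_subgroup (Zn.proj ` bin_tet) ?Q"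
    using Zn.proj_maximal[OF G.subgroup_self B_subgroup ZB BG] B_maximal by (simp add: Zn.carrier_quot[symmetric])
  have max2: "maximal_subgroup (Zn.proj ` bin_tet_C6) (?Q\<lparr>carrier := Zn.proj ` bin_tet\<rparr>)"
    by (rule Zn.proj_maximal[OF B_subgroup T_subgroup Z_T BT T_maximal])
  have "card (Zn.proj ` bin_tet_C6) = 3" using Zn.card_proj[OF T_subgroup Z_T] card_T card_Z by simp
  then have max3: "maximal_subgroup {Z} (?Q\<lparr>carrier := Zn.proj ` bin_tet_C6\<rparr>)"
    using Zn.quot.prime_card_trivial_maximal[OF Zn.proj_subgroup[OF T_subgroup]] by simp
  define C where "C = (\<lambda>i::nat. if i = 0 then carrier ?Q else if i = 1 then Zn.proj ` bin_tet else if i = 2 then Zn.proj ` bin_tet_C6 else {Z})"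
  have chain: "unrefinable_chain ?Q 3 C"
    unfolding unrefinable_chain_def using max1 max2 max3 by (auto simp: C_def less_Suc_eq numeral_3_eq_3)
  have lower: "3 \<le> t" if "unrefinable_chain ?Q t D" for t D
  proof (rule ccontr)
    assume "\<not> 3 \<le> t"
    then consider "t = 0" | "t = 1" | "t = 2" by linarith
    then show False
    proof cases
      case 1
      then have "D 0 = carrier ?Q" "D 0 = {\<one>\<^bsub>?Q\<^esub>}" using that by (auto simp: unrefinable_chain_def)
      then have "carrier ?Q = {\<one>\<^bsub>?Q\<^esub>}" by simp
      then show False using simple_group.simple_not_triv[OF simple_quot] by contradiction
    next
      case 2
      then have "maximal_subgroup {\<one>\<^bsub>?Q\<^esub>} ?Q" using that by (auto simp: unrefinable_chain_def)
      moreover have "subgroup (Zn.proj ` bin_tet) ?Q" using max1 by (simp add: maximal_subgroup_def)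
      moreover have "{\<one>\<^bsub>?Q\<^esub>} \<subseteq> Zn.proj ` bin_tet"
        using subgroup.one_closed[OF \<open>subgroup (Zn.proj ` bin_tet) ?Q\<close>] by blast
      ultimately have "Zn.proj ` bin_tet = {\<one>\<^bsub>?Q\<^esub>} \<or> Zn.proj ` bin_tet = carrier ?Q"
        unfolding maximal_subgroup_def by blast
      moreover have "Zn.proj ` bin_tet \<noteq> carrier ?Q" using max1 by (simp add: maximal_subgroup_def)
      moreover have "card (Zn.proj ` bin_tet) = 12" using Zn.card_proj[OF B_subgroup ZB] card_B card_Z by simp
      ultimately show False by auto
    next
      case 3
      then have "maximal_subgroup (D 1) ?Q" "maximal_subgroup {Z} (?Q\<lparr>carrier := D 1\<rparr>)"
        using that by (auto simp: unrefinable_chain_def less_Suc_eq numeral_2_eq_2)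
      then show False by (rule not_cyclic_maximal)
    qed
  qed
  show ?thesis
    unfolding group_depth_def by (rule Least_equality) (use chain lower in blast)+
qed

end

theorem theorem6:
  fixes n :: nat
  shows "\<exists>G p. prime p \<and> G = L2 p \<and>
    finite (carrier G) \<and> simple_group G \<and> \<not> comm_group G \<and>
    group_depth G = 3 \<and> group_length G > n"
proof -
  obtain p :: nat where p: "prime p" "p > 5" "p mod 8 = 3 \<or> p mod 8 = 5"
    "[trace_num (Suc n) + 2 ^ (3 ^ Suc n) = 0] (mod int p)" by (rule exists_suitable_prime)
  interpret SL2_prime p by unfold_locales (use p in auto)
  obtain y where y: "y \<in> carrier (G Mod Z)" "Zn.quot.ord y = 3 ^ Suc (Suc n)"
    using element_of_order_power_of_3(1)[OF p(4)] by blast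
  obtain s t where "[s\<^sup>2 = 10 * t\<^sup>2] (mod int p)" "\<not> [t = 0] (mod int p)"
    using element_of_order_power_of_3(2)[OF p(4)] by blast
  then have p5: "p mod 5 = 2 \<or> p mod 5 = 3"
    using residue_mod_5[OF p(1,2,3)] by (simp add: eqm_0_iff)
  have "\<not> [-1 = 0] (mod int p)" using one_not_0 by (simp add: eqm_0_iff)
  then obtain a b where "[a\<^sup>2 + 1 = -1 * b\<^sup>2] (mod int p)" by (rule squares_pigeonhole)
  then have ab: "[a\<^sup>2 + b\<^sup>2 = -1] (mod int p)" by (simp add: cong_iff_dvd_diff algebra_simps)
  obtain h where h: "[2 * h = 1] (mod int p)" using eqm_inverse[OF two_not_0] .
  interpret SL2_quaternions p a b h by unfold_locales (use ab h p p5 in auto)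
  have "Suc (Suc n) \<le> group_length (G Mod Z)"
    by (rule Zn.quot.group_length_ge_prime_power[OF finite_quot y]) auto
  then show ?thesis
    using p(1) L2_eq finite_quot simple_quot not_comm_quot depth_quot by (intro exI[of _ "G Mod Z"] exI[of _ p]) simp
qed

end
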